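(* Let $p\in\mathbb{C}^*$. Any finite non-trivial irreducible conformal module $V$ over $\mathcal{S}(p)$ must be free as a $\mathbb{C}[\partial]$-module, of rank $1$ or of rank $1+1$.
   Context: All vector spaces are over $\mathbb{C}$; $\mathbb{C}^*$ is the set of nonzero complex numbers, $\mathbb{Z}_+$ the nonnegative integers, $\mathbb{Z}_2=\{\bar0,\bar1\}$, and $|x|$ is the parity of a homogeneous element. A Lie conformal superalgebra is a $\mathbb{Z}_2$-graded $\mathbb{C}[\partial]$-module $S=S_{\bar0}\oplus S_{\bar1}$ with a $\mathbb{C}$-bilinear parity-preserving $\lambda$-bracket $[\cdot\,{}_\lambda\,\cdot]:S\otimes S\to\mathbb{C}[\lambda]\otimes S$ satisfying $[\partial a\,{}_\lambda\, b]=-\lambda[a\,{}_\lambda\, b]$, $[a\,{}_\lambda\,\partial b]=(\partial+\lambda)[a\,{}_\lambda\, b]$, $[a\,{}_\lambda\, b]=-(-1)^{|a||b|}[b\,{}_{-\lambda-\partial}\,a]$ and $[a\,{}_\lambda\,[b\,{}_\mu\, c]]=[[a\,{}_\lambda\, b]\,{}_{\lambda+\mu}\, c]+(-1)^{|a||b|}[b\,{}_\mu\,[a\,{}_\lambda\, c]]$. A conformal module over $S$ is a $\mathbb{Z}_2$-graded $\mathbb{C}[\partial]$-module $M=M_{\bar0}\oplus M_{\bar1}$ with a parity-preserving $\lambda$-action $S\otimes M\to\mathbb{C}[\lambda]\otimes M$ such that $(\partial a)\,{}_\lambda\, v=-\lambda\, a\,{}_\lambda\, v$, $a\,{}_\lambda(\partial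 v)=(\partial+\lambda)a\,{}_\lambda\, v$ and $a\,{}_\lambda(b\,{}_\mu\, v)-(-1)^{|a||b|}b\,{}_\mu(a\,{}_\lambda\, v)=[a\,{}_\lambda\, b]\,{}_{\lambda+\mu}\, v$. It is finite if finitely generated over $\mathbb{C}[\partial]$, irreducible if it has no submodules other than $0$ and itself, and non-trivial if the $\lambda$-action is not identically zero. Rank $1+1$ means that $M_{\bar0}$ and $M_{\bar1}$ both have rank $1$ over $\mathbb{C}[\partial]$; rank $1$ means that $M$ has rank $1$ over $\mathbb{C}[\partial]$. For $p\in\mathbb{C}^*$, $\mathcal{S}(p)$ is the Lie conformal superalgebra which is free over $\mathbb{C}[\partial]$ with even basis $\{L_i,W_i\mid i\in\mathbb{Z}_+\}$ and odd basis $\{G_i\mid i\in\mathbb{Z}_+\}$ and $[L_i\,{}_\lambda\, L_j]=((i+p)\partial+(i+j+2p)\lambda)L_{i+j}$, $[L_i\,{}_\lambda\, W_j]=((i+p)\partial+(i+j+p)\lambda)W_{i+j}$, $[L_i\,{}_\lambda\, G_j]=((i+p)\partial+(i+j+2p)\lambda)G_{i+j}$, $[W_i\,{}_\lambda\, G_j]=G_{i+j}$, $[W_i\,{}_\lambda\, W_j]=[G_i\,{}_\lambda\, G_j]=0$ (other brackets by skew-symmetry). *)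

theory Defs
  imports Complex_Main "HOL-Computational_Algebra.Polynomial" "HOL-Library.Z2"
begin

text \<open>
  The ring $\mathbb{C}[\partial]$ is \<^typ>\<open>complex poly\<close>, with \<open>\<partial>\<close> the indeterminate; a
  $\mathbb{C}[\partial]$-module is an instance of the locale \<^locale>\<open>module\<close> over this ring,
  and complex scalars act through constant polynomials.
  The space $\mathbb{C}[\lambda] \otimes M$ is \<open>'m poly\<close>: the coefficient at \<open>n\<close> is the one
  of $\lambda^n$.
\<close>

abbreviation partial_var :: "complex poly" ("\<partial>")
  where "\<partial> \<equiv> [:0, 1:]"

text \<open>
  Substitution of an element \<open>q\<close> of $\mathbb{C}[\partial]$ for $\lambda$ in an element of
  $\mathbb{C}[\lambda] \otimes M$. It covers both $\lambda := l \in \mathbb{C}$ (\<open>q = [:l:]\<close>) and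
  $\lambda := -l - \partial$ (\<open>q = - [:l:] - \<partial>\<close>), the powers of $\partial$ being applied to the
  coefficients in \<open>M\<close>.
\<close>

definition subst_lambda ::
    "(complex poly \<Rightarrow> 'm \<Rightarrow> 'm) \<Rightarrow> 'm::ab_group_add poly \<Rightarrow> complex poly \<Rightarrow> 'm"
  where "subst_lambda scale P q = (\<Sum>n\<le>degree P. scale (q ^ n) (coeff P n))"

text \<open>The sign $(-1)^{\alpha\beta}$, as a constant polynomial.\<close>

definition parity_sign :: "bit \<Rightarrow> bit \<Rightarrow> complex poly"
  where "parity_sign \<alpha> \<beta> = (if \<alpha> = 1 \<and> \<beta> = 1 then - 1 else 1)"

locale graded_module = module scale
  for scale :: "complex poly \<Rightarrow> 'm::ab_group_add \<Rightarrow> 'm" +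
  fixes gr :: "bit \<Rightarrow> 'm set"
  assumes subspace_gr: "subspace (gr \<alpha>)"
    and gr_disjoint: "gr 0 \<inter> gr 1 = {0}"
    and gr_sum: "\<exists>x\<in>gr 0. \<exists>y\<in>gr 1. v = x + y"
begin

definition finitely_generated :: bool
  where "finitely_generated \<longleftrightarrow> (\<exists>B. finite B \<and> span B = UNIV)"

definition free_module :: bool
  where "free_module \<longleftrightarrow> (\<exists>B. independent B \<and> span B = UNIV)"

text \<open>
  The rank of a submodule \<open>U\<close>, free or not, is the largest size of a
  $\mathbb{C}[\partial]$-linearly independent subset.
\<close>

definition has_rank :: "'m set \<Rightarrow> nat \<Rightarrow> bool"
  where "has_rank U n \<longleftrightarrow>
    (\<exists>B\<subseteq>U. independent B \<and> finite B \<and> card B = n) \<and>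
    (\<forall>B\<subseteq>U. independent B \<longrightarrow> finite B \<and> card B \<le> n)"

end

text \<open>
  The identities in $\lambda$, $\mu$ below that involve a substitution are stated for all complex
  values \<open>l\<close>, \<open>m\<close> of these variables; as both sides are polynomial in them, this is the same as
  equality of formal polynomials.
\<close>

locale lie_conformal_superalgebra = graded_module scale gr
  for scale :: "complex poly \<Rightarrow> 's::ab_group_add \<Rightarrow> 's" and gr :: "bit \<Rightarrow> 's set" +
  fixes br :: "'s \<Rightarrow> 's \<Rightarrow> 's poly"
  assumes br_add_left: "br (a + b) c = br a c + br b c"
    and br_add_right: "br a (b + c) = br a b + br a c"
    and br_const_left: "br (scale [:z:] a) b = map_poly (scale [:z:]) (br a b)"
    and br_const_right: "br a (scale [:z:] b) = map_poly (scale [:z:]) (br a b)"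
    and br_parity: "a \<in> gr \<alpha> \<Longrightarrow> b \<in> gr \<beta> \<Longrightarrow> coeff (br a b) n \<in> gr (\<alpha> + \<beta>)"
    and br_partial_left:
      "subst_lambda scale (br (scale \<partial> a) b) [:l:] =
        scale (- [:l:]) (subst_lambda scale (br a b) [:l:])"
    and br_partial_right:
      "subst_lambda scale (br a (scale \<partial> b)) [:l:] =
        scale (\<partial> + [:l:]) (subst_lambda scale (br a b) [:l:])"
    and br_skew: "a \<in> gr \<alpha> \<Longrightarrow> b \<in> gr \<beta> \<Longrightarrow>
      subst_lambda scale (br a b) [:l:] =
        - scale (parity_sign \<alpha> \<beta>) (subst_lambda scale (br b a) (- [:l:] - \<partial>))"
    and br_jacobi: "a \<in> gr \<alpha> \<Longrightarrow> b \<in> gr \<beta> \<Longrightarrow>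
      subst_lambda scale (br a (subst_lambda scale (br b c) [:m:])) [:l:] =
        subst_lambda scale (br (subst_lambda scale (br a b) [:l:]) c) [:l + m:] +
        scale (parity_sign \<alpha> \<beta>)
          (subst_lambda scale (br b (subst_lambda scale (br a c) [:l:])) [:m:])"
begin

definition br_at :: "'s \<Rightarrow> complex \<Rightarrow> 's \<Rightarrow> 's"
  where "br_at a l b = subst_lambda scale (br a b) [:l:]"

end

locale conformal_module =
  S: lie_conformal_superalgebra scaleS grS br + V: graded_module scaleV grV
  for scaleS :: "complex poly \<Rightarrow> 's::ab_group_add \<Rightarrow> 's" and grS :: "bit \<Rightarrow> 's set"
    and br :: "'s \<Rightarrow> 's \<Rightarrow> 's poly"
    and scaleV :: "complex poly \<Rightarrow> 'v::ab_group_add \<Rightarrow> 'v" and grV :: "bit \<Rightarrow> 'v set" +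
  fixes act :: "'s \<Rightarrow> 'v \<Rightarrow> 'v poly"
  assumes act_add_left: "act (a + b) v = act a v + act b v"
    and act_add_right: "act a (v + w) = act a v + act a w"
    and act_const_left: "act (scaleS [:z:] a) v = map_poly (scaleV [:z:]) (act a v)"
    and act_const_right: "act a (scaleV [:z:] v) = map_poly (scaleV [:z:]) (act a v)"
    and act_parity: "a \<in> grS \<alpha> \<Longrightarrow> v \<in> grV \<beta> \<Longrightarrow> coeff (act a v) n \<in> grV (\<alpha> + \<beta>)"
    and act_partial_left:
      "subst_lambda scaleV (act (scaleS \<partial> a) v) [:l:] =
        scaleV (- [:l:]) (subst_lambda scaleV (act a v) [:l:])"
    and act_partial_right:
      "subst_lambda scaleV (act a (scaleV \<partial> v)) [:l:] =
        scaleV (\<partial> + [:l:]) (subst_lambda scaleV (act a v) [:l:])"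
    and act_br: "a \<in> grS \<alpha> \<Longrightarrow> b \<in> grS \<beta> \<Longrightarrow>
      subst_lambda scaleV (act a (subst_lambda scaleV (act b v) [:m:])) [:l:] -
        scaleV (parity_sign \<alpha> \<beta>)
          (subst_lambda scaleV (act b (subst_lambda scaleV (act a v) [:l:])) [:m:]) =
        subst_lambda scaleV (act (subst_lambda scaleS (br a b) [:l:]) v) [:l + m:]"
begin

text \<open>As usual for superalgebras, submodules are \<open>\<int>\<^sub>2\<close>-graded.\<close>

definition submodule :: "'v set \<Rightarrow> bool"
  where "submodule U \<longleftrightarrow>
    V.subspace U \<and>
    (\<forall>v\<in>U. \<exists>x\<in>U \<inter> grV 0. \<exists>y\<in>U \<inter> grV 1. v = x + y) \<and>
    (\<forall>a. \<forall>v\<in>U. \<forall>n. coeff (act a v) n \<in> U)"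

definition irreducible :: bool
  where "irreducible \<longleftrightarrow> (\<forall>U. submodule U \<longrightarrow> U = {0} \<or> U = UNIV)"

definition non_trivial :: bool
  where "non_trivial \<longleftrightarrow> (\<exists>a v. act a v \<noteq> 0)"

end

datatype S_index = L nat | W nat | G nat

fun S_parity :: "S_index \<Rightarrow> bit"
  where "S_parity (L i) = 0" | "S_parity (W i) = 0" | "S_parity (G i) = 1"

text \<open>
  The Lie conformal superalgebra $\mathcal{S}(p)$, as a presentation: \<open>e\<close> is the homogeneous
  $\mathbb{C}[\partial]$-basis. The brackets not listed are determined by \<open>br_skew\<close>.
\<close>

locale S_algebra = lie_conformal_superalgebra scale gr br
  for scale :: "complex poly \<Rightarrow> 's::ab_group_add \<Rightarrow> 's" and gr :: "bit \<Rightarrow> 's set"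
    and br :: "'s \<Rightarrow> 's \<Rightarrow> 's poly" +
  fixes p :: complex and e :: "S_index \<Rightarrow> 's"
  assumes e_inj: "inj e"
    and e_independent: "independent (range e)"
    and e_span: "span (range e) = UNIV"
    and e_parity: "e k \<in> gr (S_parity k)"
    and br_L_L: "br_at (e (L i)) l (e (L j)) =
      scale ([:of_nat i + p:] * \<partial> + [:(of_nat i + of_nat j + 2 * p) * l:]) (e (L (i + j)))"
    and br_L_W: "br_at (e (L i)) l (e (W j)) =
      scale ([:of_nat i + p:] * \<partial> + [:(of_nat i + of_nat j + p) * l:]) (e (W (i + j)))"
    and br_L_G: "br_at (e (L i)) l (e (G j)) =
      scale ([:of_nat i + p:] * \<partial> + [:(of_nat i + of_nat j + 2 * p) * l:]) (e (G (i + j)))"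
    and br_W_G: "br_at (e (W i)) l (e (G j)) = e (G (i + j))"
    and br_W_W: "br_at (e (W i)) l (e (W j)) = 0"
    and br_G_G: "br_at (e (G i)) l (e (G j)) = 0"

end

theory Submission
  imports Defs "HOL-Computational_Algebra.Fundamental_Theorem_Algebra"
begin

text \<open>
  Write \<open>a\<^sub>\<lambda> v = \<Sum>\<^sub>n \<lambda>\<^sup>n / n! a\<^sub>(\<^sub>n\<^sub>) v\<close>. Torsion is annihilated by \<open>S\<close>, so \<open>V\<close> is torsion-free. With
  \<open>L = L\<^sub>0 / p\<close>, the operator \<open>\<partial> - L\<^sub>(\<^sub>0\<^sub>)\<close> commutes with everything, hence is a scalar \<open>\<alpha>\<close> by Schur's
  lemma, and \<open>L\<^sub>(\<^sub>1\<^sub>)\<close> acts as an Euler operator in \<open>\<partial> - \<alpha>\<close>. Eigenvectors of \<open>L\<^sub>(\<^sub>1\<^sub>)\<close> of minimal real part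
  yield a filtration of \<open>V\<close> by Virasoro modules with rank one quotients. A primary field between two
  rank one Virasoro modules vanishes for all but finitely many weights; since the weights of
  \<open>L\<^sub>i, W\<^sub>i, G\<^sub>i\<close> are injective in \<open>i\<close>, these act as zero for large \<open>i\<close>.

  A generator of maximal index then spans an abelian ideal. If it acts nontrivially, the Cheng--Kac
  argument produces a finite-dimensional space on which one of its modes is injective. That mode
  squares to zero if the generator is odd, and is a weight vector for \<open>L\<^sub>(\<^sub>1\<^sub>)\<close> or a commutator
  commuting with its factors if it is even, which is absurd. By descent only \<open>L\<^sub>0\<close>, the current
  \<open>W\<^sub>0\<close> and, for \<open>p = -1\<close>, the current \<open>L\<^sub>1\<close> survive; the zero modes
  of the currents are scalars, so a lowest weight vector generates a submodule of rank one, which is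
  all of \<open>V\<close>.
\<close>

section \<open>Linear algebra modulo a subspace\<close>

text \<open>Two obstacles shape the proof. The algebra has infinitely many generators, so arguments
  about finite-dimensional spaces of operators apply only after almost all of them are known to act
  as zero. And irreducibility says nothing about Virasoro submodules: vanishing of a primary field
  is proved on each rank one quotient of a Virasoro filtration and then lifted back. Quotients V/U
  are never formed; every statement is made modulo a subspace U. Finite-dimensionality comes from
  two sources: vectors killed by all late modes of a field (dimension bounded by the rank, since
  powers of \<partial> applied to them are independent), and the fibre V / (\<partial> - a) V. On a
  quotient C[\<partial>] v a primary field gives u_n = h_n v with polynomials h_n, and the Virasoro
  relations become differential equations for h_n. Comparing two formulas for h_2 yields a
  polynomial condition on the weight, whence the finite exceptional sets. The special role of p = -1
  has this origin: L_i is a current exactly when p = -i, and its zero mode is then a commutator of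
  modes of L_1 and L_(i-1) if i \<ge> 2, but not in this way if i = 1.\<close>

locale complex_space = vector_space scl
  for scl :: "complex \<Rightarrow> 'v::ab_group_add \<Rightarrow> 'v"
begin

abbreviation lin :: "('v \<Rightarrow> 'v) \<Rightarrow> bool"
  where "lin \<equiv> module_hom scl scl"

lemma linI:
  assumes "\<And>x y. T (x + y) = T x + T y" "\<And>c x. T (scl c x) = scl c (T x)"
  shows "lin T"
  using assms by unfold_locales auto

lemma lin_minus_scalar: "lin T \<Longrightarrow> lin (\<lambda>x. T x - scl c x)"
  by (intro linI) (simp_all add: module_hom.add module_hom.scale scale_right_distrib
      scale_right_diff_distrib mult.commute)

text \<open>\<open>dim_le_mod r K U\<close>: the image of \<open>K\<close> in the quotient by \<open>U\<close> has dimension at most \<open>r\<close>.\<close>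

definition dim_le_mod :: "nat \<Rightarrow> 'v set \<Rightarrow> 'v set \<Rightarrow> bool"
  where "dim_le_mod r K U \<longleftrightarrow>
    (\<forall>x. (\<forall>i\<le>r. x i \<in> K) \<longrightarrow> (\<exists>c. (\<exists>i\<le>r. c i \<noteq> 0) \<and> (\<Sum>i\<le>r. scl (c i) (x i)) \<in> U))"

lemma dim_le_modD:
  assumes "dim_le_mod r K U" "\<And>i. i \<le> r \<Longrightarrow> x i \<in> K"
  obtains c j where "j \<le> r" "c j \<noteq> 0" "(\<Sum>i\<le>r. scl (c i) (x i)) \<in> U"
  using assms unfolding dim_le_mod_def by metis

lemma dim_le_mod_mono: "dim_le_mod r K U \<Longrightarrow> K' \<subseteq> K \<Longrightarrow> dim_le_mod r K' U"
  unfolding dim_le_mod_def by (meson subsetD)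

definition poly_op :: "('v \<Rightarrow> 'v) \<Rightarrow> complex poly \<Rightarrow> 'v \<Rightarrow> 'v"
  where "poly_op T P x = (\<Sum>i\<le>degree P. scl (coeff P i) ((T ^^ i) x))"

lemma poly_op_eq:
  assumes "degree P \<le> n"
  shows "poly_op T P x = (\<Sum>i\<le>n. scl (coeff P i) ((T ^^ i) x))"
  unfolding poly_op_def using assms
  by (intro sum.mono_neutral_left) (auto simp: coeff_eq_0)

lemma poly_op_linear_factor:
  assumes "lin T"
  shows "poly_op T ([:- c, 1:] * Q) x = T (poly_op T Q x) - scl c (poly_op T Q x)"
proof -
  define n where "n = degree Q"
  have "degree ([:- c, 1:] * Q) \<le> Suc n"
    unfolding n_def by (rule order.trans[OF degree_mult_le]) simp
  then have "poly_op T ([:- c, 1:] * Q) x =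
      (\<Sum>i\<le>Suc n. scl (coeff ([:- c, 1:] * Q) i) ((T ^^ i) x))"
    by (rule poly_op_eq)
  also have "\<dots> = (\<Sum>i\<le>Suc n. scl (coeff (pCons 0 Q) i) ((T ^^ i) x))
      - (\<Sum>i\<le>Suc n. scl (c * coeff Q i) ((T ^^ i) x))"
    by (simp add: scale_left_distrib scale_left_diff_distrib sum.distrib sum_subtractf flip: sum_negf)
  also have "(\<Sum>i\<le>Suc n. scl (coeff (pCons 0 Q) i) ((T ^^ i) x)) =
      (\<Sum>i\<le>n. scl (coeff Q i) ((T ^^ Suc i) x))"
    by (subst sum.atMost_Suc_shift) simp
  also have "\<dots> = T (poly_op T Q x)"
    by (simp add: poly_op_def n_def module_hom.sum[OF assms] module_hom.scale[OF assms])
  also have "(\<Sum>i\<le>Suc n. scl (c * coeff Q i) ((T ^^ i) x)) = scl c (poly_op T Q x)"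
    using poly_op_eq[where P = Q and n = "Suc n" and T = T and x = x]
    by (simp add: scale_sum_right scale_right_distrib n_def)
  finally show ?thesis .
qed

text \<open>The vectors \<open>(T ^^ i) x0\<close> are dependent modulo U, so some nonzero
  polynomial in T carries a vector of K outside U into U. If its degree is least, splitting off a
  root leaves a vector that is still outside U, and this is the eigenvector.\<close>

lemma eigenvector_mod:
  assumes T: "lin T" and stab: "\<And>x. x \<in> K \<Longrightarrow> T x \<in> K"
    and K: "subspace K" and U: "subspace U" and fin: "dim_le_mod r K U"
    and x0: "x0 \<in> K" "x0 \<notin> U"
  obtains x c where "x \<in> K" "x \<notin> U" "T x - scl c x \<in> U"
proof -
  have pow: "(T ^^ i) x \<in> K" if "x \<in> K" for i x
    by (induction i) (use that stab in auto)
  have opK: "poly_op T P x \<in> K" if "x \<in> K" for P x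
    unfolding poly_op_def by (intro subspace_sum[OF K] subspace_scale[OF K] pow that)
  obtain c j where c: "j \<le> r" "c j \<noteq> 0" "(\<Sum>i\<le>r. scl (c i) ((T ^^ i) x0)) \<in> U"
    using dim_le_modD[OF fin, of "\<lambda>i. (T ^^ i) x0"] pow[OF x0(1)] by blast
  define P where "P = (\<Sum>i\<le>r. monom (c i) i)"
  have coP: "coeff P i = (if i \<le> r then c i else 0)" for i
    unfolding P_def by (simp add: coeff_sum)
  have "degree P \<le> r" by (rule degree_le) (simp add: coP)
  from poly_op_eq[OF this] have "poly_op T P x0 \<in> U" using c by (simp add: coP)
  moreover have "P \<noteq> 0" using c coP[of j] by auto
  ultimately have ex: "\<exists>d P x. P \<noteq> 0 \<and> degree P = d \<and> x \<in> K \<and> x \<notin> U \<and> poly_op T P x \<in> U"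
    using x0 by blast
  define d where "d = (LEAST d. \<exists>P x. P \<noteq> 0 \<and> degree P = d \<and> x \<in> K \<and> x \<notin> U \<and> poly_op T P x \<in> U)"
  obtain P x where P: "P \<noteq> 0" "degree P = d" "x \<in> K" "x \<notin> U" "poly_op T P x \<in> U"
    using LeastI_ex[OF ex] unfolding d_def by blast
  have minimal: "d \<le> degree Q" if "Q \<noteq> 0" "y \<in> K" "y \<notin> U" "poly_op T Q y \<in> U" for Q y
    unfolding d_def by (rule Least_le) (use that in blast)
  have "d \<noteq> 0"
  proof
    assume "d = 0"
    then obtain a where a: "P = [:a:]" using P(2) degree_eq_zeroE by blast
    then have "scl a x \<in> U" "a \<noteq> 0" using P by (auto simp: poly_op_def)
    then have "scl (inverse a) (scl a x) \<in> U" using subspace_scale[OF U] by blast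
    then show False using \<open>a \<noteq> 0\<close> P by simp
  qed
  then have "\<not> constant (poly P)" using P(2) constant_degree by metis
  then obtain z where "poly P z = 0" using fundamental_theorem_of_algebra by blast
  then obtain Q where Q: "P = [:- z, 1:] * Q" using poly_eq_0_iff_dvd by (metis dvdE)
  then have "Q \<noteq> 0" using P by auto
  then have "degree Q < d" using P(2) unfolding Q by (subst (asm) degree_mult_eq) auto
  then have "poly_op T Q x \<notin> U" using minimal[OF \<open>Q \<noteq> 0\<close> P(3,4)] by linarith
  moreover have "T (poly_op T Q x) - scl z (poly_op T Q x) \<in> U"
    using P(5) unfolding Q poly_op_linear_factor[OF T] .
  ultimately show thesis using that opK[OF P(3)] by blast
qed

text \<open>T minus \<open>ev n\<close> preserves U, kills the last vector modulo U and multiplies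
  the others by nonzero factors, which drives the induction.\<close>

lemma eigenvectors_independent_mod:
  fixes n :: nat
  assumes T: "lin T" and stab: "\<And>x. x \<in> U \<Longrightarrow> T x \<in> U" and U: "subspace U"
    and eig: "\<And>i. i < n \<Longrightarrow> x i \<notin> U \<and> T (x i) - scl (ev i) (x i) \<in> U"
    and inj: "inj_on ev {..<n}"
    and rel: "(\<Sum>i<n. scl (c i) (x i)) \<in> U"
  shows "\<forall>i<n. c i = 0"
  using eig inj rel
proof (induction n arbitrary: c)
  case (Suc n)
  let ?S = "\<Sum>i<Suc n. scl (c i) (x i)"
  have "T ?S - scl (ev n) ?S \<in> U"
    using Suc.prems(3) by (intro subspace_diff[OF U] subspace_scale[OF U] stab)
  also have "T ?S - scl (ev n) ?S =
      (\<Sum>i<Suc n. scl (c i) (T (x i) - scl (ev i) (x i)) + scl (c i * (ev i - ev n)) (x i))"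
    unfolding module_hom.sum[OF T] scale_sum_right sum_subtractf[symmetric]
    by (intro sum.cong refl)
      (simp add: module_hom.scale[OF T] scale_right_diff_distrib scale_left_diff_distrib
        right_diff_distrib mult.commute)
  also have "\<dots> = (\<Sum>i<Suc n. scl (c i) (T (x i) - scl (ev i) (x i))) +
      (\<Sum>i<n. scl (c i * (ev i - ev n)) (x i))"
    by (simp add: sum.distrib)
  finally have "(\<Sum>i<Suc n. scl (c i) (T (x i) - scl (ev i) (x i))) +
      (\<Sum>i<n. scl (c i * (ev i - ev n)) (x i)) \<in> U" .
  moreover have "(\<Sum>i<Suc n. scl (c i) (T (x i) - scl (ev i) (x i))) \<in> U"
    using Suc.prems(1) by (intro subspace_sum[OF U] subspace_scale[OF U]) auto
  ultimately have "(\<Sum>i<n. scl (c i * (ev i - ev n)) (x i)) \<in> U"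
    using subspace_diff[OF U] by (metis add_diff_cancel_left')
  then have "\<forall>i<n. c i * (ev i - ev n) = 0"
    using Suc.prems by (intro Suc.IH) (auto simp: inj_on_def)
  moreover have "ev i \<noteq> ev n" if "i < n" for i
    using Suc.prems(2) that by (auto simp: inj_on_def)
  ultimately have z: "\<forall>i<n. c i = 0" by auto
  then have "scl (c n) (x n) \<in> U" using Suc.prems(3) by simp
  then have "scl (inverse (c n)) (scl (c n) (x n)) \<in> U" using subspace_scale[OF U] by blast
  then have "c n = 0" using Suc.prems(1)[of n] by (cases "c n = 0") auto
  then show ?case using z by (simp add: less_Suc_eq)
qed simp

lemma too_many_eigenvectors_mod:
  assumes "lin T" "\<And>x. x \<in> U \<Longrightarrow> T x \<in> U" "subspace U" "dim_le_mod r K U"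
    and eig: "\<And>i. i \<le> r \<Longrightarrow> x i \<in> K \<and> x i \<notin> U \<and> T (x i) - scl (ev i) (x i) \<in> U"
    and inj: "inj_on ev {..r}"
  shows False
proof -
  obtain c j where c: "j \<le> r" "c j \<noteq> 0" "(\<Sum>i\<le>r. scl (c i) (x i)) \<in> U"
    using dim_le_modD[OF assms(4)] eig by blast
  have "\<forall>i<Suc r. c i = 0"
    using assms(1-3) c(3) eig inj by (intro eigenvectors_independent_mod[of T U "Suc r" x ev])
      (auto simp: lessThan_Suc_atMost)
  then show False using c by auto
qed

lemma finite_eigenvalues_mod:
  assumes "lin T" "\<And>x. x \<in> U \<Longrightarrow> T x \<in> U" "subspace U" "dim_le_mod r K U"
  shows "finite {c. \<exists>x\<in>K. x \<notin> U \<and> T x - scl c x \<in> U}" (is "finite ?A")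
proof (rule ccontr)
  assume "infinite ?A"
  then obtain B where B: "B \<subseteq> ?A" "finite B" "card B = Suc r"
    using infinite_arbitrarily_large by blast
  obtain ev where ev: "bij_betw ev {0..<Suc r} B"
    using ex_bij_betw_nat_finite[OF B(2)] B(3) by metis
  have "\<exists>x\<in>K. x \<notin> U \<and> T x - scl (ev i) x \<in> U" if "i \<le> r" for i
  proof -
    have "ev i \<in> B" using bij_betwE[OF ev] that by auto
    then show ?thesis using B(1) by blast
  qed
  then obtain x where "\<And>i. i \<le> r \<Longrightarrow> x i \<in> K \<and> x i \<notin> U \<and> T (x i) - scl (ev i) (x i) \<in> U"
    by metis
  moreover have "{..r} = {0..<Suc r}" by auto
  then have "inj_on ev {..r}" using ev by (simp add: bij_betw_def)
  ultimately show False using too_many_eigenvectors_mod[OF assms] by blast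
qed

text \<open>Z raises eigenvalues of E by c, so its injectivity turns one eigenvector into infinitely
  many with distinct eigenvalues.\<close>

lemma no_injective_shift:
  assumes E: "lin E" "\<And>x. x \<in> K \<Longrightarrow> E x \<in> K"
    and Z: "lin Z" "\<And>x. x \<in> K \<Longrightarrow> Z x \<in> K" "\<And>x. x \<in> K \<Longrightarrow> Z x = 0 \<Longrightarrow> x = 0"
    and comm: "\<And>x. x \<in> K \<Longrightarrow> E (Z x) = Z (E x) + scl c (Z x)" "c \<noteq> 0"
    and K: "subspace K" "dim_le_mod r K {0}" "x0 \<in> K" "x0 \<noteq> 0"
  shows False
proof -
  obtain x a where x: "x \<in> K" "x \<noteq> 0" "E x - scl a x = 0"
    using eigenvector_mod[OF E K(1) subspace_single_0 K(2,3)] K(4) by auto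
  have zk: "(Z ^^ n) x \<in> K \<and> (Z ^^ n) x \<noteq> 0 \<and>
      E ((Z ^^ n) x) = scl (a + of_nat n * c) ((Z ^^ n) x)" for n
  proof (induction n)
    case (Suc n)
    then show ?case using Z(2,3) comm(1)[of "(Z ^^ n) x"]
      by (auto simp: module_hom.add[OF Z(1)] module_hom.scale[OF Z(1)] scale_left_distrib algebra_simps)
  qed (use x in auto)
  show False
    by (rule too_many_eigenvectors_mod[OF E(1) _ subspace_single_0 K(2),
          of "\<lambda>n. (Z ^^ n) x" "\<lambda>n. a + of_nat n * c"])
      (use zk comm(2) module_hom.zero[OF E(1)] in \<open>auto simp: inj_on_def\<close>)
qed

text \<open>A trace-free proof that the Weyl relation has no nonzero finite-dimensional
  representation: if x is an eigenvector of Y with eigenvalue a, then Y - a acts on the vectors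
  \<open>(X ^^ n) x\<close> as c times differentiation in X, so these vectors are
  independent.\<close>

lemma no_findim_Weyl:
  assumes X: "lin X" "\<And>x. x \<in> K \<Longrightarrow> X x \<in> K"
    and Y: "lin Y" "\<And>x. x \<in> K \<Longrightarrow> Y x \<in> K"
    and comm: "\<And>x. x \<in> K \<Longrightarrow> Y (X x) = X (Y x) + scl c x" "c \<noteq> 0"
    and K: "subspace K" "dim_le_mod r K {0}" "x0 \<in> K" "x0 \<noteq> 0"
  shows False
proof -
  obtain x a where x: "x \<in> K" "x \<noteq> 0" "Y x - scl a x = 0"
    using eigenvector_mod[OF Y K(1) subspace_single_0 K(2,3)] K(4) by auto
  have xk: "(X ^^ n) x \<in> K" for n
    by (induction n) (use x X in auto)
  have yx: "Y ((X ^^ n) x) = scl a ((X ^^ n) x) + scl (of_nat n * c) ((X ^^ (n - 1)) x)" for n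
  proof (induction n)
    case (Suc n)
    have "scl (of_nat n * c) (X ((X ^^ (n - 1)) x)) = scl (of_nat n * c) ((X ^^ n) x)"
      by (cases n) auto
    moreover have "of_nat (Suc n) * c = of_nat n * c + c" by (simp add: algebra_simps)
    ultimately show ?case
      using Suc comm(1)[OF xk[of n]]
      by (simp del: of_nat_Suc add: module_hom.add[OF X(1)] module_hom.scale[OF X(1)]
          scale_left_distrib)
  qed (use x in auto)
  have indep: "\<forall>k<n. b k = 0" if "(\<Sum>k<n. scl (b k) ((X ^^ k) x)) = 0" for b n
    using that
  proof (induction n arbitrary: b)
    case (Suc n)
    let ?S = "\<Sum>k<Suc n. scl (b k) ((X ^^ k) x)"
    have "Y ?S - scl a ?S = 0" using Suc.prems module_hom.zero[OF Y(1)] by simp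
    also have "Y ?S - scl a ?S = (\<Sum>k<Suc n. scl (b k * (of_nat k * c)) ((X ^^ (k - 1)) x))"
      unfolding module_hom.sum[OF Y(1)] scale_sum_right sum_subtractf[symmetric]
      by (intro sum.cong refl)
        (simp add: module_hom.scale[OF Y(1)] yx scale_right_distrib mult.commute)
    also have "\<dots> = (\<Sum>k<n. scl (b (Suc k) * (of_nat (Suc k) * c)) ((X ^^ k) x))"
      by (subst sum.lessThan_Suc_shift) simp
    finally have "\<forall>k<n. b (Suc k) * (of_nat (Suc k) * c) = 0" by (intro Suc.IH) simp
    then have *: "\<forall>k<n. b (Suc k) = 0" using comm(2) by (simp del: of_nat_Suc)
    then have "scl (b 0) x = 0" using Suc.prems by (subst (asm) sum.lessThan_Suc_shift) simp
    then have "b 0 = 0" using x(2) by simp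
    show ?case
    proof (intro allI impI)
      fix k assume "k < Suc n"
      then show "b k = 0" using * \<open>b 0 = 0\<close> by (cases k) auto
    qed
  qed simp
  obtain b j where "j \<le> r" "b j \<noteq> 0" "(\<Sum>k\<le>r. scl (b k) ((X ^^ k) x)) = 0"
    using dim_le_modD[OF K(2), of "\<lambda>k. (X ^^ k) x"] xk by (metis singletonD)
  then show False using indep[of b "Suc r"] by (auto simp: lessThan_Suc_atMost)
qed

text \<open>X and Y preserve each eigenspace of Z, where the relation becomes the Weyl relation with
  constant \<open>c * a\<close>; the eigenvalue a is nonzero because Z is injective.\<close>

lemma no_injective_commutator:
  assumes X: "lin X" "\<And>x. x \<in> K \<Longrightarrow> X x \<in> K"
    and Y: "lin Y" "\<And>x. x \<in> K \<Longrightarrow> Y x \<in> K"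
    and Z: "lin Z" "\<And>x. x \<in> K \<Longrightarrow> Z x \<in> K" "\<And>x. x \<in> K \<Longrightarrow> Z x = 0 \<Longrightarrow> x = 0"
    and comm: "\<And>x. x \<in> K \<Longrightarrow> Y (X x) = X (Y x) + scl c (Z x)" "c \<noteq> 0"
    and ZX: "\<And>x. x \<in> K \<Longrightarrow> Z (X x) = X (Z x)" and ZY: "\<And>x. x \<in> K \<Longrightarrow> Z (Y x) = Y (Z x)"
    and K: "subspace K" "dim_le_mod r K {0}" "x0 \<in> K" "x0 \<noteq> 0"
  shows False
proof -
  obtain x a where x: "x \<in> K" "x \<noteq> 0" "Z x - scl a x = 0"
    using eigenvector_mod[OF Z(1,2) K(1) subspace_single_0 K(2,3)] K(4) by auto
  then have a: "a \<noteq> 0" using Z(3)[of x] by auto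
  define K' where "K' = {x \<in> K. Z x = scl a x}"
  have sub: "subspace K'"
    unfolding K'_def subspace_def
    by (auto simp: subspace_0[OF K(1)] subspace_add[OF K(1)] subspace_scale[OF K(1)]
        module_hom.add[OF Z(1)] module_hom.scale[OF Z(1)] module_hom.zero[OF Z(1)]
        scale_right_distrib mult.commute)
  show False
  proof (rule no_findim_Weyl[of X K' Y "c * a" r x])
    show "X y \<in> K'" if "y \<in> K'" for y
      using that X ZX module_hom.scale[OF X(1)] by (auto simp: K'_def)
    show "Y y \<in> K'" if "y \<in> K'" for y
      using that Y ZY module_hom.scale[OF Y(1)] by (auto simp: K'_def)
    show "dim_le_mod r K' {0}" using K(2) by (rule dim_le_mod_mono) (auto simp: K'_def)
    show "Y (X y) = X (Y y) + scl (c * a) y" if "y \<in> K'" for y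
      using that comm(1)[of y] by (simp add: K'_def)
  qed (use x X(1) Y(1) sub a comm(2) in \<open>auto simp: K'_def\<close>)
qed

end

section \<open>Conformal operators on modules over the polynomial ring\<close>

text \<open>Gaussian elimination without fractions: the pivot \<open>a j b\<close> clears column b
  by cross-multiplication. Solutions of the smaller system, multiplied by the pivot, stay nonzero in
  a domain, and the coefficient at j is chosen so that column b cancels.\<close>

lemma exists_dependence:
  fixes a :: "'i \<Rightarrow> 'b \<Rightarrow> 'r::idom"
  assumes "finite B" "finite I" "card B < card I"
  shows "\<exists>q. (\<exists>i\<in>I. q i \<noteq> 0) \<and> (\<forall>b\<in>B. (\<Sum>i\<in>I. q i * a i b) = 0)"
  using assms
proof (induction B arbitrary: I a rule: finite_induct)
  case empty
  then have "I \<noteq> {}" by auto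
  then show ?case by (intro exI[of _ "\<lambda>_. 1"]) auto
next
  case (insert b B)
  show ?case
  proof (cases "\<exists>j\<in>I. a j b \<noteq> 0")
    case False
    have "card B < card I" using insert by simp
    then obtain q where "\<exists>i\<in>I. q i \<noteq> 0" "\<forall>b\<in>B. (\<Sum>i\<in>I. q i * a i b) = 0"
      using insert.IH[OF insert.prems(1), of a] by blast
    then show ?thesis using False by (intro exI[of _ q]) auto
  next
    case True
    then obtain j where j: "j \<in> I" "a j b \<noteq> 0" by blast
    define I' where "I' = I - {j}"
    have I': "finite I'" "j \<notin> I'" "I = insert j I'" using insert.prems j by (auto simp: I'_def)
    have "card B < card I'" using insert.prems insert.hyps I' by auto
    then obtain q where q: "\<exists>i\<in>I'. q i \<noteq> 0"
        "\<forall>c\<in>B. (\<Sum>i\<in>I'. q i * (a j b * a i c - a i b * a j c)) = 0"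
      using insert.IH[OF I'(1), of "\<lambda>i c. a j b * a i c - a i b * a j c"] by blast
    define Q where "Q = (\<lambda>i. if i = j then - (\<Sum>i\<in>I'. q i * a i b) else a j b * q i)"
    have Qsum: "(\<Sum>i\<in>I. Q i * a i c) =
        (\<Sum>i\<in>I'. q i * (a j b * a i c - a i b * a j c))" for c
    proof -
      have "(\<Sum>i\<in>I'. Q i * a i c) = (\<Sum>i\<in>I'. a j b * q i * a i c)"
        using I' by (intro sum.cong) (auto simp: Q_def)
      then have "(\<Sum>i\<in>I. Q i * a i c) =
          - (\<Sum>i\<in>I'. q i * a i b) * a j c + (\<Sum>i\<in>I'. a j b * q i * a i c)"
        using I' by (simp add: Q_def)
      then show ?thesis
        by (simp add: sum_distrib_left sum_subtractf right_diff_distrib mult_ac)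
    qed
    have "(\<Sum>i\<in>I. Q i * a i c) = 0" if "c \<in> insert b B" for c
    proof (cases "c = b")
      case True
      then show ?thesis unfolding Qsum by (intro sum.neutral) (simp add: mult_ac)
    next
      case False
      then show ?thesis unfolding Qsum using that q(2) by auto
    qed
    moreover have "\<exists>i\<in>I. Q i \<noteq> 0" using q(1) I' j(2) by (auto simp: Q_def)
    ultimately show ?thesis by blast
  qed
qed

locale poly_module = module scale
  for scale :: "complex poly \<Rightarrow> 'v::ab_group_add \<Rightarrow> 'v"
begin

text \<open>Mode operators are linear over the complex numbers but not over polynomials, so the
  linear algebra above is imported through constant polynomials.\<close>

sublocale C: complex_space "\<lambda>z. scale [:z:]"
  by unfold_locales
    (simp_all add: scale_right_distrib mult.commute flip: scale_left_distrib one_pCons)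

lemma subspace_imp_complex: "subspace U \<Longrightarrow> C.subspace U"
  unfolding subspace_def C.subspace_def by blast

lemma subspace_cancel_left: "subspace U \<Longrightarrow> x + y \<in> U \<Longrightarrow> x \<in> U \<Longrightarrow> y \<in> U"
  and subspace_cancel_right: "subspace U \<Longrightarrow> x + y \<in> U \<Longrightarrow> y \<in> U \<Longrightarrow> x \<in> U"
  using subspace_diff[of U "x + y" x] subspace_diff[of U "x + y" y] by simp_all

lemma scale_pCons: "scale (pCons a q) x = scale [:a:] x + scale \<partial> (scale q x)"
proof -
  have "pCons a q = [:a:] + \<partial> * q" by simp
  then show ?thesis by (metis scale_left_distrib scale_scale)
qed

lemma scale_as_sum: "scale q x = (\<Sum>i\<le>degree q. scale [:coeff q i:] (scale (\<partial> ^ i) x))"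
proof -
  have "scale q x = scale (\<Sum>i\<le>degree q. monom (coeff q i) i) x"
    by (simp add: poly_as_sum_of_monoms)
  then show ?thesis by (simp add: scale_sum_left monom_altdef)
qed

lemma subspace_closedI:
  assumes "C.subspace U" "\<And>x. x \<in> U \<Longrightarrow> scale \<partial> x \<in> U"
  shows "subspace U"
proof (rule subspaceI)
  show "scale q x \<in> U" if "x \<in> U" for q x
  proof (induction q)
    case 0
    then show ?case using C.subspace_0[OF assms(1)] by simp
  next
    case (pCons a q)
    then show ?case
      unfolding scale_pCons[of a q]
      using that by (intro C.subspace_add[OF assms(1)] C.subspace_scale[OF assms(1)] assms(2))
  qed
qed (use assms(1) in \<open>auto simp: C.subspace_def\<close>)

text \<open>
  The sequence of operators \<open>a\<^sub>(\<^sub>n\<^sub>)\<close> attached to \<open>a \<in> S\<close> by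
  \<open>a\<^sub>\<lambda> v = \<Sum>\<^sub>n \<lambda>\<^sup>n / n! a\<^sub>(\<^sub>n\<^sub>) v\<close>.
\<close>

definition conformal_op :: "(nat \<Rightarrow> 'v \<Rightarrow> 'v) \<Rightarrow> bool"
  where "conformal_op T \<longleftrightarrow> (\<forall>n. C.lin (T n)) \<and>
    (\<forall>n x. T n (scale \<partial> x) = scale \<partial> (T n x) + scale [:of_nat n:] (T (n - 1) x)) \<and>
    (\<forall>x. \<exists>N. \<forall>n\<ge>N. T n x = 0)"

lemma conformal_op_lin: "conformal_op T \<Longrightarrow> C.lin (T n)"
  and conformal_op_partial:
    "conformal_op T \<Longrightarrow> T n (scale \<partial> x) = scale \<partial> (T n x) + scale [:of_nat n:] (T (n - 1) x)"
  and conformal_op_nil: "conformal_op T \<Longrightarrow> \<exists>N. \<forall>n\<ge>N. T n x = 0"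
  unfolding conformal_op_def by blast+

lemma conformal_op_add: "conformal_op T \<Longrightarrow> T n (x + y) = T n x + T n y"
  and conformal_op_diff: "conformal_op T \<Longrightarrow> T n (x - y) = T n x - T n y"
  and conformal_op_const: "conformal_op T \<Longrightarrow> T n (scale [:c:] x) = scale [:c:] (T n x)"
  and conformal_op_zero: "conformal_op T \<Longrightarrow> T n 0 = 0"
  and conformal_op_sum: "conformal_op T \<Longrightarrow> T n (sum f A) = (\<Sum>a\<in>A. T n (f a))"
  by (simp_all add: module_hom.add[OF conformal_op_lin] module_hom.diff[OF conformal_op_lin]
      module_hom.scale[OF conformal_op_lin] module_hom.zero[OF conformal_op_lin]
      module_hom.sum[OF conformal_op_lin])

text \<open>Only a complex subspace results: by \<open>conformal_op_partial\<close>, multiplication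
  by \<partial> can move the last surviving mode up by one.\<close>

lemma complex_subspace_truncation:
  assumes T: "conformal_op T" and U: "subspace U"
  shows "C.subspace {x. \<forall>n\<ge>M. T n x \<in> U}"
  unfolding C.subspace_def
proof (intro conjI ballI allI)
  show "0 \<in> {x. \<forall>n\<ge>M. T n x \<in> U}"
    using subspace_0[OF U] by (simp add: conformal_op_zero[OF T])
  show "x + y \<in> {x. \<forall>n\<ge>M. T n x \<in> U}"
    if "x \<in> {x. \<forall>n\<ge>M. T n x \<in> U}" "y \<in> {x. \<forall>n\<ge>M. T n x \<in> U}" for x y
    using that subspace_add[OF U] by (simp add: conformal_op_add[OF T])
  show "scale [:c:] x \<in> {x. \<forall>n\<ge>M. T n x \<in> U}" if "x \<in> {x. \<forall>n\<ge>M. T n x \<in> U}" for c x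
    using that subspace_scale[OF U] by (simp add: conformal_op_const[OF T])
qed

lemma subspace_preimage:
  assumes T: "conformal_op T" and U: "subspace U"
  shows "subspace {x. \<forall>n. T n x \<in> U}"
proof (rule subspace_closedI)
  show "C.subspace {x. \<forall>n. T n x \<in> U}"
    using complex_subspace_truncation[OF assms, of 0] by simp
  show "scale \<partial> x \<in> {x. \<forall>n. T n x \<in> U}" if "x \<in> {x. \<forall>n. T n x \<in> U}" for x
    using that subspace_add[OF U] subspace_scale[OF U] by (simp add: conformal_op_partial[OF T])
qed

text \<open>The constant is (M + 1) (M + 2) ... (M + k), the product of the factors that
  \<open>conformal_op_partial\<close> produces at the top index. So the top mode detects the highest
  power of \<partial>.\<close>

lemma conformal_op_partial_power:
  assumes T: "conformal_op T" and U: "subspace U" and y: "\<And>n. n > M \<Longrightarrow> T n y \<in> U"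
  shows "(\<forall>m>M + k. T m (scale (\<partial> ^ k) y) \<in> U) \<and>
    (\<exists>c. c \<noteq> 0 \<and> T (M + k) (scale (\<partial> ^ k) y) - scale [:c:] (T M y) \<in> U)"
proof (induction k)
  case 0
  show ?case using y subspace_0[OF U] by (auto intro!: exI[of _ 1] simp flip: one_pCons)
next
  case (Suc k)
  then obtain c where c: "c \<noteq> 0" "T (M + k) (scale (\<partial> ^ k) y) - scale [:c:] (T M y) \<in> U"
    by blast
  have step: "T m (scale (\<partial> ^ Suc k) y) =
      scale \<partial> (T m (scale (\<partial> ^ k) y)) + scale [:of_nat m:] (T (m - 1) (scale (\<partial> ^ k) y))" for m
    using conformal_op_partial[OF T, of m "scale (\<partial> ^ k) y"] by simp
  have 1: "T m (scale (\<partial> ^ Suc k) y) \<in> U" if "m > M + Suc k" for m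
    unfolding step using that Suc by (intro subspace_add[OF U] subspace_scale[OF U]) auto
  let ?m = "M + Suc k"
  have "scale \<partial> (T ?m (scale (\<partial> ^ k) y)) + scale [:of_nat ?m:]
      (T (M + k) (scale (\<partial> ^ k) y) - scale [:c:] (T M y)) \<in> U"
    using Suc c by (intro subspace_add[OF U] subspace_scale[OF U]) auto
  then have "T ?m (scale (\<partial> ^ Suc k) y) - scale [:of_nat ?m * c:] (T M y) \<in> U"
    unfolding step by (simp add: scale_right_diff_distrib algebra_simps)
  moreover have "of_nat ?m * c \<noteq> 0" using c by (simp del: of_nat_Suc add: of_nat_eq_0_iff)
  ultimately show ?case using 1 by blast
qed

text \<open>If M is the last index with \<open>T M y\<close> outside U, the mode of index M +
  \<open>degree q\<close> of \<open>scale q y\<close> is a nonzero multiple of \<open>T M y\<close>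
  modulo U. For U = {0} this says that every mode kills torsion; for larger U it is the source of
  torsion-free quotients.\<close>

lemma conformal_op_leading:
  assumes T: "conformal_op T" and U: "subspace U" and q: "q \<noteq> 0"
    and qy: "\<And>n. T n (scale q y) \<in> U"
  shows "T n y \<in> U"
proof (rule ccontr)
  assume n: "T n y \<notin> U"
  obtain N where N: "\<forall>n\<ge>N. T n y = 0" using conformal_op_nil[OF T] by blast
  define M where "M = (GREATEST n. T n y \<notin> U)"
  have bd: "\<forall>n. T n y \<notin> U \<longrightarrow> n \<le> N"
    using N subspace_0[OF U] by (metis nle_le)
  have M: "T M y \<notin> U" unfolding M_def using GreatestI_nat[of "\<lambda>n. T n y \<notin> U", OF n] bd by blast
  have gt: "T m y \<in> U" if "m > M" for m
    using Greatest_le_nat[of "\<lambda>n. T n y \<notin> U" m N] bd that unfolding M_def by fastforce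
  define d where "d = degree q"
  have top: "\<forall>m>M + k. T m (scale (\<partial> ^ k) y) \<in> U" for k
    using conformal_op_partial_power[OF T U gt] by blast
  obtain c where c: "c \<noteq> 0" "T (M + d) (scale (\<partial> ^ d) y) - scale [:c:] (T M y) \<in> U"
    using conformal_op_partial_power[OF T U gt] by blast
  have "T (M + d) (scale q y) = (\<Sum>i\<le>d. scale [:coeff q i:] (T (M + d) (scale (\<partial> ^ i) y)))"
    by (subst scale_as_sum) (simp add: conformal_op_sum[OF T] conformal_op_const[OF T] d_def del: scale_scale)
  also have "\<dots> = (\<Sum>i<d. scale [:coeff q i:] (T (M + d) (scale (\<partial> ^ i) y))) +
      scale [:coeff q d:] (T (M + d) (scale (\<partial> ^ d) y))"
    by (simp flip: lessThan_Suc_atMost)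
  finally have eq: "T (M + d) (scale q y) = \<dots>" .
  have "(\<Sum>i<d. scale [:coeff q i:] (T (M + d) (scale (\<partial> ^ i) y))) \<in> U"
    using top by (intro subspace_sum[OF U] subspace_scale[OF U]) auto
  then have "scale [:coeff q d:] (T (M + d) (scale (\<partial> ^ d) y)) \<in> U"
    using qy[of "M + d"] unfolding eq by (blast intro: subspace_cancel_left[OF U])
  then have "scale [:coeff q d:] (T (M + d) (scale (\<partial> ^ d) y)) -
      scale [:coeff q d:] (T (M + d) (scale (\<partial> ^ d) y) - scale [:c:] (T M y)) \<in> U"
    by (rule subspace_diff[OF U _ subspace_scale[OF U c(2)]])
  then have "scale [:coeff q d * c:] (T M y) \<in> U" by (simp add: scale_right_diff_distrib mult.commute)
  then have "scale [:inverse (coeff q d * c):] (scale [:coeff q d * c:] (T M y)) \<in> U"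
    by (rule subspace_scale[OF U])
  moreover have "coeff q d * c \<noteq> 0" using q c by (simp add: d_def)
  then have "[:inverse (coeff q d * c):] * [:coeff q d * c:] = 1"
    by (simp add: field_simps flip: one_pCons)
  ultimately have "T M y \<in> U" by (metis scale_scale scale_one)
  then show False using M by blast
qed

text \<open>
  The Cheng--Kac argument: as \<open>[a\<^sub>(\<^sub>n\<^sub>), \<partial>] = n a\<^sub>(\<^sub>n\<^sub>-\<^sub>1\<^sub>)\<close>, applying the mode of index \<open>M + d\<close> to the
  relation leaves only a multiple of the mode of index \<open>M\<close> applied to \<open>y d\<close>.
\<close>

lemma truncation_free:
  assumes T: "conformal_op T" and U: "subspace U" and TU: "\<And>n x. x \<in> U \<Longrightarrow> T n x \<in> U"
    and minimal: "\<And>x. (\<And>n. n \<ge> M \<Longrightarrow> T n x \<in> U) \<Longrightarrow> x \<in> U"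
    and y: "\<And>k n. k \<le> d \<Longrightarrow> n > M \<Longrightarrow> T n (y k) \<in> U"
    and rel: "(\<Sum>k\<le>d. scale (\<partial> ^ k) (y k)) \<in> U"
  shows "\<forall>k\<le>d. y k \<in> U"
proof -
  have *: "\<forall>k<d. y k \<in> U" if "\<And>k n. k < d \<Longrightarrow> n > M \<Longrightarrow> T n (y k) \<in> U"
    "(\<Sum>k<d. scale (\<partial> ^ k) (y k)) \<in> U" for d
    using that
  proof (induction d)
    case (Suc d)
    let ?S = "\<Sum>k<Suc d. scale (\<partial> ^ k) (y k)"
    have top: "\<forall>m>M + k. T m (scale (\<partial> ^ k) (y k)) \<in> U" if "k < Suc d" for k
      using conformal_op_partial_power[OF T U, of M "y k"] Suc.prems(1) that by blast
    obtain c where c: "c \<noteq> 0" "T (M + d) (scale (\<partial> ^ d) (y d)) - scale [:c:] (T M (y d)) \<in> U"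
      using conformal_op_partial_power[OF T U, of M "y d"] Suc.prems(1) by blast
    have "T (M + d) ?S = (\<Sum>k<d. T (M + d) (scale (\<partial> ^ k) (y k))) +
        T (M + d) (scale (\<partial> ^ d) (y d))"
      by (simp add: conformal_op_sum[OF T] conformal_op_add[OF T])
    moreover have "(\<Sum>k<d. T (M + d) (scale (\<partial> ^ k) (y k))) \<in> U"
      using top by (intro subspace_sum[OF U]) auto
    moreover have "T (M + d) ?S \<in> U" using TU Suc.prems(2) by blast
    ultimately have "T (M + d) (scale (\<partial> ^ d) (y d)) \<in> U"
      by (simp only:) (rule subspace_cancel_left[OF U])
    then have "T (M + d) (scale (\<partial> ^ d) (y d)) -
        (T (M + d) (scale (\<partial> ^ d) (y d)) - scale [:c:] (T M (y d))) \<in> U"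
      by (rule subspace_diff[OF U _ c(2)])
    then have "scale [:c:] (T M (y d)) \<in> U" by simp
    then have "scale [:inverse c:] (scale [:c:] (T M (y d))) \<in> U"
      by (rule subspace_scale[OF U])
    then have TM: "T M (y d) \<in> U" using c by (simp flip: one_pCons)
    have yd: "y d \<in> U"
    proof (rule minimal)
      show "T n (y d) \<in> U" if "n \<ge> M" for n
        using TM Suc.prems(1)[of d n] that by (cases "n = M") auto
    qed
    have "(\<Sum>k<d. scale (\<partial> ^ k) (y k)) = ?S - scale (\<partial> ^ d) (y d)" by simp
    also have "\<dots> \<in> U" by (intro subspace_diff[OF U] subspace_scale[OF U] yd Suc.prems(2))
    finally have "\<forall>k<d. y k \<in> U" using Suc by simp
    then show ?case using yd by (simp add: less_Suc_eq)
  qed simp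
  have "\<forall>k<Suc d. y k \<in> U"
    by (rule *) (use y rel in \<open>auto simp: lessThan_Suc_atMost less_Suc_eq_le\<close>)
  then show ?thesis by (simp add: less_Suc_eq_le)
qed

section \<open>Rank over the polynomial ring and dimension of truncation spaces\<close>

definition rank_le :: "nat \<Rightarrow> bool"
  where "rank_le r \<longleftrightarrow> (\<forall>x. \<exists>q. (\<exists>i\<le>r. q i \<noteq> 0) \<and> (\<Sum>i\<le>r. scale (q i) (x i)) = 0)"

lemma finite_span_imp_rank_le:
  assumes "finite B" "span B = UNIV"
  shows "rank_le (card B)"
  unfolding rank_le_def
proof
  fix x :: "nat \<Rightarrow> 'v"
  have "\<exists>a. x i = (\<Sum>b\<in>B. scale (a b) b)" for i
    using span_finite[OF assms(1)] assms(2) by auto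
  then obtain a where a: "\<And>i. x i = (\<Sum>b\<in>B. scale (a i b) b)" by metis
  obtain q where q: "\<exists>i\<in>{..card B}. q i \<noteq> 0" "\<forall>b\<in>B. (\<Sum>i\<le>card B. q i * a i b) = 0"
    using exists_dependence[OF assms(1), of "{..card B}" a] by auto
  have "(\<Sum>i\<le>card B. scale (q i) (x i)) = (\<Sum>i\<le>card B. \<Sum>b\<in>B. scale (q i * a i b) b)"
    by (simp add: a scale_sum_right)
  also have "\<dots> = (\<Sum>b\<in>B. scale (\<Sum>i\<le>card B. q i * a i b) b)"
    by (subst sum.swap) (simp add: scale_sum_left)
  finally show "\<exists>q. (\<exists>i\<le>card B. q i \<noteq> 0) \<and> (\<Sum>i\<le>card B. scale (q i) (x i)) = 0"
    using q by (intro exI[of _ q]) auto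
qed

lemma rank_leE:
  assumes "rank_le r"
  obtains q j where "j \<le> r" "q j \<noteq> 0" "(\<Sum>i\<le>r. scale (q i) (x i)) = 0"
  using assms[unfolded rank_le_def, THEN spec[where x = x]] by blast

text \<open>By \<open>truncation_free\<close>, a polynomial relation among vectors of the truncation
  space splits into complex relations modulo U, one for each power of \<partial>. Hence rank bounds
  complex dimension.\<close>

lemma truncation_dim_le:
  assumes T: "conformal_op T" and U: "subspace U" and TU: "\<And>n x. x \<in> U \<Longrightarrow> T n x \<in> U"
    and minimal: "\<And>x. (\<And>n. n \<ge> M \<Longrightarrow> T n x \<in> U) \<Longrightarrow> x \<in> U" and r: "rank_le r"
  shows "C.dim_le_mod r {x. \<forall>n\<ge>Suc M. T n x \<in> U} U"
  unfolding C.dim_le_mod_def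
proof (intro allI impI)
  fix x assume x: "\<forall>i\<le>r. x i \<in> {x. \<forall>n\<ge>Suc M. T n x \<in> U}"
  obtain q j where q: "j \<le> r" "q j \<noteq> 0" "(\<Sum>i\<le>r. scale (q i) (x i)) = 0"
    using rank_leE[OF r] by blast
  define D where "D = Max (degree ` q ` {..r})"
  have D: "degree (q i) \<le> D" if "i \<le> r" for i
    unfolding D_def using that by (intro Max_ge) auto
  define y where "y k = (\<Sum>i\<le>r. scale [:coeff (q i) k:] (x i))" for k
  have ext: "scale (q i) (x i) = (\<Sum>k\<le>D. scale [:coeff (q i) k:] (scale (\<partial> ^ k) (x i)))"
    if "i \<le> r" for i
    by (subst scale_as_sum, rule sum.mono_neutral_left) (use D[OF that] in \<open>auto simp: coeff_eq_0\<close>)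
  have "0 = (\<Sum>i\<le>r. \<Sum>k\<le>D. scale [:coeff (q i) k:] (scale (\<partial> ^ k) (x i)))"
    using q(3) ext by simp
  also have "\<dots> = (\<Sum>k\<le>D. scale (\<partial> ^ k) (y k))"
    unfolding y_def scale_sum_right by (subst sum.swap) (simp add: mult.commute)
  finally have "(\<Sum>k\<le>D. scale (\<partial> ^ k) (y k)) \<in> U" using subspace_0[OF U] by simp
  moreover have "T n (y k) \<in> U" if "n > M" for n k
    unfolding y_def conformal_op_sum[OF T] conformal_op_const[OF T] using x that
    by (intro subspace_sum[OF U] subspace_scale[OF U]) auto
  ultimately have "\<forall>k\<le>D. y k \<in> U"
    using truncation_free[OF T U TU minimal, where d = D and y = y] by blast
  \<comment> \<open>At this power of \<partial> the complex relation is nontrivial, as it contains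
    the leading coefficient of \<open>q j\<close>.\<close>
  moreover define k where "k = degree (q j)"
  ultimately have "y k \<in> U" "coeff (q j) k \<noteq> 0" using q D by auto
  then show "\<exists>c. (\<exists>i\<le>r. c i \<noteq> 0) \<and> (\<Sum>i\<le>r. scale [:c i:] (x i)) \<in> U"
    using q(1) unfolding y_def by (intro exI[of _ "\<lambda>i. coeff (q i) k"]) auto
qed

section \<open>Torsion-free quotients and their fibres at a point\<close>

definition saturated :: "'v set \<Rightarrow> bool"
  where "saturated U \<longleftrightarrow> subspace U \<and> (\<forall>q x. q \<noteq> 0 \<longrightarrow> scale q x \<in> U \<longrightarrow> x \<in> U)"

lemma saturatedD: "saturated U \<Longrightarrow> q \<noteq> 0 \<Longrightarrow> scale q x \<in> U \<Longrightarrow> x \<in> U"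
  and saturated_subspace: "saturated U \<Longrightarrow> subspace U"
  unfolding saturated_def by blast+

lemma poly_split_root: "\<exists>g. q = [:poly q a:] + [:- a, 1:] * g" for q :: "complex poly"
proof -
  have "[:- a, 1:] dvd q - [:poly q a:]" by (simp flip: poly_eq_0_iff_dvd)
  then obtain g where "q - [:poly q a:] = [:- a, 1:] * g" by (elim dvdE)
  then show ?thesis by (metis add.commute diff_add_cancel)
qed

text \<open>The quotient of V by this subspace is the fibre of V/U at \<partial> = a.\<close>

definition multiples :: "complex \<Rightarrow> 'v set \<Rightarrow> 'v set"
  where "multiples a U = {scale [:- a, 1:] x + u | x u. u \<in> U}"

lemma multiplesI: "u \<in> U \<Longrightarrow> scale [:- a, 1:] x + u \<in> multiples a U"
  unfolding multiples_def by blast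

lemma multiplesE:
  assumes "x \<in> multiples a U"
  obtains y u where "x = scale [:- a, 1:] y + u" "u \<in> U"
  using assms unfolding multiples_def by blast

lemma multiples_superset: "U \<subseteq> multiples a U"
  using multiplesI[where x = 0] by fastforce

lemma subspace_multiples:
  assumes U: "subspace U"
  shows "subspace (multiples a U)"
proof (rule subspaceI)
  show "0 \<in> multiples a U" using multiples_superset subspace_0[OF U] by blast
  show "x + y \<in> multiples a U" if x: "x \<in> multiples a U" and y: "y \<in> multiples a U" for x y
  proof -
    obtain x' u where "x = scale [:- a, 1:] x' + u" "u \<in> U" using x by (rule multiplesE)
    moreover obtain y' v where "y = scale [:- a, 1:] y' + v" "v \<in> U" using y by (rule multiplesE)
    ultimately have "x + y = scale [:- a, 1:] (x' + y') + (u + v)" "u + v \<in> U"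
      by (simp_all add: scale_right_distrib subspace_add[OF U])
    then show ?thesis using multiplesI by metis
  qed
  show "scale c x \<in> multiples a U" if x: "x \<in> multiples a U" for c x
  proof -
    obtain x' u where "x = scale [:- a, 1:] x' + u" "u \<in> U" using x by (rule multiplesE)
    then have "scale c x = scale [:- a, 1:] (scale c x') + scale c u" "scale c u \<in> U"
      by (simp_all only: scale_right_distrib scale_left_commute subspace_scale[OF U])
    then show ?thesis using multiplesI by metis
  qed
qed

text \<open>Evaluate a polynomial relation at a. If all coefficients vanish there, torsion-freeness
  permits division of the relation by \<open>[:- a, 1:]\<close>; this lowers the degree of the
  nonzero coefficient \<open>q j\<close>, so the process ends.\<close>

lemma dim_le_mod_multiples:
  assumes tf: "saturated {0}" and r: "rank_le r" and U: "subspace U"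
  shows "C.dim_le_mod r K (multiples a U)"
  unfolding C.dim_le_mod_def
proof (intro allI impI)
  fix x
  have *: "\<exists>c. (\<exists>i\<le>r. c i \<noteq> 0) \<and> (\<Sum>i\<le>r. scale [:c i:] (x i)) \<in> multiples a U"
    if "j \<le> r" "q j \<noteq> 0" "(\<Sum>i\<le>r. scale (q i) (x i)) = 0" for q j
    using that
  proof (induction "degree (q j)" arbitrary: q rule: less_induct)
    case less
    have "\<forall>i. \<exists>g. q i = [:poly (q i) a:] + [:- a, 1:] * g" using poly_split_root by blast
    then obtain g where g: "\<And>i. q i = [:poly (q i) a:] + [:- a, 1:] * g i" by (rule choice[THEN exE]) blast
    have "(\<Sum>i\<le>r. scale (q i) (x i)) =
        (\<Sum>i\<le>r. scale [:poly (q i) a:] (x i)) + scale [:- a, 1:] (\<Sum>i\<le>r. scale (g i) (x i))"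
      unfolding scale_sum_right scale_scale sum.distrib[symmetric] scale_left_distrib[symmetric]
        g[symmetric] ..
    then have eq: "(\<Sum>i\<le>r. scale [:poly (q i) a:] (x i)) =
        scale [:- a, 1:] (- (\<Sum>i\<le>r. scale (g i) (x i)))"
      using less.prems(3) by (simp add: eq_neg_iff_add_eq_0)
    show ?case
    proof (cases "\<exists>i\<le>r. poly (q i) a \<noteq> 0")
      case True
      moreover have "(\<Sum>i\<le>r. scale [:poly (q i) a:] (x i)) \<in> multiples a U"
        unfolding eq using multiplesI[OF subspace_0[OF U]] by (metis add.right_neutral)
      ultimately show ?thesis by (intro exI[of _ "\<lambda>i. poly (q i) a"]) auto
    next
      case False
      then have "scale [:- a, 1:] (\<Sum>i\<le>r. scale (g i) (x i)) = 0" using eq by simp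
      then have "(\<Sum>i\<le>r. scale (g i) (x i)) = 0"
        using saturatedD[OF tf, of "[:- a, 1:]"] by simp
      moreover have qg: "q j = [:- a, 1:] * g j" using g[of j] False less.prems(1) by simp
      then have "g j \<noteq> 0" using less.prems(2) by auto
      then have "degree (g j) < degree (q j)" unfolding qg by (subst degree_mult_eq) auto
      ultimately show ?thesis using less.hyps[of g] less.prems(1) \<open>g j \<noteq> 0\<close> by blast
    qed
  qed
  obtain q j where "j \<le> r" "q j \<noteq> 0" "(\<Sum>i\<le>r. scale (q i) (x i)) = 0"
    using rank_leE[OF r] by blast
  then show "\<exists>c. (\<exists>i\<le>r. c i \<noteq> 0) \<and> (\<Sum>i\<le>r. scale [:c i:] (x i)) \<in> multiples a U"
    by (rule *)
qed

definition independent_mod :: "'v set \<Rightarrow> nat \<Rightarrow> (nat \<Rightarrow> 'v) \<Rightarrow> bool"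
  where "independent_mod U d f \<longleftrightarrow>
    (\<forall>q. (\<Sum>i<d. scale (q i) (f i)) \<in> U \<longrightarrow> (\<forall>i<d. q i = 0))"

lemma independent_mod_le:
  assumes "subspace U" "rank_le r" "independent_mod U d f"
  shows "d \<le> r"
proof (rule ccontr)
  assume "\<not> d \<le> r"
  obtain q j where q: "j \<le> r" "q j \<noteq> 0" "(\<Sum>i\<le>r. scale (q i) (f i)) = 0"
    using rank_leE[OF assms(2)] by blast
  define q' where "q' i = (if i \<le> r then q i else 0)" for i
  have "(\<Sum>i<d. scale (q' i) (f i)) = (\<Sum>i\<le>r. scale (q i) (f i))"
    using \<open>\<not> d \<le> r\<close> unfolding q'_def
    by (intro sum.mono_neutral_cong_right) auto
  then have "(\<Sum>i<d. scale (q' i) (f i)) \<in> U" using q(3) subspace_0[OF assms(1)] by simp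
  then have "q' j = 0" using assms(3) q(1) \<open>\<not> d \<le> r\<close> unfolding independent_mod_def by force
  then show False using q by (simp add: q'_def)
qed

text \<open>An instance of Krull's intersection theorem. Let F be U plus the span of a family that
  is maximal independent modulo U. One nonzero P maps the whole module into F, and divisibility of x
  makes the coordinates of \<open>scale P x\<close> divisible by all powers of
  \<open>[:- a, 1:]\<close>, hence zero.\<close>

lemma divisible_imp_mem:
  assumes fg: "finite B" "span B = UNIV" and U: "saturated U"
    and div: "\<And>k. \<exists>y. x - scale ([:- a, 1:] ^ k) y \<in> U"
  shows "x \<in> U"
proof -
  note sU = saturated_subspace[OF U]
  have "\<exists>f. independent_mod U 0 f" by (auto simp: independent_mod_def)
  then have ex0: "\<exists>f. independent_mod U 0 f" .
  have bd: "\<forall>d. (\<exists>f. independent_mod U d f) \<longrightarrow> d \<le> card B"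
    using independent_mod_le[OF sU finite_span_imp_rank_le[OF fg]] by blast
  define d where "d = (GREATEST d. \<exists>f. independent_mod U d f)"
  obtain f where f: "independent_mod U d f"
    using GreatestI_nat[of "\<lambda>d. \<exists>f. independent_mod U d f", OF ex0] bd unfolding d_def by blast
  have "\<not> independent_mod U (Suc d) g" for g
  proof
    assume "independent_mod U (Suc d) g"
    then have "Suc d \<le> d"
      using Greatest_le_nat[of "\<lambda>d. \<exists>f. independent_mod U d f" "Suc d"] bd unfolding d_def by blast
    then show False by simp
  qed
  note maxi = this
  define F where "F = {(\<Sum>i<d. scale (q i) (f i)) + u | q u. u \<in> U}"
  have memF: "(\<Sum>i<d. scale (q i) (f i)) + u \<in> F" if "u \<in> U" for q u
    using that unfolding F_def by blast
  have sF: "subspace F"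
  proof (rule subspaceI)
    show "0 \<in> F" using memF[OF subspace_0[OF sU], of "\<lambda>_. 0"] by simp
    show "y + z \<in> F" if y: "y \<in> F" and z: "z \<in> F" for y z
    proof -
      obtain q u where "y = (\<Sum>i<d. scale (q i) (f i)) + u" "u \<in> U"
        using y unfolding F_def by blast
      moreover obtain q' u' where "z = (\<Sum>i<d. scale (q' i) (f i)) + u'" "u' \<in> U"
        using z unfolding F_def by blast
      ultimately show ?thesis
        using memF[OF subspace_add[OF sU, of u u'], of "\<lambda>i. q i + q' i"]
        by (simp add: scale_left_distrib sum.distrib algebra_simps)
    qed
    show "scale c y \<in> F" if y: "y \<in> F" for c y
    proof -
      obtain q u where "y = (\<Sum>i<d. scale (q i) (f i)) + u" "u \<in> U"
        using y unfolding F_def by blast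
      then show ?thesis
        using memF[OF subspace_scale[OF sU, of u c], of "\<lambda>i. c * q i"]
        by (simp add: scale_right_distrib scale_sum_right)
    qed
  qed
  have "\<exists>q. q \<noteq> 0 \<and> scale q y \<in> F" for y
  proof -
    obtain q j where q: "(\<Sum>i<Suc d. scale (q i) ((f(d := y)) i)) \<in> U" "j < Suc d" "q j \<noteq> 0"
      using maxi[of "f(d := y)"] unfolding independent_mod_def by blast
    define s where "s = (\<Sum>i<d. scale (q i) (f i))"
    have u: "s + scale (q d) y \<in> U" using q(1) by (simp add: s_def)
    have "q d \<noteq> 0"
    proof
      assume "q d = 0"
      then have "\<forall>i<d. q i = 0" using f u by (simp add: independent_mod_def s_def)
      then show False using q \<open>q d = 0\<close> by (auto simp: less_Suc_eq)
    qed
    moreover have "scale (q d) y = (\<Sum>i<d. scale (- q i) (f i)) + (s + scale (q d) y)"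
      by (simp add: s_def sum_negf)
    then have "scale (q d) y \<in> F" using memF[OF u] by metis
    ultimately show ?thesis by blast
  qed
  then obtain Q where Q: "\<And>y. Q y \<noteq> 0" "\<And>y. scale (Q y) y \<in> F" by metis
  \<comment> \<open>A common denominator for the finitely many generators in B.\<close>
  define P where "P = prod Q B"
  have P: "P \<noteq> 0" using Q(1) fg(1) by (simp add: P_def)
  have PF: "scale P y \<in> F" for y
  proof -
    have "y \<in> span B" using fg(2) by simp
    then show ?thesis
    proof (induction rule: span_induct_alt)
      case base
      then show ?case using subspace_0[OF sF] by simp
    next
      case (step c b y)
      have "P = (prod Q (B - {b})) * Q b"
        using step(1) fg(1) by (simp add: P_def prod.remove mult.commute)
      then have "scale P b \<in> F" using Q(2)[of b] subspace_scale[OF sF] by (metis scale_scale)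
      then have "scale c (scale P b) \<in> F" using subspace_scale[OF sF] by blast
      then have "scale P (scale c b) \<in> F" by (simp add: mult.commute)
      then show ?case using step(2) subspace_add[OF sF] by (simp add: scale_right_distrib)
    qed
  qed
  obtain q u where q: "scale P x = (\<Sum>i<d. scale (q i) (f i)) + u" "u \<in> U"
    using PF[of x] unfolding F_def by blast
  have dvd: "[:- a, 1:] ^ k dvd q i" if "i < d" for i k
  proof -
    obtain y where y: "x - scale ([:- a, 1:] ^ k) y \<in> U" using div by blast
    obtain q' u' where q': "scale P y = (\<Sum>i<d. scale (q' i) (f i)) + u'" "u' \<in> U"
      using PF[of y] unfolding F_def by blast
    have "scale P (x - scale ([:- a, 1:] ^ k) y) \<in> U" by (rule subspace_scale[OF sU y])
    also have "scale P (x - scale ([:- a, 1:] ^ k) y) = scale P x - scale ([:- a, 1:] ^ k) (scale P y)"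
      by (simp add: scale_right_diff_distrib scale_left_commute del: scale_scale)
    also have "\<dots> = (\<Sum>i<d. scale (q i - [:- a, 1:] ^ k * q' i) (f i)) +
        (u - scale ([:- a, 1:] ^ k) u')"
      unfolding q q' by (simp add: scale_right_distrib scale_sum_right scale_left_diff_distrib
          sum_subtractf)
    finally have "(\<Sum>i<d. scale (q i - [:- a, 1:] ^ k * q' i) (f i)) +
        (u - scale ([:- a, 1:] ^ k) u') \<in> U" .
    moreover have "u - scale ([:- a, 1:] ^ k) u' \<in> U"
      using q q' by (intro subspace_diff[OF sU] subspace_scale[OF sU])
    ultimately have "(\<Sum>i<d. scale (q i - [:- a, 1:] ^ k * q' i) (f i)) \<in> U"
      by (rule subspace_cancel_right[OF sU])
    then have "\<forall>i<d. q i - [:- a, 1:] ^ k * q' i = 0"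
      using spec[OF f[unfolded independent_mod_def], of "\<lambda>i. q i - [:- a, 1:] ^ k * q' i"]
      by (rule rev_mp)
    then have "q i - [:- a, 1:] ^ k * q' i = 0" using that by blast
    then show ?thesis by simp
  qed
  have "q i = 0" if "i < d" for i
  proof (rule ccontr)
    assume "q i \<noteq> 0"
    then have "degree ([:- a, 1:] ^ Suc (degree (q i))) \<le> degree (q i)"
      using dvd[OF that] dvd_imp_degree_le by blast
    then show False by (simp add: degree_linear_power del: power_Suc)
  qed
  then have "scale P x \<in> U" using q by simp
  then show ?thesis using saturatedD[OF U P] by blast
qed

text \<open>By \<open>divisible_imp_mem\<close>, a nonzero class modulo U can be divided by
  \<open>[:- a, 1:]\<close> only finitely often; the last quotient is nonzero in the fibre. In
  particular the fibre of a nonzero quotient is nonzero.\<close>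

lemma divide_maximally:
  assumes fg: "finite B" "span B = UNIV" and U: "saturated U" and x: "x \<notin> U"
  obtains k y where "x - scale ([:- a, 1:] ^ k) y \<in> U" "y \<notin> multiples a U"
proof -
  note sU = saturated_subspace[OF U]
  obtain k where k: "\<not> (\<exists>y. x - scale ([:- a, 1:] ^ k) y \<in> U)"
    using divisible_imp_mem[OF fg U] x by blast
  define k0 where "k0 = (LEAST k. \<not> (\<exists>y. x - scale ([:- a, 1:] ^ k) y \<in> U))"
  have k0: "\<not> (\<exists>y. x - scale ([:- a, 1:] ^ k0) y \<in> U)"
    unfolding k0_def using k by (rule LeastI)
  have "\<exists>y. x - scale ([:- a, 1:] ^ 0) y \<in> U" using subspace_0[OF sU] by (intro exI[of _ x]) simp
  then obtain j where j: "k0 = Suc j" using k0 by (cases k0) auto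
  then obtain y where y: "x - scale ([:- a, 1:] ^ j) y \<in> U"
    using not_less_Least[of j "\<lambda>k. \<not> (\<exists>y. x - scale ([:- a, 1:] ^ k) y \<in> U)", folded k0_def] by auto
  have "y \<notin> multiples a U"
  proof
    assume "y \<in> multiples a U"
    then obtain y' u where y': "y = scale [:- a, 1:] y' + u" "u \<in> U" by (rule multiplesE)
    have "x - scale ([:- a, 1:] ^ k0) y' = x - scale ([:- a, 1:] ^ j) y + scale ([:- a, 1:] ^ j) u"
      unfolding y' j by (simp add: scale_right_distrib mult.commute)
    also have "\<dots> \<in> U" using y y'(2) by (intro subspace_add[OF sU] subspace_scale[OF sU])
    finally show False using k0 by blast
  qed
  then show thesis using that y by blast
qed

end

section \<open>Commutation relations of the mode operators\<close>

context poly_module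
begin

section \<open>Exponential generating functions of finitely supported sequences\<close>

definition finsupp :: "(nat \<Rightarrow> 'v) \<Rightarrow> bool"
  where "finsupp f \<longleftrightarrow> (\<exists>M. \<forall>n>M. f n = 0)"

definition finsupp2 :: "(nat \<Rightarrow> nat \<Rightarrow> 'v) \<Rightarrow> bool"
  where "finsupp2 F \<longleftrightarrow> (\<exists>M. \<forall>m n. m > M \<or> n > M \<longrightarrow> F m n = 0)"

text \<open>With the factorials, multiplication by l becomes the index shift
  \<open>n * f (n - 1)\<close>, and the argument l + u becomes the double sequence
  \<open>f (m + n)\<close>. Over an infinite support the sum is 0 by default, hence the hypotheses
  \<open>finsupp\<close> below.\<close>

definition eg :: "(nat \<Rightarrow> 'v) \<Rightarrow> complex \<Rightarrow> 'v"
  where "eg f l = (\<Sum>n | f n \<noteq> 0. scale [:l ^ n / fact n:] (f n))"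

lemma eg_bound:
  assumes "\<forall>n>M. f n = 0"
  shows "eg f l = (\<Sum>n\<le>M. scale [:l ^ n / fact n:] (f n))"
  unfolding eg_def
  by (rule sum.mono_neutral_left) (use assms in \<open>auto simp: not_less[symmetric]\<close>)

lemma common_bound:
  assumes "finsupp f" "finsupp g"
  obtains M where "\<forall>n>M. f n = 0" "\<forall>n>M. g n = 0"
proof -
  obtain A B where "\<forall>n>A. f n = 0" "\<forall>n>B. g n = 0" using assms unfolding finsupp_def by blast
  then show thesis using that[of "max A B"] by simp
qed

text \<open>Subtracting 2^M times the value at l from the value at 2 l cancels the top coefficient
  and multiplies the nth one by 2^n - 2^M, which is nonzero for n < M.\<close>

lemma polynomial_zero:
  assumes "\<And>l :: complex. (\<Sum>n<M. scale [:l ^ n:] (x n)) = 0"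
  shows "\<forall>n<M. x n = 0"
  using assms
proof (induction M arbitrary: x)
  case (Suc M)
  have "(\<Sum>n<M. scale [:l ^ n:] (scale [:2 ^ n - 2 ^ M:] (x n))) = 0" for l :: complex
  proof -
    have "(\<Sum>n<Suc M. scale [:(2 * l) ^ n:] (x n)) -
        scale [:2 ^ M:] (\<Sum>n<Suc M. scale [:l ^ n:] (x n)) = 0"
      by (simp only: Suc.prems scale_zero_right diff_0_right)
    also have "(\<Sum>n<Suc M. scale [:(2 * l) ^ n:] (x n)) -
        scale [:2 ^ M:] (\<Sum>n<Suc M. scale [:l ^ n:] (x n)) =
        (\<Sum>n<Suc M. scale [:l ^ n * (2 ^ n - 2 ^ M):] (x n))"
      unfolding scale_sum_right sum_subtractf[symmetric]
      by (intro sum.cong refl)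
        (simp add: power_mult_distrib right_diff_distrib mult.commute flip: scale_left_diff_distrib)
    finally show ?thesis by (simp add: mult.commute)
  qed
  from Suc.IH[OF this] have "\<forall>n<M. scale [:2 ^ n - 2 ^ M:] (x n) = 0" .
  moreover have "(2::complex) ^ n - 2 ^ M \<noteq> 0" if "n < M" for n
  proof
    assume "(2::complex) ^ n - 2 ^ M = 0"
    then have "(of_nat (2 ^ n) :: complex) = of_nat (2 ^ M)" by simp
    then have "(2::nat) ^ n = 2 ^ M" using of_nat_eq_iff by blast
    then show False using that by simp
  qed
  ultimately have z: "\<forall>n<M. x n = 0" using C.scale_eq_0_iff by blast
  then show ?case using Suc.prems[of 1] by (simp add: less_Suc_eq flip: one_pCons)
qed simp

lemma eg_inj:
  assumes "finsupp f" "finsupp g" and eq: "\<And>l. eg f l = eg g l"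
  shows "f n = g n"
proof -
  obtain M where M: "\<forall>n>M. f n = 0" "\<forall>n>M. g n = 0"
    using common_bound[OF assms(1,2)] by blast
  have "(\<Sum>n<Suc M. scale [:l ^ n:] (scale [:1 / fact n:] (f n - g n))) = 0" for l
    using eq[of l] unfolding eg_bound[OF M(1)] eg_bound[OF M(2)]
    by (simp add: lessThan_Suc_atMost scale_right_diff_distrib sum_subtractf del: sum.lessThan_Suc)
  from polynomial_zero[OF this] have "\<forall>n<Suc M. f n - g n = 0"
    by (metis C.scale_eq_0_iff divide_eq_0_iff fact_nonzero one_neq_zero)
  then show ?thesis using M by (cases "n \<le> M") auto
qed

lemma finsupp_zero_case: "finsupp f \<Longrightarrow> (\<And>n. f n = 0 \<Longrightarrow> g n = 0) \<Longrightarrow> finsupp g"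
  unfolding finsupp_def by auto

lemma eg_scale: "finsupp f \<Longrightarrow> scale q (eg f l) = eg (\<lambda>n. scale q (f n)) l"
proof -
  assume "finsupp f"
  then obtain M where M: "\<forall>n>M. f n = 0" unfolding finsupp_def by blast
  show ?thesis
    by (subst eg_bound[of M f], fact M, subst eg_bound[of M])
      (simp_all add: M scale_sum_right mult.commute)
qed

lemma eg_hom:
  assumes T: "C.lin T" and f: "finsupp f"
  shows "T (eg f l) = eg (\<lambda>n. T (f n)) l"
proof -
  obtain M where M: "\<forall>n>M. f n = 0" using f unfolding finsupp_def by blast
  show ?thesis
    by (subst eg_bound[of M f], fact M, subst eg_bound[of M])
      (simp_all add: M module_hom.sum[OF T] module_hom.scale[OF T] module_hom.zero[OF T])
qed

lemma eg_add:
  assumes "finsupp f" "finsupp g"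
  shows "eg f l + eg g l = eg (\<lambda>n. f n + g n) l"
proof -
  obtain M where M: "\<forall>n>M. f n = 0" "\<forall>n>M. g n = 0"
    using common_bound[OF assms] by blast
  show ?thesis
    unfolding eg_bound[OF M(1)] eg_bound[OF M(2)]
    by (subst eg_bound[of M]) (simp_all add: M scale_right_distrib sum.distrib)
qed

lemma finsupp_shift: "finsupp f \<Longrightarrow> finsupp (\<lambda>n. scale [:of_nat n:] (f (n - 1)))"
proof -
  assume "finsupp f"
  then obtain M where M: "\<forall>n>M. f n = 0" unfolding finsupp_def by blast
  then have "\<forall>n>Suc M. scale [:of_nat n:] (f (n - 1)) = 0" by simp
  then show ?thesis unfolding finsupp_def by blast
qed

lemma eg_shift:
  assumes "finsupp f"
  shows "scale [:l:] (eg f l) = eg (\<lambda>n. scale [:of_nat n:] (f (n - 1))) l"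
proof -
  obtain M where M: "\<forall>n>M. f n = 0" using assms unfolding finsupp_def by blast
  have "eg (\<lambda>n. scale [:of_nat n:] (f (n - 1))) l =
      (\<Sum>n\<le>Suc M. scale [:l ^ n / fact n:] (scale [:of_nat n:] (f (n - 1))))"
    by (rule eg_bound) (simp add: M)
  also have "\<dots> = (\<Sum>n\<le>M. scale [:l:] (scale [:l ^ n / fact n:] (f n)))"
    by (subst sum.atMost_Suc_shift) (simp add: field_simps del: of_nat_Suc)
  finally show ?thesis
    unfolding eg_bound[OF M] scale_sum_right by simp
qed

text \<open>The binomial theorem in the form that converts the argument \<open>l + m\<close> of
  \<open>act_br\<close> into a sum of mode indices.\<close>

lemma eg_binomial:
  assumes "finsupp f"
  shows "eg (\<lambda>m. eg (\<lambda>n. f (m + n)) u) l = eg f (l + u)"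
proof -
  obtain M where M: "\<forall>n>M. f n = 0" using assms unfolding finsupp_def by blast
  let ?g = "\<lambda>m n. scale [:l ^ m / fact m * (u ^ n / fact n):] (f (m + n))"
  have "eg (\<lambda>m. eg (\<lambda>n. f (m + n)) u) l =
      (\<Sum>m\<le>M. scale [:l ^ m / fact m:] (eg (\<lambda>n. f (m + n)) u))"
    by (rule eg_bound) (auto simp: M eg_def)
  also have "\<dots> = (\<Sum>m\<le>M. \<Sum>n\<le>M. ?g m n)"
  proof (intro sum.cong refl)
    fix m
    have "eg (\<lambda>n. f (m + n)) u = (\<Sum>n\<le>M. scale [:u ^ n / fact n:] (f (m + n)))"
      by (rule eg_bound) (simp add: M)
    then show "scale [:l ^ m / fact m:] (eg (\<lambda>n. f (m + n)) u) = (\<Sum>n\<le>M. ?g m n)"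
      by (simp add: scale_sum_right mult.commute)
  qed
  also have "\<dots> = (\<Sum>(m, n)\<in>{..M} \<times> {..M}. ?g m n)" by (rule sum.cartesian_product)
  also have "\<dots> = (\<Sum>(m, n)\<in>{(m, n). m + n \<le> M}. ?g m n)"
    by (rule sum.mono_neutral_right) (use M in \<open>auto intro!: leI\<close>)
  also have "\<dots> = (\<Sum>k\<le>M. \<Sum>m\<le>k. ?g m (k - m))"
    by (rule sum.triangle_reindex_eq)
  also have "\<dots> = (\<Sum>k\<le>M. scale [:(l + u) ^ k / fact k:] (f k))"
  proof (intro sum.cong refl)
    fix k
    have "(l + u) ^ k / fact k = (\<Sum>m\<le>k. l ^ m / fact m * (u ^ (k - m) / fact (k - m)))"
      unfolding binomial_ring sum_divide_distrib
      by (intro sum.cong refl) (simp add: binomial_fact)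
    then have "[:(l + u) ^ k / fact k:] = (\<Sum>m\<le>k. [:l ^ m / fact m * (u ^ (k - m) / fact (k - m)):])"
      by (simp add: sum_to_poly)
    then show "(\<Sum>m\<le>k. ?g m (k - m)) = scale [:(l + u) ^ k / fact k:] (f k)"
      by (simp add: scale_sum_left)
  qed
  also have "\<dots> = eg f (l + u)" by (rule eg_bound[symmetric]) (rule M)
  finally show ?thesis .
qed

lemma finsupp2_row: "finsupp2 F \<Longrightarrow> finsupp (F m)"
  unfolding finsupp2_def finsupp_def by blast

lemma finsupp2_transpose: "finsupp2 F \<Longrightarrow> finsupp2 (\<lambda>n m. F m n)"
  unfolding finsupp2_def by blast

lemma finsupp2_eg:
  assumes "finsupp2 F"
  shows "finsupp (\<lambda>m. eg (F m) u)"
proof -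
  obtain M where "\<forall>m n. m > M \<or> n > M \<longrightarrow> F m n = 0" using assms unfolding finsupp2_def by blast
  then have "\<forall>m>M. eg (F m) u = 0" by (simp add: eg_def)
  then show ?thesis unfolding finsupp_def by blast
qed

lemma eg_swap:
  assumes "finsupp2 F"
  shows "eg (\<lambda>m. eg (\<lambda>n. F m n) u) l = eg (\<lambda>n. eg (\<lambda>m. F m n) l) u"
proof -
  obtain M where M: "\<And>m n. m > M \<or> n > M \<Longrightarrow> F m n = 0"
    using assms unfolding finsupp2_def by blast
  have dbl: "eg (\<lambda>m. eg (\<lambda>n. H m n) u) l =
      (\<Sum>m\<le>M. \<Sum>n\<le>M. scale [:l ^ m / fact m * (u ^ n / fact n):] (H m n))"
    if H: "\<And>m n. m > M \<or> n > M \<Longrightarrow> H m n = 0" for H u l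
  proof -
    have "eg (\<lambda>m. eg (\<lambda>n. H m n) u) l = (\<Sum>m\<le>M. scale [:l ^ m / fact m:] (eg (\<lambda>n. H m n) u))"
      by (rule eg_bound) (auto simp: H eg_def)
    moreover have "eg (\<lambda>n. H m n) u = (\<Sum>n\<le>M. scale [:u ^ n / fact n:] (H m n))" for m
      by (rule eg_bound) (simp add: H)
    ultimately show ?thesis by (simp add: scale_sum_right mult.commute)
  qed
  have "eg (\<lambda>m. eg (\<lambda>n. F m n) u) l =
      (\<Sum>m\<le>M. \<Sum>n\<le>M. scale [:l ^ m / fact m * (u ^ n / fact n):] (F m n))"
    by (rule dbl) (rule M)
  also have "\<dots> = (\<Sum>n\<le>M. \<Sum>m\<le>M. scale [:u ^ n / fact n * (l ^ m / fact m):] (F m n))"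
    by (subst sum.swap) (simp add: mult.commute)
  also have "\<dots> = eg (\<lambda>n. eg (\<lambda>m. F m n) l) u"
    by (rule dbl[symmetric]) (use M in blast)
  finally show ?thesis .
qed

lemma eg2_inj:
  assumes F: "finsupp2 F" and H: "finsupp2 H"
    and eq: "\<And>l u. eg (\<lambda>m. eg (F m) u) l = eg (\<lambda>m. eg (H m) u) l"
  shows "F m n = H m n"
proof (rule eg_inj)
  show "eg (F m) u = eg (H m) u" for u
    by (rule eg_inj[OF finsupp2_eg[OF F] finsupp2_eg[OF H] eq])
qed (use F H finsupp2_row in blast)+

end

section \<open>Mode operators of a conformal module\<close>

context conformal_module
begin

sublocale V: poly_module scaleV ..

definition nprod :: "'s \<Rightarrow> nat \<Rightarrow> 'v \<Rightarrow> 'v"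
  where "nprod a n v = scaleV [:fact n:] (coeff (act a v) n)"

lemma nprod_eq_0_iff: "nprod a n v = 0 \<longleftrightarrow> coeff (act a v) n = 0"
  unfolding nprod_def by (simp add: V.C.scale_eq_0_iff)

lemma coeff_map_scale: "coeff (map_poly (scaleV q) P) n = scaleV q (coeff P n)"
  by (rule coeff_map_poly) simp

lemma lin_nprod: "V.C.lin (nprod a n)"
  by (rule V.C.linI)
    (simp_all add: nprod_def act_add_right act_const_right coeff_map_scale V.scale_right_distrib
      mult.commute)

lemma nprod_add_left: "nprod (a + b) n v = nprod a n v + nprod b n v"
  and nprod_const_left: "nprod (scaleS [:z:] a) n v = scaleV [:z:] (nprod a n v)"
  by (simp_all add: nprod_def act_add_left act_const_left coeff_map_scale V.scale_right_distrib
      mult.commute)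

lemma finsupp_nprod: "V.finsupp (\<lambda>n. nprod a n v)"
  unfolding V.finsupp_def nprod_eq_0_iff using coeff_eq_0 by blast

definition act_at :: "'s \<Rightarrow> complex \<Rightarrow> 'v \<Rightarrow> 'v"
  where "act_at a l v = subst_lambda scaleV (act a v) [:l:]"

lemma act_at_eg: "act_at a l v = V.eg (\<lambda>n. nprod a n v) l"
proof -
  have "[:l:] ^ n = [:l ^ n:]" for n
    by (induction n) (auto simp: one_pCons)
  then have "act_at a l v = (\<Sum>n\<le>degree (act a v). scaleV [:l ^ n / fact n:] (nprod a n v))"
    unfolding act_at_def subst_lambda_def nprod_def by simp
  also have "\<dots> = V.eg (\<lambda>n. nprod a n v) l"
    by (rule V.eg_bound[symmetric]) (simp add: nprod_eq_0_iff coeff_eq_0)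
  finally show ?thesis .
qed

lemma act_at_add_left: "act_at (a + b) l v = act_at a l v + act_at b l v"
  unfolding act_at_eg nprod_add_left by (rule V.eg_add[symmetric]) (rule finsupp_nprod)+

lemma act_at_const_left: "act_at (scaleS [:z:] a) l v = scaleV [:z:] (act_at a l v)"
  unfolding act_at_eg nprod_const_left by (rule V.eg_scale[symmetric]) (rule finsupp_nprod)

lemma act_at_scale_left: "act_at (scaleS q a) l v = scaleV [:poly q (- l):] (act_at a l v)"
proof (induction q)
  case 0
  then show ?case using act_at_const_left[of 0 a l v] by simp
next
  case (pCons z q)
  have "scaleS (pCons z q) a = scaleS [:z:] a + scaleS \<partial> (scaleS q a)"
    by (simp flip: S.scale_left_distrib)
  then have "act_at (scaleS (pCons z q) a) l v =
      scaleV [:z:] (act_at a l v) + scaleV (- [:l:]) (act_at (scaleS q a) l v)"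
    using act_partial_left[of "scaleS q a" v l]
    by (simp add: act_at_add_left act_at_const_left flip: act_at_def)
  then show ?case using pCons
    by (simp add: mult.commute flip: V.scale_left_distrib V.scale_left_diff_distrib)
qed

lemma nprod_partial:
  "nprod a n (scaleV \<partial> v) = scaleV \<partial> (nprod a n v) + scaleV [:of_nat n:] (nprod a (n - 1) v)"
proof (rule V.eg_inj[where f = "\<lambda>n. nprod a n (scaleV \<partial> v)"])
  show "V.eg (\<lambda>n. nprod a n (scaleV \<partial> v)) l =
      V.eg (\<lambda>n. scaleV \<partial> (nprod a n v) + scaleV [:of_nat n:] (nprod a (n - 1) v)) l" for l
  proof -
    have "act_at a l (scaleV \<partial> v) = scaleV \<partial> (act_at a l v) + scaleV [:l:] (act_at a l v)"
      using act_partial_right[of a v l] by (simp add: act_at_def flip: V.scale_left_distrib)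
    also have "\<dots> = V.eg (\<lambda>n. scaleV \<partial> (nprod a n v)) l +
        V.eg (\<lambda>n. scaleV [:of_nat n:] (nprod a (n - 1) v)) l"
      unfolding act_at_eg
      by (simp only: V.eg_shift[OF finsupp_nprod] V.eg_scale[OF finsupp_nprod, where q = \<partial>])
    also have "\<dots> = V.eg (\<lambda>n. scaleV \<partial> (nprod a n v) + scaleV [:of_nat n:] (nprod a (n - 1) v)) l"
      by (rule V.eg_add[OF V.finsupp_zero_case[OF finsupp_nprod[of a v]]
            V.finsupp_shift[OF finsupp_nprod]]) simp
    finally show ?thesis unfolding act_at_eg .
  qed
  show "V.finsupp (\<lambda>n. scaleV \<partial> (nprod a n v) + scaleV [:of_nat n:] (nprod a (n - 1) v))"
  proof -
    obtain M where "\<forall>n>M. nprod a n v = 0" using finsupp_nprod unfolding V.finsupp_def by blast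
    then show ?thesis unfolding V.finsupp_def by (intro exI[of _ "Suc M"]) auto
  qed
qed (rule finsupp_nprod)

lemma conformal_op_nprod: "V.conformal_op (nprod a)"
proof -
  have "\<exists>N. \<forall>n\<ge>N. nprod a n x = 0" for x
    using finsupp_nprod[of a x] unfolding V.finsupp_def by (metis Suc_le_eq)
  then show ?thesis unfolding V.conformal_op_def using lin_nprod nprod_partial by blast
qed

lemma finsupp2_nprod: "V.finsupp2 (\<lambda>m n. nprod a m (nprod b n v))"
proof -
  obtain N where N: "\<forall>n>N. nprod b n v = 0" using finsupp_nprod unfolding V.finsupp_def by blast
  have "\<forall>n. \<exists>M. \<forall>m>M. nprod a m (nprod b n v) = 0"
    using finsupp_nprod unfolding V.finsupp_def by blast
  then obtain M where M: "\<And>n m. m > M n \<Longrightarrow> nprod a m (nprod b n v) = 0" by metis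
  \<comment> \<open>Only the finitely many n \<le> N matter, and the largest of their individual
    bounds is uniform.\<close>
  have "nprod a m (nprod b n v) = 0" if "m > max N (Max (M ` {..N})) \<or> n > max N (Max (M ` {..N}))" for m n
  proof (cases "n \<le> N")
    case True
    then have "M n \<le> Max (M ` {..N})" by (intro Max_ge) auto
    then show ?thesis using that True by (intro M) auto
  qed (use N module_hom.zero[OF lin_nprod] in auto)
  then show ?thesis unfolding V.finsupp2_def by blast
qed

lemma finsupp2_add:
  assumes "V.finsupp f"
  shows "V.finsupp2 (\<lambda>m n. f (m + n))"
proof -
  obtain N where "\<forall>n>N. f n = 0" using assms unfolding V.finsupp_def by blast
  then have "\<forall>m n. m > N \<or> n > N \<longrightarrow> f (m + n) = 0" by auto
  then show ?thesis unfolding V.finsupp2_def by blast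
qed

text \<open>The listed brackets of generators all have the form (B \<partial> + C l + D) c. In the
  action at l + u the \<partial> in front of c becomes - (l + u), so c is multiplied by (C - B) l -
  B u + D; comparing coefficients of l^m / m! and u^n / n! gives the supercommutator of
  modes.\<close>

lemma nprod_commutator:
  assumes a: "a \<in> grS \<alpha>" and b: "b \<in> grS \<beta>"
    and ab: "\<And>l. subst_lambda scaleS (br a b) [:l:] = scaleS ([:B:] * \<partial> + [:C * l + D:]) c"
  shows "nprod a m (nprod b n v) - scaleV (parity_sign \<alpha> \<beta>) (nprod b n (nprod a m v)) =
    scaleV [:(C - B) * of_nat m - B * of_nat n:] (nprod c (m + n - 1) v) +
    scaleV [:D:] (nprod c (m + n) v)"
proof -
  define s where "s = parity_sign \<alpha> \<beta>"
  define F where "F m n = nprod a m (nprod b n v) + scaleV (- s) (nprod b n (nprod a m v))" for m n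
  define Y where "Y n = nprod c n v" for n
  \<comment> \<open>Truncated subtraction is harmless here and in \<open>Y2\<close>: at index 0 the
    coefficient is 0.\<close>
  define Y1 where "Y1 m n = scaleV [:C - B:] (scaleV [:of_nat m:] (Y (m - 1 + n)))" for m n
  define Y2 where "Y2 m n = scaleV [:- B:] (scaleV [:of_nat n:] (Y (m + (n - 1))))" for m n
  define Y3 where "Y3 m n = scaleV [:D:] (Y (m + n))" for m n
  have finY: "V.finsupp Y" unfolding Y_def by (rule finsupp_nprod)
  note fY2 = finsupp2_add[OF finY]
  obtain N where N: "\<forall>n>N. Y n = 0" using finY unfolding V.finsupp_def by blast
  have f1: "V.finsupp2 Y1" "V.finsupp2 Y2" "V.finsupp2 Y3"
    unfolding V.finsupp2_def Y1_def Y2_def Y3_def using N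
    by (auto intro!: exI[of _ "Suc N"])
  have fs: "V.finsupp2 (\<lambda>m n. P m n + Q m n)" if P: "V.finsupp2 P" and Q: "V.finsupp2 Q" for P Q
  proof -
    obtain A where "\<forall>m n. m > A \<or> n > A \<longrightarrow> P m n = 0" using P unfolding V.finsupp2_def by blast
    moreover obtain B where "\<forall>m n. m > B \<or> n > B \<longrightarrow> Q m n = 0"
      using Q unfolding V.finsupp2_def by blast
    ultimately show ?thesis unfolding V.finsupp2_def by (intro exI[of _ "max A B"]) auto
  qed
  have fsc: "V.finsupp2 (\<lambda>m n. scaleV q (P m n))" if "V.finsupp2 P" for P q
    using that unfolding V.finsupp2_def by (metis V.scale_zero_right)
  have eg2add: "V.eg (\<lambda>m. V.eg (P m) u) l + V.eg (\<lambda>m. V.eg (Q m) u) l =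
      V.eg (\<lambda>m. V.eg (\<lambda>n. P m n + Q m n) u) l"
    if "V.finsupp2 P" "V.finsupp2 Q" for P Q u l
    using that by (simp add: V.eg_add V.finsupp2_eg V.finsupp2_row)
  have eg2sc: "scaleV q (V.eg (\<lambda>m. V.eg (P m) u) l) = V.eg (\<lambda>m. V.eg (\<lambda>n. scaleV q (P m n)) u) l"
    if "V.finsupp2 P" for P q u l
    using that by (simp add: V.eg_scale V.finsupp2_eg V.finsupp2_row)
  have fab: "V.finsupp2 (\<lambda>m n. nprod a m (nprod b n v))" by (rule finsupp2_nprod)
  have fba: "V.finsupp2 (\<lambda>m n. nprod b n (nprod a m v))"
    by (rule V.finsupp2_transpose) (rule finsupp2_nprod)
  have "F m n = Y1 m n + (Y2 m n + Y3 m n)"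
  proof (rule V.eg2_inj)
    show "V.finsupp2 F" unfolding F_def by (intro fs fsc fab fba)
    show "V.finsupp2 (\<lambda>m n. Y1 m n + (Y2 m n + Y3 m n))" by (intro fs f1)
    show "V.eg (\<lambda>m. V.eg (F m) u) l = V.eg (\<lambda>m. V.eg (\<lambda>n. Y1 m n + (Y2 m n + Y3 m n)) u) l" for l u
    proof -
      have E1: "act_at a l (act_at b u v) = V.eg (\<lambda>m. V.eg (\<lambda>n. nprod a m (nprod b n v)) u) l"
        unfolding act_at_eg by (simp add: V.eg_hom[OF lin_nprod finsupp_nprod])
      have "act_at b u (act_at a l v) = V.eg (\<lambda>n. V.eg (\<lambda>m. nprod b n (nprod a m v)) l) u"
        unfolding act_at_eg by (simp add: V.eg_hom[OF lin_nprod finsupp_nprod])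
      also have "\<dots> = V.eg (\<lambda>m. V.eg (\<lambda>n. nprod b n (nprod a m v)) u) l"
        by (rule V.eg_swap[OF finsupp2_nprod])
      finally have E2: "act_at b u (act_at a l v) = \<dots>" .
      have "V.eg (\<lambda>m. V.eg (F m) u) l = act_at a l (act_at b u v) + scaleV (- s) (act_at b u (act_at a l v))"
        unfolding E1 E2 eg2sc[OF fba] eg2add[OF fab fsc[OF fba]] F_def ..
      also have "\<dots> = act_at (scaleS ([:B:] * \<partial> + [:C * l + D:]) c) (l + u) v"
        using act_br[OF a b, of v u l] unfolding ab by (simp add: act_at_def s_def)
      also have "\<dots> = scaleV [:(C - B) * l - B * u + D:] (act_at c (l + u) v)"
        unfolding act_at_scale_left by (simp add: algebra_simps)
      also have "\<dots> = scaleV [:(C - B) * l - B * u + D:] (V.eg (\<lambda>m. V.eg (\<lambda>n. Y (m + n)) u) l)"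
        unfolding V.eg_binomial[OF finY] act_at_eg by (simp add: Y_def[abs_def])
      also have "\<dots> = scaleV [:C - B:] (scaleV [:l:] (V.eg (\<lambda>m. V.eg (\<lambda>n. Y (m + n)) u) l)) +
          (scaleV [:- B:] (scaleV [:u:] (V.eg (\<lambda>m. V.eg (\<lambda>n. Y (m + n)) u) l)) +
           scaleV [:D:] (V.eg (\<lambda>m. V.eg (\<lambda>n. Y (m + n)) u) l))"
        unfolding V.scale_scale V.scale_left_distrib[symmetric]
        by (rule arg_cong[where f = "\<lambda>q. scaleV q _"]) simp
      also have "scaleV [:l:] (V.eg (\<lambda>m. V.eg (\<lambda>n. Y (m + n)) u) l) =
          V.eg (\<lambda>m. V.eg (\<lambda>n. scaleV [:of_nat m:] (Y (m - 1 + n))) u) l"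
        by (subst V.eg_shift[OF V.finsupp2_eg[OF fY2]]) (simp add: V.eg_scale V.finsupp2_row[OF fY2])
      also have "scaleV [:u:] (V.eg (\<lambda>m. V.eg (\<lambda>n. Y (m + n)) u) l) =
          V.eg (\<lambda>m. V.eg (\<lambda>n. scaleV [:of_nat n:] (Y (m + (n - 1)))) u) l"
        by (subst V.eg_scale[OF V.finsupp2_eg[OF fY2]]) (simp add: V.eg_shift V.finsupp2_row[OF fY2])
      also have "scaleV [:C - B:] (V.eg (\<lambda>m. V.eg (\<lambda>n. scaleV [:of_nat m:] (Y (m - 1 + n))) u) l) =
          V.eg (\<lambda>m. V.eg (Y1 m) u) l"
        unfolding Y1_def by (rule eg2sc)
          (use N in \<open>auto simp: V.finsupp2_def intro!: exI[of _ "Suc N"]\<close>)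
      also have "scaleV [:- B:] (V.eg (\<lambda>m. V.eg (\<lambda>n. scaleV [:of_nat n:] (Y (m + (n - 1)))) u) l) =
          V.eg (\<lambda>m. V.eg (Y2 m) u) l"
        unfolding Y2_def by (rule eg2sc)
          (use N in \<open>auto simp: V.finsupp2_def intro!: exI[of _ "Suc N"]\<close>)
      also have "scaleV [:D:] (V.eg (\<lambda>m. V.eg (\<lambda>n. Y (m + n)) u) l) = V.eg (\<lambda>m. V.eg (Y3 m) u) l"
        unfolding Y3_def by (rule eg2sc[OF fY2])
      finally show ?thesis by (simp add: eg2add f1 fs)
    qed
  qed
  moreover have "Y1 m n = scaleV [:(C - B) * of_nat m:] (nprod c (m + n - 1) v)"
    unfolding Y1_def Y_def by (cases m) simp_all
  moreover have "Y2 m n = scaleV [:- (B * of_nat n):] (nprod c (m + n - 1) v)"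
    unfolding Y2_def Y_def by (cases n) simp_all
  ultimately show ?thesis
    unfolding F_def Y3_def Y_def s_def
    by (simp flip: V.scale_left_distrib V.scale_left_diff_distrib)
qed

end

section \<open>Modules over the annihilation algebra\<close>

text \<open>Ordered so that a nonzero bracket has at least the kind of both factors. As indices add,
  the generators of at least a given kind and a given index span an ideal.\<close>

fun kind :: "S_index \<Rightarrow> nat"
  where "kind (L i) = 0" | "kind (W i) = 1" | "kind (G i) = 2"

fun idx :: "S_index \<Rightarrow> nat"
  where "idx (L i) = i" | "idx (W i) = i" | "idx (G i) = i"

text \<open>The weight of \<open>k\<close> as a field over the Virasoro subalgebra generated by \<open>L\<^sub>0 / p\<close>, minus \<open>1\<close>.\<close>

fun wt :: "complex \<Rightarrow> S_index \<Rightarrow> complex"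
  where "wt p (L i) = 1 + of_nat i / p" | "wt p (W i) = of_nat i / p"
  | "wt p (G i) = 1 + of_nat i / p"

text \<open>The classification sees only the modes of the generators, that is, a module over the
  annihilation algebra. The index \<open>m + n - 1\<close> is truncated only for m = n = 0, where
  its coefficient vanishes.\<close>

locale S_module_ops = poly_module scale
  for scale :: "complex poly \<Rightarrow> 'v::ab_group_add \<Rightarrow> 'v" +
  fixes gr :: "bit \<Rightarrow> 'v set" and op :: "S_index \<Rightarrow> nat \<Rightarrow> 'v \<Rightarrow> 'v" and p :: complex
  assumes p: "p \<noteq> 0"
    and fg: "\<exists>B. finite B \<and> span B = UNIV"
    and conf: "conformal_op (op k)"
    and gr_subspace: "subspace (gr \<alpha>)"
    and gr_disj: "gr 0 \<inter> gr 1 = {0}"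
    and gr_sum: "\<exists>x\<in>gr 0. \<exists>y\<in>gr 1. v = x + y"
    and parity: "x \<in> gr \<beta> \<Longrightarrow> op k n x \<in> gr (S_parity k + \<beta>)"
    and LL: "op (L i) m (op (L j) n x) = op (L j) n (op (L i) m x) +
      scale [:of_nat m * (of_nat j + p) - of_nat n * (of_nat i + p):] (op (L (i + j)) (m + n - 1) x)"
    and LW: "op (L i) m (op (W j) n x) = op (W j) n (op (L i) m x) +
      scale [:of_nat m * of_nat j - of_nat n * (of_nat i + p):] (op (W (i + j)) (m + n - 1) x)"
    and LG: "op (L i) m (op (G j) n x) = op (G j) n (op (L i) m x) +
      scale [:of_nat m * (of_nat j + p) - of_nat n * (of_nat i + p):] (op (G (i + j)) (m + n - 1) x)"
    and WG: "op (W i) m (op (G j) n x) = op (G j) n (op (W i) m x) + op (G (i + j)) (m + n) x"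
    and WW: "op (W i) m (op (W j) n x) = op (W j) n (op (W i) m x)"
    and GG: "op (G i) m (op (G j) n x) = - op (G j) n (op (G i) m x)"
    and irred: "subspace U \<Longrightarrow> (\<And>v. v \<in> U \<Longrightarrow> \<exists>x\<in>U \<inter> gr 0. \<exists>y\<in>U \<inter> gr 1. v = x + y) \<Longrightarrow>
      (\<And>k n x. x \<in> U \<Longrightarrow> op k n x \<in> U) \<Longrightarrow> U = {0} \<or> U = UNIV"
    and nontrivial: "\<exists>k n x. op k n x \<noteq> 0"
begin

lemmas op_add = conformal_op_add[OF conf]
  and op_diff = conformal_op_diff[OF conf]
  and op_const = conformal_op_const[OF conf]
  and op_zero = conformal_op_zero[OF conf]
  and op_partial = conformal_op_partial[OF conf]
  and op_lin = conformal_op_lin[OF conf]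

text \<open>A common weak form of all the brackets, from which invariance of joint kernels follows:
  if the correction term kills x as well, the kernel is stable.\<close>

lemma op_commute:
  "\<exists>s c k'' r. op k n (op k' m x) = scale s (op k' m (op k n x)) + scale c (op k'' r x) \<and>
    idx k'' = idx k + idx k' \<and> kind k'' \<ge> kind k \<and> kind k'' \<ge> kind k'"
proof -
  have I: "\<exists>s c k'' r. op k n (op k' m x) = scale s (op k' m (op k n x)) + scale c (op k'' r x) \<and>
      idx k'' = idx k + idx k' \<and> kind k'' \<ge> kind k \<and> kind k'' \<ge> kind k'"
    if "op k n (op k' m x) = scale s (op k' m (op k n x)) + scale c (op k'' r x)"
      "idx k'' = idx k + idx k'" "kind k'' \<ge> kind k" "kind k'' \<ge> kind k'" for k k' k'' n m r s c
    using that by blast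
  have swap: "y = scale 1 x + scale (- c) r" if "x = y + scale c r" for x y r :: 'v and c
    using that by simp
  consider (ll') i j where "k = L i" "k' = L j" | (lw') i j where "k = L i" "k' = W j"
    | (lg') i j where "k = L i" "k' = G j" | (wl') i j where "k = W i" "k' = L j"
    | (ww') i j where "k = W i" "k' = W j" | (wg') i j where "k = W i" "k' = G j"
    | (gl') i j where "k = G i" "k' = L j" | (gw') i j where "k = G i" "k' = W j"
    | (gg') i j where "k = G i" "k' = G j"
    by (cases k; cases k') auto
  then show ?thesis
  proof cases
    case ll'
    then show ?thesis using LL[of i n j m x] by (intro I[where s = 1 and k'' = "L (i + j)"]) auto
  next
    case lw'
    then show ?thesis using LW[of i n j m x] by (intro I[where s = 1 and k'' = "W (i + j)"]) auto
  next
    case lg'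
    then show ?thesis using LG[of i n j m x] by (intro I[where s = 1 and k'' = "G (i + j)"]) auto
  next
    case wl'
    show ?thesis unfolding wl' by (rule I[OF swap[OF LW[of j m i n x]]]) auto
  next
    case ww'
    \<comment> \<open>The bracket vanishes, so any k'' of suitable index and kind serves, with c =
      0.\<close>
    then show ?thesis using WW[of i n j m x]
      by (intro I[where s = 1 and k'' = "W (i + j)" and c = 0]) auto
  next
    case wg'
    then show ?thesis using WG[of i n j m x]
      by (intro I[where s = 1 and k'' = "G (i + j)" and c = 1]) auto
  next
    case gl'
    show ?thesis unfolding gl' by (rule I[OF swap[OF LG[of j m i n x]]]) auto
  next
    case gw'
    show ?thesis unfolding gw'
      by (rule I[OF swap[where c = 1]]) (use WG[of j m i n x] in auto)
  next
    case gg'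
    then show ?thesis using GG[of i n j m x]
      by (intro I[where s = "- 1" and k'' = "G (i + j)" and c = 0]) auto
  qed
qed

lemma gr_unique:
  assumes "x \<in> gr d" "y \<in> gr (d + 1)" "x + y = 0"
  shows "x = 0 \<and> y = 0"
proof -
  have "x = - y" using assms(3) by (simp add: eq_neg_iff_add_eq_0)
  then have "x \<in> gr (d + 1)" using assms(2) subspace_neg[OF gr_subspace] by blast
  then have "x \<in> gr 0 \<inter> gr 1" using assms(1) by (cases d) auto
  then have "x = 0" using gr_disj by blast
  then show ?thesis using assms(3) by simp
qed

text \<open>Irreducibility concerns graded subspaces only. The images of the two homogeneous parts
  of v lie in opposite parities, so they cancel only if both are zero.\<close>

lemma graded_kernel:
  assumes lin: "\<And>i x y. i \<in> I \<Longrightarrow> T i (x + y) = T i x + T i y"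
    and hom: "\<And>i \<beta> x. i \<in> I \<Longrightarrow> x \<in> gr \<beta> \<Longrightarrow> T i x \<in> gr (d i + \<beta>)"
    and v: "v \<in> {x. \<forall>i\<in>I. T i x = 0}" (is "v \<in> ?U")
  shows "\<exists>x\<in>?U \<inter> gr 0. \<exists>y\<in>?U \<inter> gr 1. v = x + y"
proof -
  obtain x y where xy: "x \<in> gr 0" "y \<in> gr 1" "v = x + y" using gr_sum by blast
  have "T i x = 0 \<and> T i y = 0" if "i \<in> I" for i
  proof (rule gr_unique)
    show "T i x \<in> gr (d i)" using hom[OF that xy(1)] by (simp only: add_0_right)
    show "T i y \<in> gr (d i + 1)" by (rule hom[OF that xy(2)])
    show "T i x + T i y = 0" using v xy(3) lin[OF that] that by auto
  qed
  then show ?thesis using xy by blast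
qed

lemma graded_op_kernel:
  assumes "v \<in> {x. \<forall>k\<in>A. \<forall>n. op k n x = 0}" (is "v \<in> ?U")
  shows "\<exists>x\<in>?U \<inter> gr 0. \<exists>y\<in>?U \<inter> gr 1. v = x + y"
proof -
  have eq: "?U = {x. \<forall>i\<in>A \<times> UNIV. op (fst i) (snd i) x = 0}" by auto
  show ?thesis using assms unfolding eq
    by (rule graded_kernel[where d = "\<lambda>i. S_parity (fst i)", rotated -1])
      (simp only: op_add, rule parity)
qed

lemma subspace_op_kernel: "subspace {x. \<forall>k\<in>A. \<forall>n. op k n x = 0}"
proof -
  have "{x. \<forall>k\<in>A. \<forall>n. op k n x = 0} = (\<Inter>k\<in>A. {x. \<forall>n. op k n x \<in> {0}})" by auto
  then show ?thesis
    using subspace_Int[of A "\<lambda>k. {x. \<forall>n. op k n x \<in> {0}}"]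
      subspace_preimage[OF conf subspace_single_0] by simp
qed

text \<open>The vectors killed by all modes form a submodule, which is proper by
  \<open>nontrivial\<close> and therefore zero; \<open>conformal_op_leading\<close> places torsion
  in it.\<close>

lemma torsion_free: "saturated {0}"
proof -
  let ?U = "{x. \<forall>k\<in>UNIV. \<forall>n. op k n x = 0}"
  have "?U = {0} \<or> ?U = UNIV"
    by (rule irred[OF subspace_op_kernel graded_op_kernel]) (auto simp: op_zero)
  moreover have "?U \<noteq> UNIV" using nontrivial by (metis (mono_tags, lifting) UNIV_I mem_Collect_eq)
  ultimately have U: "?U = {0}" by blast
  show ?thesis unfolding saturated_def
  proof (intro conjI allI impI)
    fix q x assume q: "q \<noteq> 0" and x: "scale q x \<in> {0}"
    have "op k n x \<in> {0}" for k n
      by (rule conformal_op_leading[OF conf subspace_single_0 q]) (use x in \<open>auto simp: op_zero\<close>)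
    then have "x \<in> ?U" by auto
    then show "x \<in> {0}" unfolding U .
  qed simp
qed

lemma nonzero: "\<exists>x::'v. x \<noteq> 0"
  using nontrivial by blast

lemma rank: "\<exists>r. rank_le r"
  using fg finite_span_imp_rank_le by blast

text \<open>V is infinite-dimensional over the complex numbers, so the eigenvalue c is found on the
  fibre V / \<partial> V. If S = T - c were nonzero, its kernel and image would make it bijective;
  but an x outside \<partial> V has S x = \<partial> y = S (\<partial> y'), whence x = \<partial>
  y'.\<close>

lemma Schur:
  assumes T: "C.lin T" and Tp: "\<And>x. T (scale \<partial> x) = scale \<partial> (T x)"
    and comm: "\<And>k n x. op k n (T x) = T (op k n x)"
    and hom: "\<And>\<beta> x. x \<in> gr \<beta> \<Longrightarrow> T x \<in> gr \<beta>"
  shows "\<exists>c. \<forall>x. T x = scale [:c:] x"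
proof -
  obtain B where B: "finite B" "span B = UNIV" using fg by blast
  obtain r where r: "rank_le r" using rank by blast
  obtain x0 :: 'v where x0: "x0 \<notin> {0}" using nonzero by blast
  define M where "M = multiples 0 {0}"
  have memM: "x \<in> M \<longleftrightarrow> (\<exists>y. x = scale \<partial> y)" for x by (simp add: M_def multiples_def)
  obtain x1 where x1: "x1 \<notin> M"
    using divide_maximally[OF B torsion_free x0, of 0] unfolding M_def by blast
  have sM: "C.subspace M"
    unfolding M_def by (intro subspace_imp_complex subspace_multiples subspace_single_0)
  have dim: "C.dim_le_mod r UNIV M"
    unfolding M_def by (rule dim_le_mod_multiples[OF torsion_free r subspace_single_0])
  obtain x c where x: "x \<notin> M" "T x - scale [:c:] x \<in> M"
    using C.eigenvector_mod[OF T _ C.subspace_UNIV sM dim UNIV_I x1] by auto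
  define S where "S x = T x - scale [:c:] x" for x
  have S: "C.lin S" unfolding S_def using C.lin_minus_scalar[OF T] .
  have Sp: "S (scale \<partial> y) = scale \<partial> (S y)" for y
    unfolding S_def Tp by (simp add: scale_right_diff_distrib scale_left_commute del: scale_scale)
  have Sc: "op k n (S y) = S (op k n y)" for k n y
    unfolding S_def by (simp add: op_diff op_const comm)
  have Sh: "S y \<in> gr \<beta>" if "y \<in> gr \<beta>" for y \<beta>
    unfolding S_def using that
    by (intro subspace_diff[OF gr_subspace] subspace_scale[OF gr_subspace] hom)
  note Sadd = module_hom.add[OF S] and Sconst = module_hom.scale[OF S]
    and S0 = module_hom.zero[OF S] and Sdiff = module_hom.diff[OF S]
  have ker: "{y. S y = 0} = {0} \<or> {y. S y = 0} = UNIV"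
  proof (rule irred)
    show "subspace {y. S y = 0}"
      by (rule subspace_closedI) (auto simp: C.subspace_def Sadd Sconst S0 Sp)
    show "\<exists>y\<in>{y. S y = 0} \<inter> gr 0. \<exists>z\<in>{y. S y = 0} \<inter> gr 1. v = y + z" if "v \<in> {y. S y = 0}" for v
      using graded_kernel[of "UNIV :: unit set" "\<lambda>_. S" "\<lambda>_. 0" v, simplified add_0_left] that Sadd Sh
      by simp
  qed (auto simp: Sc op_zero simp flip: Sc)
  have im: "range S = {0} \<or> range S = UNIV"
  proof (rule irred)
    show "subspace (range S)"
    proof (rule subspace_closedI)
      show "C.subspace (range S)" unfolding C.subspace_def
        by (auto simp flip: Sadd Sconst intro!: range_eqI[of 0 S 0] S0[symmetric])
      show "scale \<partial> y \<in> range S" if "y \<in> range S" for y using that by (auto simp flip: Sp)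
    qed
    show "\<exists>y\<in>range S \<inter> gr 0. \<exists>z\<in>range S \<inter> gr 1. v = y + z" if v: "v \<in> range S" for v
    proof -
      obtain y where y: "v = S y" using v by blast
      obtain a b where "a \<in> gr 0" "b \<in> gr 1" "y = a + b" using gr_sum by blast
      then show ?thesis using y Sh by (auto simp: Sadd)
    qed
  qed (auto simp: Sc)
  have "\<forall>y. S y = 0"
  proof (rule ccontr)
    assume nz: "\<not> (\<forall>y. S y = 0)"
    then have ker0: "\<And>y. S y = 0 \<Longrightarrow> y = 0" using ker by auto
    have "range S = UNIV" using im nz by auto
    moreover obtain y where y: "S x = scale \<partial> y" using x(2) unfolding memM S_def by blast
    ultimately obtain y' where "y = S y'" by blast
    then have "S (x - scale \<partial> y') = 0" using y by (simp add: Sdiff Sp)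
    then have "x = scale \<partial> y'" using ker0 by (metis eq_iff_diff_eq_0)
    then show False using x(1) memM by blast
  qed
  then show ?thesis unfolding S_def by auto
qed

section \<open>The Virasoro action\<close>

definition Lop :: "nat \<Rightarrow> 'v \<Rightarrow> 'v"
  where "Lop n x = scale [:1 / p:] (op (L 0) n x)"

lemma op_L0: "op (L 0) n x = scale [:p:] (Lop n x)"
  unfolding Lop_def using p by (simp flip: one_pCons)

lemma conformal_op_Lop: "conformal_op Lop"
  unfolding conformal_op_def
proof (intro conjI allI)
  show "C.lin (Lop n)" for n
    by (rule C.linI) (simp_all add: Lop_def op_add op_const scale_right_distrib mult.commute)
  show "Lop n (scale \<partial> x) = scale \<partial> (Lop n x) + scale [:of_nat n:] (Lop (n - 1) x)" for n x
    by (simp add: Lop_def op_partial scale_right_distrib mult.commute)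
  show "\<exists>N. \<forall>n\<ge>N. Lop n x = 0" for x
    using conformal_op_nil[OF conf[of "L 0"], of x] by (auto simp: Lop_def)
qed

lemmas Lop_add = conformal_op_add[OF conformal_op_Lop]
  and Lop_diff = conformal_op_diff[OF conformal_op_Lop]
  and Lop_const = conformal_op_const[OF conformal_op_Lop]
  and Lop_zero = conformal_op_zero[OF conformal_op_Lop]
  and Lop_partial = conformal_op_partial[OF conformal_op_Lop]
  and Lop_lin = conformal_op_lin[OF conformal_op_Lop]

text \<open>In the language of fields, k is primary of conformal weight \<open>wt p k + 1\<close>.
  The case m = 1 makes L_(1) a grading operator, with \<open>op k n\<close> of degree
  \<open>wt p k - n\<close>.\<close>

lemma Lop_op: "Lop m (op k n x) = op k n (Lop m x) +
    scale [:of_nat m * wt p k - of_nat n:] (op k (m + n - 1) x)"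
proof -
  have "op (L 0) m (op k n x) = op k n (op (L 0) m x) +
      scale [:p * (of_nat m * wt p k - of_nat n):] (op k (m + n - 1) x)"
  proof (cases k)
    case (L j)
    have "p * (of_nat m * wt p k - of_nat n) = of_nat m * (of_nat j + p) - of_nat n * (of_nat 0 + p)"
      using p L by (simp add: field_simps)
    then show ?thesis using LL[of 0 m j n x] L by (simp only: add_0)
  next
    case (W j)
    have "p * (of_nat m * wt p k - of_nat n) = of_nat m * of_nat j - of_nat n * (of_nat 0 + p)"
      using p W by (simp add: field_simps)
    then show ?thesis using LW[of 0 m j n x] W by (simp only: add_0)
  next
    case (G j)
    have "p * (of_nat m * wt p k - of_nat n) = of_nat m * (of_nat j + p) - of_nat n * (of_nat 0 + p)"
      using p G by (simp add: field_simps)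
    then show ?thesis using LG[of 0 m j n x] G by (simp only: add_0)
  qed
  then show ?thesis using p by (simp add: Lop_def op_const scale_right_distrib)
qed

lemma Lop_Lop: "Lop m (Lop n x) = Lop n (Lop m x) + scale [:of_nat m - of_nat n:] (Lop (m + n - 1) x)"
proof -
  have "Lop m (Lop n x) = scale [:1 / p:] (Lop m (op (L 0) n x))"
    unfolding Lop_def[of n x] Lop_const ..
  also have "\<dots> = scale [:1 / p:] (op (L 0) n (Lop m x)) +
      scale [:of_nat m - of_nat n:] (scale [:1 / p:] (op (L 0) (m + n - 1) x))"
    unfolding Lop_op scale_right_distrib by (simp add: mult.commute)
  finally show ?thesis unfolding Lop_def .
qed

text \<open>The operator \<open>\<partial> - L\<^sub>(\<^sub>0\<^sub>)\<close> commutes with the whole action.\<close>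

lemma Lop_0_ex: "\<exists>\<alpha>. \<forall>x. Lop 0 x = scale [:- \<alpha>, 1:] x"
proof -
  define T where "T x = scale \<partial> x - Lop 0 x" for x
  have "\<exists>c. \<forall>x. T x = scale [:c:] x"
  proof (rule Schur)
    show "C.lin T"
      by (rule C.linI) (simp_all add: T_def Lop_add Lop_const scale_right_distrib
          scale_right_diff_distrib mult.commute)
    show "T (scale \<partial> x) = scale \<partial> (T x)" for x
      using Lop_partial[of 0 x] by (simp add: T_def scale_right_diff_distrib)
    \<comment> \<open>Commutation with \<partial> and with L_(0) both turn \<open>op k n\<close>
      into - n times \<open>op k (n - 1)\<close>.\<close>
    show "op k n (T x) = T (op k n x)" for k n x
      using Lop_op[of 0 k n x] by (simp add: T_def op_diff op_partial)
    show "T x \<in> gr \<beta>" if "x \<in> gr \<beta>" for \<beta> x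
      unfolding T_def Lop_def using that parity[of x \<beta> "L 0" 0]
      by (intro subspace_diff[OF gr_subspace] subspace_scale[OF gr_subspace])
        (simp_all only: S_parity.simps add_0_left)
  qed
  then obtain c where c: "\<And>x. T x = scale [:c:] x" by blast
  have "Lop 0 x = scale [:- c, 1:] x" for x
  proof -
    have "[:- c, 1:] = \<partial> - [:c:]" by simp
    then have "scale [:- c, 1:] x = scale \<partial> x - scale [:c:] x" by (metis scale_left_diff_distrib)
    then show ?thesis using c[of x] by (simp add: T_def algebra_simps)
  qed
  then show ?thesis by blast
qed

definition \<alpha> :: complex where "\<alpha> = (SOME \<alpha>. \<forall>x. Lop 0 x = scale [:- \<alpha>, 1:] x)"

abbreviation z :: "complex poly" where "z \<equiv> [:- \<alpha>, 1:]"

lemma Lop_0: "Lop 0 x = scale z x"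
  unfolding \<alpha>_def using someI_ex[OF Lop_0_ex] by blast

lemma scale_z: "scale z x = scale \<partial> x - scale [:\<alpha>:] x"
proof -
  have "z = \<partial> - [:\<alpha>:]" by simp
  then show ?thesis by (metis scale_left_diff_distrib)
qed

lemma Lop_z: "Lop n (scale z x) = scale z (Lop n x) + scale [:of_nat n:] (Lop (n - 1) x)"
  unfolding scale_z Lop_diff Lop_partial Lop_const by simp

lemma Lop_1_z: "Lop 1 (scale z x) = scale z (Lop 1 x) + scale z x"
  using Lop_z[of 1 x] by (simp add: Lop_0 flip: one_pCons)

lemma Lop_1_z_power: "Lop 1 (scale (z ^ k) y) = scale (z ^ k) (Lop 1 y + scale [:of_nat k:] y)"
proof (induction k)
  case (Suc k)
  have "Lop 1 (scale (z ^ Suc k) y) = scale z (Lop 1 (scale (z ^ k) y)) + scale z (scale (z ^ k) y)"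
    unfolding power_Suc scale_scale[symmetric] by (rule Lop_1_z)
  also have "\<dots> = scale (z ^ Suc k) ((Lop 1 y + scale [:of_nat k:] y) + y)"
    unfolding Suc power_Suc scale_scale[symmetric] scale_right_distrib ..
  also have "(Lop 1 y + scale [:of_nat k:] y) + y = Lop 1 y + scale [:of_nat (Suc k):] y"
  proof -
    have "[:of_nat (Suc k):] = [:of_nat k:] + (1 :: complex poly)" by (simp add: one_pCons)
    then show ?thesis by (simp only: scale_left_distrib scale_one add.assoc)
  qed
  finally show ?case .
qed simp

section \<open>A Virasoro filtration with torsion-free quotients\<close>

definition Lstable :: "'v set \<Rightarrow> bool"
  where "Lstable U \<longleftrightarrow> saturated U \<and> (\<forall>n. \<forall>x\<in>U. Lop n x \<in> U)"

text \<open>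
  \<open>v\<close> spans a rank one highest weight submodule of the quotient by \<open>U\<close>; it is taken of minimal
  weight, which makes every operator of negative degree kill it.
\<close>

definition lowest :: "'v set \<Rightarrow> 'v \<Rightarrow> complex \<Rightarrow> bool"
  where "lowest U v \<Delta> \<longleftrightarrow> v \<notin> multiples \<alpha> U \<and> Lop 1 v - scale [:\<Delta>:] v \<in> U \<and>
    (\<forall>m\<ge>2. Lop m v \<in> U) \<and>
    (\<forall>x e. x \<notin> U \<longrightarrow> Lop 1 x - scale [:e:] x \<in> U \<longrightarrow> Re \<Delta> \<le> Re e)"

text \<open>The truncation argument for the field L. The least truncation index modulo U is positive
  because L_(0) is multiplication by z, which is injective modulo U. The resulting space K is
  finite-dimensional modulo U and stable under L_(1).\<close>

lemma exists_eigenvector: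
  assumes U: "Lstable U" "U \<noteq> UNIV"
  obtains x e where "x \<notin> U" "Lop 1 x - scale [:e:] x \<in> U"
proof -
  have sat: "saturated U" and st: "\<And>n x. x \<in> U \<Longrightarrow> Lop n x \<in> U" using U by (auto simp: Lstable_def)
  note sU = saturated_subspace[OF sat]
  define P where "P N \<longleftrightarrow> (\<exists>x. x \<notin> U \<and> (\<forall>n\<ge>N. Lop n x \<in> U))" for N
  obtain x0 where x0: "x0 \<notin> U" using U by blast
  obtain N0 where "\<forall>n\<ge>N0. Lop n x0 = 0" using conformal_op_nil[OF conformal_op_Lop] by blast
  then have "P N0" using x0 subspace_0[OF sU] unfolding P_def by auto
  then have PN: "P (LEAST N. P N)" by (rule LeastI)
  have "\<not> P 0"
  proof
    assume "P 0"
    then obtain x where "x \<notin> U" "Lop 0 x \<in> U" unfolding P_def by blast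
    then show False using saturatedD[OF sat, of z] by (simp add: Lop_0)
  qed
  then obtain M where M: "(LEAST N. P N) = Suc M" using PN by (cases "LEAST N. P N") auto
  have "\<not> P M" using not_less_Least[of M P] M by simp
  then have minimal: "x \<in> U" if "\<And>n. n \<ge> M \<Longrightarrow> Lop n x \<in> U" for x
    using that unfolding P_def by blast
  define K where "K = {x. \<forall>n\<ge>Suc M. Lop n x \<in> U}"
  obtain r where r: "rank_le r" using rank by blast
  have dim: "C.dim_le_mod r K U"
    unfolding K_def using conformal_op_Lop sU st minimal r by (rule truncation_dim_le)
  have sK: "C.subspace K" unfolding K_def by (rule complex_subspace_truncation[OF conformal_op_Lop sU])
  obtain x1 where x1: "x1 \<in> K" "x1 \<notin> U" using PN[unfolded M] unfolding P_def K_def by blast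
  have "Lop 1 x \<in> K" if "x \<in> K" for x
    unfolding K_def
  proof (intro CollectI allI impI)
    fix n assume n: "n \<ge> Suc M"
    then have "Lop n x \<in> U" using that by (simp add: K_def)
    then show "Lop n (Lop 1 x) \<in> U"
      unfolding Lop_Lop[of n 1] using st by (intro subspace_add[OF sU] subspace_scale[OF sU]) auto
  qed
  from C.eigenvector_mod[OF Lop_lin this sK subspace_imp_complex[OF sU] dim x1] that
  show thesis by blast
qed

text \<open>Dividing an eigenvector by z lowers its eigenvalue by 1, and after finitely many
  divisions it is nonzero in the fibre at \<alpha>. That fibre is finite-dimensional, so a least
  real part exists. The mode L_(m) lowers eigenvalues by m - 1, so for m \<ge> 2 minimality makes it
  kill v modulo U.\<close>

lemma exists_lowest:
  assumes U: "Lstable U" "U \<noteq> UNIV"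
  obtains v \<Delta> where "lowest U v \<Delta>"
proof -
  have sat: "saturated U" and st: "\<And>n x. x \<in> U \<Longrightarrow> Lop n x \<in> U" using U by (auto simp: Lstable_def)
  note sU = saturated_subspace[OF sat]
  obtain B where B: "finite B" "span B = UNIV" using fg by blast
  obtain r where r: "rank_le r" using rank by blast
  define \<Lambda> where "\<Lambda> = {e. \<exists>x. x \<notin> multiples \<alpha> U \<and> Lop 1 x - scale [:e:] x \<in> U}"
  have red: "\<exists>k. e - of_nat k \<in> \<Lambda>" if x: "x \<notin> U" "Lop 1 x - scale [:e:] x \<in> U" for x e
  proof -
    obtain k y where y: "x - scale (z ^ k) y \<in> U" "y \<notin> multiples \<alpha> U"
      using divide_maximally[OF B sat x(1), of \<alpha>] by blast
    define d where "d = x - scale (z ^ k) y"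
    have "Lop 1 x - scale [:e:] x - (Lop 1 d - scale [:e:] d) \<in> U"
      using y(1) unfolding d_def[symmetric]
      by (intro subspace_diff[OF sU x(2)] subspace_diff[OF sU] subspace_scale[OF sU] st)
    also have "Lop 1 x - scale [:e:] x - (Lop 1 d - scale [:e:] d) =
        Lop 1 (scale (z ^ k) y) - scale [:e:] (scale (z ^ k) y)"
      unfolding d_def Lop_diff scale_right_diff_distrib by simp
    also have "\<dots> = scale (z ^ k) (Lop 1 y - scale [:e - of_nat k:] y)"
    proof -
      have "scale [:e:] y = scale [:e - of_nat k:] y + scale [:of_nat k:] y"
        by (simp flip: scale_left_distrib)
      then have "scale (z ^ k) (scale [:e:] y) =
          scale (z ^ k) (scale [:e - of_nat k:] y + scale [:of_nat k:] y)" by simp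
      moreover have "scale [:e:] (scale (z ^ k) y) = scale (z ^ k) (scale [:e:] y)"
        by (rule scale_left_commute)
      ultimately show ?thesis
        unfolding Lop_1_z_power by (simp add: scale_right_distrib scale_right_diff_distrib del: scale_scale)
    qed
    finally have "Lop 1 y - scale [:e - of_nat k:] y \<in> U"
      using saturatedD[OF sat, of "z ^ k"] by simp
    then show ?thesis using y(2) unfolding \<Lambda>_def by blast
  qed
  obtain x e where "x \<notin> U" "Lop 1 x - scale [:e:] x \<in> U" using exists_eigenvector[OF U] .
  then have ne: "\<Lambda> \<noteq> {}" using red by blast
  have "finite {e. \<exists>x\<in>UNIV. x \<notin> multiples \<alpha> U \<and> Lop 1 x - scale [:e:] x \<in> multiples \<alpha> U}"
  proof (rule C.finite_eigenvalues_mod[OF Lop_lin])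
    show "Lop 1 x \<in> multiples \<alpha> U" if x: "x \<in> multiples \<alpha> U" for x
    proof -
      obtain y u where "x = scale z y + u" "u \<in> U" using x by (rule multiplesE)
      then have "Lop 1 x = scale z (Lop 1 y + y) + Lop 1 u" "Lop 1 u \<in> U"
        using st by (simp_all only: Lop_add Lop_1_z scale_right_distrib)
      then show ?thesis using multiplesI by metis
    qed
    show "C.subspace (multiples \<alpha> U)" by (intro subspace_imp_complex subspace_multiples sU)
    show "C.dim_le_mod r UNIV (multiples \<alpha> U)" by (rule dim_le_mod_multiples[OF torsion_free r sU])
  qed
  then have fin: "finite \<Lambda>"
    by (rule rev_finite_subset) (use multiples_superset in \<open>auto simp: \<Lambda>_def\<close>)
  define \<Delta> where "\<Delta> = arg_min_on Re \<Lambda>"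
  have \<Delta>: "\<Delta> \<in> \<Lambda>" "\<And>e. e \<in> \<Lambda> \<Longrightarrow> Re \<Delta> \<le> Re e"
    using arg_min_if_finite[OF fin ne, of Re] by (auto simp: \<Delta>_def not_less)
  have minimal: "Re \<Delta> \<le> Re e" if x: "x \<notin> U" "Lop 1 x - scale [:e:] x \<in> U" for x e
  proof -
    obtain k where "e - of_nat k \<in> \<Lambda>" using red[OF x] by blast
    from \<Delta>(2)[OF this] show ?thesis by simp
  qed
  obtain v where v: "v \<notin> multiples \<alpha> U" "Lop 1 v - scale [:\<Delta>:] v \<in> U"
    using \<Delta>(1) unfolding \<Lambda>_def by blast
  have "Lop m v \<in> U" if "m \<ge> 2" for m
  proof (rule ccontr)
    assume n: "Lop m v \<notin> U"
    have "Lop 1 (Lop m v) - scale [:\<Delta> + 1 - of_nat m:] (Lop m v) = Lop m (Lop 1 v - scale [:\<Delta>:] v)"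
    proof -
      have "[:\<Delta> + 1 - of_nat m:] = [:\<Delta>:] + [:1 - of_nat m:]" by simp
      then have "scale [:\<Delta> + 1 - of_nat m:] (Lop m v) =
          scale [:\<Delta>:] (Lop m v) + scale [:1 - of_nat m:] (Lop m v)"
        by (metis scale_left_distrib)
      then show ?thesis using Lop_Lop[of 1 m v] by (simp add: Lop_diff Lop_const)
    qed
    also have "\<dots> \<in> U" using st v(2) by blast
    finally have "Re \<Delta> \<le> Re (\<Delta> + 1 - of_nat m)" using minimal[OF n] by blast
    then show False using that by simp
  qed
  then have "lowest U v \<Delta>" unfolding lowest_def using v minimal by blast
  then show thesis by (rule that)
qed

definition adjoin :: "'v \<Rightarrow> 'v set \<Rightarrow> 'v set"
  where "adjoin v U = {scale q v + u | q u. u \<in> U}"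

lemma adjoinI: "u \<in> U \<Longrightarrow> scale q v + u \<in> adjoin v U"
  unfolding adjoin_def by blast

lemma adjoinE:
  assumes "x \<in> adjoin v U"
  obtains q u where "x = scale q v + u" "u \<in> U"
  using assms unfolding adjoin_def by blast

lemma subset_adjoin: "U \<subseteq> adjoin v U"
  using adjoinI[where q = 0] by fastforce

lemma subspace_adjoin:
  assumes U: "subspace U"
  shows "subspace (adjoin v U)"
proof (rule subspaceI)
  show "0 \<in> adjoin v U" using subset_adjoin subspace_0[OF U] by blast
  show "x + y \<in> adjoin v U" if x: "x \<in> adjoin v U" and y: "y \<in> adjoin v U" for x y
  proof -
    obtain q u where 1: "x = scale q v + u" "u \<in> U" using x by (rule adjoinE)
    obtain q' u' where 2: "y = scale q' v + u'" "u' \<in> U" using y by (rule adjoinE)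
    have "x + y = scale (q + q') v + (u + u')" using 1 2 by (simp add: scale_left_distrib)
    then show ?thesis using adjoinI[OF subspace_add[OF U 1(2) 2(2)]] by metis
  qed
  show "scale c x \<in> adjoin v U" if x: "x \<in> adjoin v U" for c x
  proof -
    obtain q u where 1: "x = scale q v + u" "u \<in> U" using x by (rule adjoinE)
    then have "scale c x = scale (c * q) v + scale c u" by (simp add: scale_right_distrib)
    then show ?thesis using adjoinI[OF subspace_scale[OF U 1(2)]] by metis
  qed
qed

text \<open>The delicate point is that the new quotient is torsion-free. If q y lies in the new
  space, so does L_(0) y = z y, by \<open>conformal_op_leading\<close>. Since v is nonzero in the
  fibre at \<alpha>, its coefficient there vanishes at \<alpha>, and z can be cancelled.\<close>

lemma Lstable_adjoin:
  assumes U: "Lstable U" and v: "lowest U v \<Delta>"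
  shows "Lstable (adjoin v U)"
proof -
  have sat: "saturated U" and st: "\<And>n x. x \<in> U \<Longrightarrow> Lop n x \<in> U" using U by (auto simp: Lstable_def)
  note sU = saturated_subspace[OF sat] and sA = subspace_adjoin[OF saturated_subspace[OF sat]]
  have vA: "scale q v \<in> adjoin v U" for q using adjoinI[OF subspace_0[OF sU], of q v] by simp
  have "Lop n v \<in> adjoin v U" for n
  proof -
    consider "n = 0" | "n = 1" | "n \<ge> 2" by linarith
    then show ?thesis
    proof cases
      case 1
      then show ?thesis using vA by (simp add: Lop_0)
    next
      case 2
      have "Lop 1 v - scale [:\<Delta>:] v \<in> adjoin v U" using v subset_adjoin by (auto simp: lowest_def)
      then have "(Lop 1 v - scale [:\<Delta>:] v) + scale [:\<Delta>:] v \<in> adjoin v U"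
        using vA by (rule subspace_add[OF sA])
      then show ?thesis using 2 by simp
    next
      case 3
      then show ?thesis using v subset_adjoin by (auto simp: lowest_def)
    qed
  qed
  note Lv = this
  let ?P = "{x. \<forall>n. Lop n x \<in> adjoin v U}"
  have sP: "subspace ?P" by (rule subspace_preimage[OF conformal_op_Lop sA])
  have stA: "Lop n x \<in> adjoin v U" if x: "x \<in> adjoin v U" for n x
  proof -
    obtain q u where qu: "x = scale q v + u" "u \<in> U" using x by (rule adjoinE)
    have "scale q v \<in> ?P" using Lv by (intro subspace_scale[OF sP]) simp
    moreover have "u \<in> ?P" using st[OF qu(2)] subset_adjoin by blast
    ultimately have "x \<in> ?P" unfolding qu(1) by (rule subspace_add[OF sP])
    then show ?thesis by blast
  qed
  have "y \<in> adjoin v U" if q: "q \<noteq> 0" and qy: "scale q y \<in> adjoin v U" for q y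
  proof -
    have "Lop 0 y \<in> adjoin v U"
      by (rule conformal_op_leading[OF conformal_op_Lop sA q]) (rule stA[OF qy])
    then obtain h u where h: "scale z y = scale h v + u" "u \<in> U"
      unfolding Lop_0 by (rule adjoinE)
    obtain g where g: "h = [:poly h \<alpha>:] + z * g" using poly_split_root by blast
    define c where "c = poly h \<alpha>"
    have "scale h v = scale [:c:] v + scale z (scale g v)"
      unfolding scale_scale scale_left_distrib[symmetric] c_def by (subst g) simp
    then have eq: "scale z (y - scale g v) = scale [:c:] v + u"
      using h(1) by (simp add: scale_right_diff_distrib)
    have "c = 0"
    proof (rule ccontr)
      assume "c \<noteq> 0"
      have "v = scale [:inverse c:] (scale [:c:] v)" using \<open>c \<noteq> 0\<close> by (simp flip: one_pCons)
      also have "scale [:c:] v = scale z (y - scale g v) + - u" using eq by simp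
      also have "scale [:inverse c:] \<dots> \<in> multiples \<alpha> U"
        using h(2) by (intro subspace_scale[OF subspace_multiples[OF sU]] multiplesI subspace_neg[OF sU])
      finally show False using v by (simp add: lowest_def)
    qed
    then have "scale z (y - scale g v) \<in> U" using eq h(2) by simp
    then have "y - scale g v \<in> U" using saturatedD[OF sat, of z] by simp
    from adjoinI[OF this, of g v] show ?thesis by simp
  qed
  then show ?thesis using stA sA unfolding Lstable_def saturated_def by blast
qed

end

section \<open>Vanishing of the generators of high index\<close>

lemma poly_induct_partial:
  fixes P :: "complex poly \<Rightarrow> bool"
  assumes "P 0" "\<And>a g. P g \<Longrightarrow> P ([:a:] + \<partial> * g)"
  shows "P q"
proof (induction q)
  case (pCons a g)
  then show ?case using assms(2)[of g a] by simp
qed (rule assms(1))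

lemma pderiv_linear_mult: "pderiv ([:- a, 1:] * q) = [:- a, 1:] * pderiv q + q"
  for q :: "complex poly"
  unfolding pderiv_mult by (simp add: pderiv_pCons)

lemma degree_of_eigenpolynomial:
  fixes h :: "complex poly"
  assumes "[:- a, 1:] * pderiv h = smult D h" "h \<noteq> 0"
  shows "D = of_nat (degree h)"
proof -
  define n where "n = degree h"
  have "coeff ([:- a, 1:] * pderiv h) n = of_nat n * coeff h n"
    by (cases n) (auto simp: coeff_pderiv n_def coeff_eq_0)
  then have "D * coeff h n = of_nat n * coeff h n" unfolding assms(1) by simp
  then show ?thesis using assms(2) by (simp add: n_def)
qed

text \<open>
  The polynomial below comes from expressing \<open>h 2\<close> through \<open>h 0\<close> in two ways in
  \<open>intertwiner_zero\<close>: by the action of \<open>L\<^sub>(\<^sub>3\<^sub>)\<close>, and by applying \<open>L\<^sub>(\<^sub>2\<^sub>)\<close> twice.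
\<close>

lemma finite_intertwiner_exceptions:
  fixes w s \<Delta> :: complex
  shows "finite {w. (w + s) * (w + s - 1) * w * (3 * (w + s - 1 + 2 * \<Delta>) * (w + s - 2 + 2 * \<Delta>) -
    2 * (2 * w - 1) * (w + s - 2 + 3 * \<Delta>)) = 0}"
proof -
  define R where "R = smult 3 ([:s - 1 + 2 * \<Delta>, 1:] * [:s - 2 + 2 * \<Delta>, 1:]) -
    smult 2 ([:- 1, 2:] * [:s - 2 + 3 * \<Delta>, 1:])"
  define P where "P = [:s, 1:] * [:s - 1, 1:] * [:0, 1:] * R"
  \<comment> \<open>3 - 2 * 2, whatever s and \<Delta> are.\<close>
  have "coeff R 2 = - 1" by (simp add: R_def numeral_2_eq_2)
  then have "R \<noteq> 0" by auto
  then have "P \<noteq> 0" unfolding P_def mult_eq_0_iff by simp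
  then have "finite {w. poly P w = 0}" by (rule poly_roots_finite)
  moreover have "poly P w = (w + s) * (w + s - 1) * w * (3 * (w + s - 1 + 2 * \<Delta>) *
      (w + s - 2 + 2 * \<Delta>) - 2 * (2 * w - 1) * (w + s - 2 + 3 * \<Delta>))" for w
    by (simp add: P_def R_def algebra_simps)
  ultimately show ?thesis by simp
qed

text \<open>These are the weights for which the factor \<open>2 * w - n\<close> of the recursion in
  \<open>intertwiner_zero\<close> vanishes while the degree expected of \<open>h (Suc n)\<close> is
  a natural number. Comparing real parts bounds n.\<close>

lemma finite_half_integers:
  fixes s :: complex
  shows "finite {w. \<exists>n k. 2 * w = of_nat n \<and> w + s - of_nat (Suc n) = of_nat k}"
proof (rule finite_subset)
  show "{w. \<exists>n k. 2 * w = of_nat n \<and> w + s - of_nat (Suc n) = of_nat k} \<subseteq>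
      (\<lambda>n. of_nat n / 2) ` {..nat \<lceil>2 * \<bar>Re s\<bar>\<rceil>}"
  proof
    fix w assume "w \<in> {w. \<exists>n k. 2 * w = of_nat n \<and> w + s - of_nat (Suc n) = of_nat k}"
    then obtain n k where nk: "2 * w = of_nat n" "w + s - of_nat (Suc n) = of_nat k" by blast
    have "Re (2 * w) = real n" "Re (w + s - of_nat (Suc n)) = real k"
      unfolding nk by simp_all
    then have "real n \<le> 2 * \<bar>Re s\<bar>" by simp
    then have "n \<le> nat \<lceil>2 * \<bar>Re s\<bar>\<rceil>" by linarith
    moreover have "w = of_nat n / 2" using nk(1) by (simp add: field_simps)
    ultimately show "w \<in> (\<lambda>n. of_nat n / 2) ` {..nat \<lceil>2 * \<bar>Re s\<bar>\<rceil>}" by blast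
  qed
qed simp

text \<open>The three families of equations express L_(1), L_(2), L_(3) on \<open>h n\<close> times
  a lowest weight vector of weight \<Delta>. The first is an Euler equation that fixes the degree of
  \<open>h n\<close>; the second is a recursion that propagates \<open>h 0 = 0\<close>, and
  \<open>w2\<close> excludes its resonances.\<close>

lemma intertwiner_zero:
  fixes h :: "nat \<Rightarrow> complex poly"
  assumes 1: "\<And>n. [:- a, 1:] * pderiv (h n) = smult (w + s - of_nat n) (h n)"
    and 2: "\<And>n. [:- a, 1:] * pderiv (pderiv (h n)) + smult (2 * \<Delta>) (pderiv (h n)) =
      smult (2 * w - of_nat n) (h (Suc n))"
    and 3: "\<And>n. [:- a, 1:] * pderiv (pderiv (pderiv (h n))) + smult (3 * \<Delta>) (pderiv (pderiv (h n))) =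
      smult (3 * w - of_nat n) (h (n + 2))"
    and w1: "(w + s) * (w + s - 1) * w * (3 * (w + s - 1 + 2 * \<Delta>) * (w + s - 2 + 2 * \<Delta>) -
      2 * (2 * w - 1) * (w + s - 2 + 3 * \<Delta>)) \<noteq> 0"
    and w2: "\<not> (\<exists>n k. 2 * w = of_nat n \<and> w + s - of_nat (Suc n) = of_nat k)"
  shows "h n = 0"
proof (induction n)
  case 0
  have "poly (h 0) x = 0" for x
  proof -
    let ?y = "x - a" and ?D = "w + s"
    define f where "f = poly (h 0) x"
    define f1 where "f1 = poly (pderiv (h 0)) x"
    define f2 where "f2 = poly (pderiv (pderiv (h 0))) x"
    define f3 where "f3 = poly (pderiv (pderiv (pderiv (h 0)))) x"
    define g where "g = poly (h 1) x"
    define g1 where "g1 = poly (pderiv (h 1)) x"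
    define k where "k = poly (h 2) x"
    have e1: "?y * f1 = ?D * f"
      using arg_cong[OF 1[of 0], of "\<lambda>q. poly q x"] by (simp add: f_def f1_def algebra_simps)
    have "pderiv ([:- a, 1:] * pderiv (h 0)) = pderiv (smult ?D (h 0))" using 1[of 0] by simp
    then have d1: "[:- a, 1:] * pderiv (pderiv (h 0)) + pderiv (h 0) = smult ?D (pderiv (h 0))"
      unfolding pderiv_linear_mult pderiv_smult .
    then have "pderiv ([:- a, 1:] * pderiv (pderiv (h 0)) + pderiv (h 0)) =
        pderiv (smult ?D (pderiv (h 0)))" by simp
    then have d2: "[:- a, 1:] * pderiv (pderiv (pderiv (h 0))) + pderiv (pderiv (h 0)) +
        pderiv (pderiv (h 0)) = smult ?D (pderiv (pderiv (h 0)))"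
      unfolding pderiv_linear_mult pderiv_smult pderiv_add .
    have e2: "?y * f2 = (?D - 1) * f1"
      using arg_cong[OF d1, of "\<lambda>q. poly q x"] by (simp add: f1_def f2_def algebra_simps)
    have e3: "?y * f3 = (?D - 2) * f2"
      using arg_cong[OF d2, of "\<lambda>q. poly q x"] by (simp add: f3_def f2_def algebra_simps)
    have e4: "?y * g1 = (?D - 1) * g"
      using arg_cong[OF 1[of 1], of "\<lambda>q. poly q x"] by (simp add: g_def g1_def algebra_simps)
    have e5: "(?D - 1 + 2 * \<Delta>) * f1 = 2 * w * g"
    proof -
      have "?y * f2 + 2 * \<Delta> * f1 = 2 * w * g"
        using arg_cong[OF 2[of 0], of "\<lambda>q. poly q x"]
        by (simp add: f1_def f2_def g_def algebra_simps)
      then show ?thesis using e2 by algebra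
    qed
    have "pderiv ([:- a, 1:] * pderiv (h 1)) = pderiv (smult (?D - 1) (h 1))" using 1[of 1] by simp
    then have d3: "[:- a, 1:] * pderiv (pderiv (h 1)) + pderiv (h 1) = smult (?D - 1) (pderiv (h 1))"
      unfolding pderiv_linear_mult pderiv_smult .
    have e6: "(?D - 2 + 2 * \<Delta>) * g1 = (2 * w - 1) * k"
    proof -
      define g2 where "g2 = poly (pderiv (pderiv (h 1))) x"
      have "?y * g2 + 2 * \<Delta> * g1 = (2 * w - 1) * k"
        using arg_cong[OF 2[of 1], of "\<lambda>q. poly q x"]
        by (simp add: g1_def g2_def k_def algebra_simps numeral_2_eq_2)
      moreover have "?y * g2 + g1 = (?D - 1) * g1"
        using arg_cong[OF d3, of "\<lambda>q. poly q x"] by (simp add: g1_def g2_def algebra_simps)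
      ultimately show ?thesis by algebra
    qed
    have e7: "(?D - 2 + 3 * \<Delta>) * f2 = 3 * w * k"
    proof -
      have "?y * f3 + 3 * \<Delta> * f2 = 3 * w * k"
        using arg_cong[OF 3[of 0], of "\<lambda>q. poly q x"]
        by (simp add: f2_def f3_def k_def algebra_simps numeral_2_eq_2)
      then show ?thesis using e3 by algebra
    qed
    have A: "2 * w * (2 * w - 1) * (?y\<^sup>2 * k) = (?D - 2 + 2 * \<Delta>) * (?D - 1) * (?D - 1 + 2 * \<Delta>) * ?D * f"
    proof -
      have "2 * w * (2 * w - 1) * (?y\<^sup>2 * k) = 2 * w * ?y\<^sup>2 * ((2 * w - 1) * k)" by algebra
      also have "\<dots> = 2 * w * ?y * ((?D - 2 + 2 * \<Delta>) * (?y * g1))"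
        unfolding e6[symmetric] by algebra
      also have "\<dots> = (?D - 2 + 2 * \<Delta>) * (?D - 1) * ?y * (2 * w * g)" unfolding e4 by algebra
      also have "\<dots> = (?D - 2 + 2 * \<Delta>) * (?D - 1) * (?D - 1 + 2 * \<Delta>) * (?y * f1)"
        unfolding e5[symmetric] by algebra
      finally show ?thesis unfolding e1 by algebra
    qed
    have B: "3 * w * (?y\<^sup>2 * k) = (?D - 2 + 3 * \<Delta>) * (?D - 1) * ?D * f"
    proof -
      have "3 * w * (?y\<^sup>2 * k) = ?y\<^sup>2 * ((?D - 2 + 3 * \<Delta>) * f2)" unfolding e7 by algebra
      also have "\<dots> = (?D - 2 + 3 * \<Delta>) * ?y * (?y * f2)" by algebra
      also have "\<dots> = (?D - 2 + 3 * \<Delta>) * (?D - 1) * (?y * f1)" unfolding e2 by algebra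
      finally show ?thesis unfolding e1 by algebra
    qed
    \<comment> \<open>Multiplying \<open>A\<close> by 3 w and \<open>B\<close> by 2 w (2 w - 1)
      makes the left-hand sides equal, so the right-hand sides differ by 0.\<close>
    have "f * ((w + s) * (w + s - 1) * w * (3 * (w + s - 1 + 2 * \<Delta>) * (w + s - 2 + 2 * \<Delta>) -
        2 * (2 * w - 1) * (w + s - 2 + 3 * \<Delta>))) =
        3 * w * ((?D - 2 + 2 * \<Delta>) * (?D - 1) * (?D - 1 + 2 * \<Delta>) * ?D * f) -
        2 * w * (2 * w - 1) * ((?D - 2 + 3 * \<Delta>) * (?D - 1) * ?D * f)" by algebra
    also have "\<dots> = 0" unfolding A[symmetric] B[symmetric] by algebra
    finally show "poly (h 0) x = 0" using w1 unfolding f_def by (metis mult_eq_0_iff)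
  qed
  then show ?case by (simp add: poly_eq_0_iff_dvd flip: poly_all_0_iff_0)
next
  case (Suc n)
  have z: "smult (2 * w - of_nat n) (h (Suc n)) = 0" using 2[of n] Suc by simp
  show ?case
  proof (rule ccontr)
    assume nz: "h (Suc n) \<noteq> 0"
    then have "2 * w = of_nat n" using z by simp
    moreover have "w + s - of_nat (Suc n) = of_nat (degree (h (Suc n)))"
      using degree_of_eigenpolynomial[OF 1 nz] .
    ultimately show False using w2 by blast
  qed
qed

context poly_module
begin

text \<open>The Leibniz rule with binomial coefficients: \<open>T (n - j)\<close> is paired with the
  jth derivative of q. The orders up to 3 are those for which the Virasoro equations are written
  out.\<close>

lemma conformal_op_scale:
  assumes T: "conformal_op T"
  shows "T 0 (scale q x) = scale q (T 0 x)"
    and "T 1 (scale q x) = scale q (T 1 x) + scale (pderiv q) (T 0 x)"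
    and "T 2 (scale q x) = scale q (T 2 x) + scale (2 * pderiv q) (T 1 x) +
      scale (pderiv (pderiv q)) (T 0 x)"
    and "T 3 (scale q x) = scale q (T 3 x) + scale (3 * pderiv q) (T 2 x) +
      scale (3 * pderiv (pderiv q)) (T 1 x) + scale (pderiv (pderiv (pderiv q))) (T 0 x)"
proof -
  have num: "[:of_nat n:] = (of_nat n :: complex poly)" for n by (simp add: of_nat_poly)
  have step: "scale ([:a:] + \<partial> * g) y = scale [:a:] y + scale \<partial> (scale g y)" for a g y
    unfolding scale_left_distrib scale_scale ..
  have Tstep: "T n (scale ([:a:] + \<partial> * g) x) = scale [:a:] (T n x) + scale \<partial> (T n (scale g x)) +
      scale (of_nat n) (T (n - 1) (scale g x))" for n a g
    unfolding step conformal_op_add[OF T] conformal_op_const[OF T] conformal_op_partial[OF T] num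
    by (simp add: add.assoc)
  have pd: "pderiv ([:a:] + \<partial> * g) = g + \<partial> * pderiv g"
    "pderiv (g + \<partial> * g') = pderiv g + g' + \<partial> * pderiv g'" for a and g g' :: "complex poly"
    by (simp_all add: pderiv_add pderiv_mult pderiv_pCons)
  show T0: "T 0 (scale q x) = scale q (T 0 x)" for q
  proof (induction q rule: poly_induct_partial)
    case (2 a g)
    show ?case unfolding Tstep 2 unfolding step by simp
  qed (simp add: conformal_op_zero[OF T])
  show T1: "T 1 (scale q x) = scale q (T 1 x) + scale (pderiv q) (T 0 x)" for q
  proof (induction q rule: poly_induct_partial)
    case (2 a g)
    have t: "T (1 - 1) = T 0" by simp
    have c: "g + \<partial> * pderiv g = of_nat 1 * g + \<partial> * pderiv g" by simp
    show ?case
      unfolding Tstep 2 t T0 pd(1) c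
      unfolding scale_left_distrib scale_right_distrib scale_scale[symmetric]
      by (simp only: ac_simps)
  qed (simp add: conformal_op_zero[OF T])
  show T2: "T 2 (scale q x) = scale q (T 2 x) + scale (2 * pderiv q) (T 1 x) +
      scale (pderiv (pderiv q)) (T 0 x)" for q
  proof (induction q rule: poly_induct_partial)
    case (2 a g)
    have t: "T (2 - 1) = T 1" by simp
    have c: "2 * (g + \<partial> * pderiv g) = of_nat 2 * g + \<partial> * (2 * pderiv g)"
      "pderiv (g + \<partial> * pderiv g) = of_nat 2 * pderiv g + \<partial> * pderiv (pderiv g)"
      unfolding pd by (simp_all add: algebra_simps)
    show ?case
      unfolding Tstep 2 t T1 pd(1) c
      unfolding scale_left_distrib scale_right_distrib scale_scale[symmetric]
      by (simp only: ac_simps)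
  qed (simp add: conformal_op_zero[OF T])
  show "T 3 (scale q x) = scale q (T 3 x) + scale (3 * pderiv q) (T 2 x) +
      scale (3 * pderiv (pderiv q)) (T 1 x) + scale (pderiv (pderiv (pderiv q))) (T 0 x)"
  proof (induction q rule: poly_induct_partial)
    case (2 a g)
    have t: "T (3 - 1) = T 2" by simp
    have c: "3 * (g + \<partial> * pderiv g) = of_nat 3 * g + \<partial> * (3 * pderiv g)"
      "3 * pderiv (g + \<partial> * pderiv g) = of_nat 3 * (2 * pderiv g) + \<partial> * (3 * pderiv (pderiv g))"
      "pderiv (pderiv (g + \<partial> * pderiv g)) =
        of_nat 3 * pderiv (pderiv g) + \<partial> * pderiv (pderiv (pderiv g))"
      unfolding pd by (simp_all add: algebra_simps pderiv_add pderiv_mult pderiv_pCons)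
    show ?case
      unfolding Tstep 2 t T2 pd(1) c
      unfolding scale_left_distrib scale_right_distrib scale_scale[symmetric]
      by (simp only: ac_simps)
  qed (simp add: conformal_op_zero[OF T])
qed

end

context S_module_ops
begin

text \<open>What \<open>Lop_op\<close> yields for \<open>u n = op k n v\<close> with w =
  \<open>wt p k\<close>, if v has L_(1)-eigenvalue \<Delta>0 and L_(2), L_(3) kill it. With k
  forgotten, one exceptional set of weights serves all generators.\<close>

definition primary_seq :: "complex \<Rightarrow> complex \<Rightarrow> (nat \<Rightarrow> 'v) \<Rightarrow> bool"
  where "primary_seq w \<Delta>0 u \<longleftrightarrow> (\<forall>n. Lop 1 (u n) = scale [:w - of_nat n + \<Delta>0:] (u n) \<and>
    Lop 2 (u n) = scale [:2 * w - of_nat n:] (u (Suc n)) \<and>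
    Lop 3 (u n) = scale [:3 * w - of_nat n:] (u (n + 2)))"

lemma primary_seq_mod:
  assumes U: "Lstable U" and v: "lowest U v \<Delta>"
  shows "\<exists>X. finite X \<and> (\<forall>w u. w \<notin> X \<longrightarrow> primary_seq w \<Delta>0 u \<longrightarrow>
    (\<forall>n. u n \<in> adjoin v U) \<longrightarrow> (\<forall>n. u n \<in> U))"
proof -
  have sat: "saturated U" and st: "\<And>n x. x \<in> U \<Longrightarrow> Lop n x \<in> U" using U by (auto simp: Lstable_def)
  note sU = saturated_subspace[OF sat]
  have vU: "v \<notin> U" using v multiples_superset by (auto simp: lowest_def)
  have zeroI: "g = 0" if "scale g v \<in> U" for g using saturatedD[OF sat _ that] vU by blast
  \<comment> \<open>The L_(1)-eigenvalue of \<open>u n\<close> exceeds that of v by w + s - n, which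
    becomes the degree of \<open>h n\<close>.\<close>
  define s where "s = \<Delta>0 - \<Delta>"
  define X where "X = {w. (w + s) * (w + s - 1) * w * (3 * (w + s - 1 + 2 * \<Delta>) *
      (w + s - 2 + 2 * \<Delta>) - 2 * (2 * w - 1) * (w + s - 2 + 3 * \<Delta>)) = 0} \<union>
    {w. \<exists>n k. 2 * w = of_nat n \<and> w + s - of_nat (Suc n) = of_nat k}"
  have "finite X" unfolding X_def using finite_intertwiner_exceptions finite_half_integers by blast
  moreover have "u n \<in> U" if w: "w \<notin> X" and u: "primary_seq w \<Delta>0 u" and uA: "\<forall>n. u n \<in> adjoin v U"
    for w u n
  proof -
    have "\<forall>n. \<exists>q. u n - scale q v \<in> U"
    proof
      fix n
      obtain q y where "u n = scale q v + y" "y \<in> U" using uA adjoinE by metis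
      then show "\<exists>q. u n - scale q v \<in> U" by (intro exI[of _ q]) simp
    qed
    then obtain h where h: "\<And>n. u n - scale (h n) v \<in> U" by (auto dest!: choice)
    have Lv: "Lop 0 v = scale z v" "Lop 1 v - scale [:\<Delta>:] v \<in> U" "Lop 2 v \<in> U" "Lop 3 v \<in> U"
      using v by (auto simp: lowest_def Lop_0)
    \<comment> \<open>Apply L_(m) to the congruence of \<open>u n\<close> and
      \<open>scale (h n) v\<close> modulo U, and compare coefficients of v, which is not torsion
      modulo U.\<close>
    have key: "A = B" if "Lop m (u n) = scale [:c:] (u j)" "Lop m (scale (h n) v) - scale A v \<in> U"
      "B = smult c (h j)" for m n c j A B
    proof -
      have "Lop m (u n - scale (h n) v) \<in> U" using st h by blast
      then have "Lop m (u n - scale (h n) v) + (Lop m (scale (h n) v) - scale A v) -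
          scale [:c:] (u j - scale (h j) v) \<in> U"
        by (rule subspace_diff[OF sU subspace_add[OF sU _ that(2)] subspace_scale[OF sU h]])
      also have "Lop m (u n - scale (h n) v) + (Lop m (scale (h n) v) - scale A v) -
          scale [:c:] (u j - scale (h j) v) = scale (B - A) v"
        using that(1,3) by (simp add: Lop_diff scale_right_diff_distrib scale_left_diff_distrib)
      finally have "B - A = 0" by (rule zeroI)
      then show ?thesis by simp
    qed
    have "h n = 0" for n
    proof (rule intertwiner_zero)
      show "z * pderiv (h n) = smult (w + s - of_nat n) (h n)" for n
      proof -
        have "z * pderiv (h n) + smult \<Delta> (h n) = smult (w - of_nat n + \<Delta>0) (h n)"
        proof (rule key)
          show "Lop 1 (u n) = scale [:w - of_nat n + \<Delta>0:] (u n)"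
            using u by (simp add: primary_seq_def)
          have "Lop 1 (scale (h n) v) - scale (z * pderiv (h n) + smult \<Delta> (h n)) v =
              scale (h n) (Lop 1 v - scale [:\<Delta>:] v)"
            unfolding conformal_op_scale[OF conformal_op_Lop] Lv(1)
            by (simp add: scale_left_distrib scale_right_diff_distrib mult.commute)
          then show "Lop 1 (scale (h n) v) - scale (z * pderiv (h n) + smult \<Delta> (h n)) v \<in> U"
            using subspace_scale[OF sU Lv(2)] by simp
        qed simp
        then have "z * pderiv (h n) = smult (w - of_nat n + \<Delta>0) (h n) - smult \<Delta> (h n)"
          by (metis add_diff_cancel)
        then show ?thesis by (simp add: s_def algebra_simps flip: smult_diff_left)
      qed
      show "z * pderiv (pderiv (h n)) + smult (2 * \<Delta>) (pderiv (h n)) =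
          smult (2 * w - of_nat n) (h (Suc n))" for n
      proof (rule key)
        show "Lop 2 (u n) = scale [:2 * w - of_nat n:] (u (Suc n))"
          using u by (simp add: primary_seq_def)
        have "Lop 2 (scale (h n) v) - scale (z * pderiv (pderiv (h n)) + smult (2 * \<Delta>) (pderiv (h n))) v =
            scale (h n) (Lop 2 v) + scale (2 * pderiv (h n)) (Lop 1 v - scale [:\<Delta>:] v)"
          unfolding conformal_op_scale[OF conformal_op_Lop] Lv(1)
          by (simp add: scale_left_distrib scale_right_diff_distrib mult.commute numeral_poly)
        then show "Lop 2 (scale (h n) v) - scale (z * pderiv (pderiv (h n)) +
            smult (2 * \<Delta>) (pderiv (h n))) v \<in> U"
          using subspace_add[OF sU subspace_scale[OF sU Lv(3)] subspace_scale[OF sU Lv(2)]] by simp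
      qed simp
      show "z * pderiv (pderiv (pderiv (h n))) + smult (3 * \<Delta>) (pderiv (pderiv (h n))) =
          smult (3 * w - of_nat n) (h (n + 2))" for n
      proof (rule key)
        show "Lop 3 (u n) = scale [:3 * w - of_nat n:] (u (n + 2))"
          using u by (simp add: primary_seq_def)
        have "Lop 3 (scale (h n) v) - scale (z * pderiv (pderiv (pderiv (h n))) +
              smult (3 * \<Delta>) (pderiv (pderiv (h n)))) v =
            scale (h n) (Lop 3 v) + scale (3 * pderiv (h n)) (Lop 2 v) +
            scale (3 * pderiv (pderiv (h n))) (Lop 1 v - scale [:\<Delta>:] v)"
          unfolding conformal_op_scale[OF conformal_op_Lop] Lv(1)
          by (simp add: scale_left_distrib scale_right_diff_distrib mult.commute numeral_poly)
        then show "Lop 3 (scale (h n) v) - scale (z * pderiv (pderiv (pderiv (h n))) +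
            smult (3 * \<Delta>) (pderiv (pderiv (h n)))) v \<in> U"
          using subspace_add[OF sU subspace_add[OF sU subspace_scale[OF sU Lv(4)]
              subspace_scale[OF sU Lv(3)]] subspace_scale[OF sU Lv(2)]] by simp
      qed simp
    qed (use w in \<open>auto simp: X_def\<close>)
    then show ?thesis using h[of n] by simp
  qed
  ultimately show ?thesis by blast
qed

lemma Lstable_zero: "Lstable {0}"
  unfolding Lstable_def using torsion_free by (simp add: Lop_zero)

text \<open>
  Induction along a filtration of the module by Virasoro submodules with rank one quotients.
\<close>

lemma primary_seq_zero:
  "\<exists>X. finite X \<and> (\<forall>w u. w \<notin> X \<longrightarrow> primary_seq w \<Delta>0 u \<longrightarrow> (\<forall>n. u n = 0))"
proof -
  define P where "P U \<longleftrightarrow> (\<exists>X. finite X \<and> (\<forall>w u. w \<notin> X \<longrightarrow> primary_seq w \<Delta>0 u \<longrightarrow>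
    (\<forall>n. u n \<in> U) \<longrightarrow> (\<forall>n. u n = 0)))" for U
  \<comment> \<open>Each step adjoins an independent vector unless the whole module is already
    reached, so the rank forces the latter at d = r + 1. The exceptional sets accumulate by
    union.\<close>
  have "\<exists>U. Lstable U \<and> P U \<and>
      (U = UNIV \<or> (\<exists>f. (\<forall>i<d. f i \<in> U) \<and> independent_mod {0} d f))" for d
  proof (induction d)
    case 0
    show ?case
      by (rule exI[of _ "{0}"]) (auto simp: Lstable_zero P_def independent_mod_def)
  next
    case (Suc d)
    then obtain U where U: "Lstable U" "P U"
      "U = UNIV \<or> (\<exists>f. (\<forall>i<d. f i \<in> U) \<and> independent_mod {0} d f)" by blast
    show ?case
    proof (cases "U = UNIV")
      case True
      then show ?thesis using U by blast
    next
      case False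
      then obtain f where f: "\<And>i. i < d \<Longrightarrow> f i \<in> U" "independent_mod {0} d f" using U(3) by blast
      obtain v \<Delta> where v: "lowest U v \<Delta>" using exists_lowest[OF U(1) False] .
      have sat: "saturated U" using U(1) by (simp add: Lstable_def)
      note sU = saturated_subspace[OF sat]
      have vU: "v \<notin> U" using v multiples_superset by (auto simp: lowest_def)
      obtain X where X: "finite X" "\<And>w u. w \<notin> X \<Longrightarrow> primary_seq w \<Delta>0 u \<Longrightarrow>
        \<forall>n. u n \<in> adjoin v U \<Longrightarrow> \<forall>n. u n \<in> U"
        using primary_seq_mod[OF U(1) v, of \<Delta>0] by metis
      obtain Y where Y: "finite Y" "\<And>w u. w \<notin> Y \<Longrightarrow> primary_seq w \<Delta>0 u \<Longrightarrow>
        \<forall>n. u n \<in> U \<Longrightarrow> \<forall>n. u n = 0"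
        using U(2) unfolding P_def by metis
      have "P (adjoin v U)" unfolding P_def
        by (rule exI[of _ "X \<union> Y"]) (use X Y in \<open>meson UnCI finite_UnI\<close>)
      moreover have "independent_mod {0} (Suc d) (f(d := v))"
        unfolding independent_mod_def
      proof (intro allI impI)
        fix q i assume "(\<Sum>i<Suc d. scale (q i) ((f(d := v)) i)) \<in> {0}" and i: "i < Suc d"
        then have eq: "(\<Sum>i<d. scale (q i) (f i)) + scale (q d) v = 0" by simp
        have "(\<Sum>i<d. scale (q i) (f i)) \<in> U"
          using f(1) by (intro subspace_sum[OF sU] subspace_scale[OF sU]) auto
        then have "scale (q d) v \<in> U"
          using subspace_cancel_left[OF sU] eq subspace_0[OF sU] by metis
        then have "q d = 0" using saturatedD[OF sat] vU by blast
        then have "(\<Sum>i<d. scale (q i) (f i)) \<in> {0}" using eq by simp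
        then have "\<forall>i<d. q i = 0" using f(2) unfolding independent_mod_def by blast
        then show "q i = 0" using i \<open>q d = 0\<close> by (auto simp: less_Suc_eq)
      qed
      moreover have "\<forall>i<Suc d. (f(d := v)) i \<in> adjoin v U"
        using f(1) subset_adjoin[of U v] adjoinI[OF subspace_0[OF sU], of 1 v]
        by (auto simp: less_Suc_eq)
      ultimately show ?thesis using Lstable_adjoin[OF U(1) v] by blast
    qed
  qed
  note chain = this
  obtain r where r: "rank_le r" using rank by blast
  obtain U where U: "P U" "U = UNIV \<or> (\<exists>f. independent_mod {0} (Suc r) f)"
    using chain[of "Suc r"] by blast
  moreover have "\<not> independent_mod {0} (Suc r) f" for f
    using independent_mod_le[OF subspace_single_0 r] by fastforce
  ultimately have "P UNIV" by blast
  then show ?thesis unfolding P_def by simp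
qed

definition trivial_op :: "S_index \<Rightarrow> bool"
  where "trivial_op k \<longleftrightarrow> (\<forall>n x. op k n x = 0)"

text \<open>One lowest weight vector v suffices: indices add under brackets, so the vectors killed
  by all generators of index at least N form a submodule, and it contains v once N is past the
  exceptional weights.\<close>

lemma finite_nontrivial: "\<exists>N. \<forall>k. idx k \<ge> N \<longrightarrow> trivial_op k"
proof -
  obtain x0 :: 'v where x0: "x0 \<noteq> 0" using nonzero by blast
  then have "{0} \<noteq> (UNIV :: 'v set)" by blast
  then obtain v \<Delta> where v: "lowest {0} v \<Delta>" using exists_lowest[OF Lstable_zero] by blast
  have v0: "v \<noteq> 0" using v multiples_superset[of "{0}" \<alpha>] by (auto simp: lowest_def)
  obtain X where X: "finite X" "\<And>w u. w \<notin> X \<Longrightarrow> primary_seq w \<Delta> u \<Longrightarrow> \<forall>n. u n = 0"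
    using primary_seq_zero[of \<Delta>] by metis
  have Lv: "Lop 1 v = scale [:\<Delta>:] v" "Lop 2 v = 0" "Lop 3 v = 0"
    using v by (auto simp: lowest_def)
  have "primary_seq (wt p k) \<Delta> (\<lambda>n. op k n v)" for k
    unfolding primary_seq_def
  proof (intro allI conjI)
    fix n
    show "Lop 1 (op k n v) = scale [:wt p k - of_nat n + \<Delta>:] (op k n v)"
      unfolding Lop_op Lv(1) op_const by (simp add: add.commute flip: scale_left_distrib)
    show "Lop 2 (op k n v) = scale [:2 * wt p k - of_nat n:] (op k (Suc n) v)"
      using Lop_op[of 2 k n v] by (simp add: Lv op_zero)
    show "Lop 3 (op k n v) = scale [:3 * wt p k - of_nat n:] (op k (n + 2) v)"
      using Lop_op[of 3 k n v] by (simp add: Lv op_zero)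
  qed
  then have kill: "op k n v = 0" if "wt p k \<notin> X" for k n using X(2)[OF that] by blast
  have "finite {i. wt p (c i) \<in> X}" if "inj (\<lambda>i. wt p (c i))" for c :: "nat \<Rightarrow> S_index"
    using finite_vimageI[OF X(1) that] by (simp add: vimage_def)
  moreover have "inj (\<lambda>i. wt p (L i))" "inj (\<lambda>i. wt p (W i))" "inj (\<lambda>i. wt p (G i))"
    using p by (auto simp: inj_def)
  ultimately have "finite ({i. wt p (L i) \<in> X} \<union> {i. wt p (W i) \<in> X} \<union> {i. wt p (G i) \<in> X})"
    by blast
  then obtain N where N: "\<And>i. i \<in> {i. wt p (L i) \<in> X} \<union> {i. wt p (W i) \<in> X} \<union> {i. wt p (G i) \<in> X}
      \<Longrightarrow> i < N"
    unfolding finite_nat_set_iff_bounded by blast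
  define A where "A = {k. idx k \<ge> N}"
  have "wt p k \<notin> X" if "k \<in> A" for k
    using N[of "idx k"] that unfolding A_def by (cases k) (auto simp del: wt.simps)
  then have vA: "v \<in> {x. \<forall>k\<in>A. \<forall>n. op k n x = 0}" using kill by blast
  have "{x. \<forall>k\<in>A. \<forall>n. op k n x = 0} = {0} \<or> {x. \<forall>k\<in>A. \<forall>n. op k n x = 0} = UNIV"
  proof (rule irred[OF subspace_op_kernel graded_op_kernel])
    show "op k' m x \<in> {x. \<forall>k\<in>A. \<forall>n. op k n x = 0}" if x: "x \<in> {x. \<forall>k\<in>A. \<forall>n. op k n x = 0}" for k' m x
    proof (intro CollectI ballI allI)
      fix k n assume k: "k \<in> A"
      obtain s c k'' r where c: "op k n (op k' m x) = scale s (op k' m (op k n x)) + scale c (op k'' r x)"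
        "idx k'' = idx k + idx k'" using op_commute[of k n k' m x] by blast
      have "k'' \<in> A" using k c(2) by (simp add: A_def)
      then show "op k n (op k' m x) = 0" using c(1) x k by (simp add: op_zero)
    qed
  qed
  then have "{x. \<forall>k\<in>A. \<forall>n. op k n x = 0} = UNIV" using vA v0 by blast
  then show ?thesis unfolding trivial_op_def A_def by blast
qed

end

section \<open>Classification\<close>

context S_module_ops
begin

text \<open>\<open>e k\<close> acts as a generator of an ideal of rank one.\<close>

definition top_op :: "S_index \<Rightarrow> bool"
  where "top_op k \<longleftrightarrow>
    (\<forall>k'. kind k' \<ge> kind k \<longrightarrow> idx k' \<ge> idx k \<longrightarrow> k' \<noteq> k \<longrightarrow> trivial_op k')"

text \<open>The correction term in \<open>op_commute\<close> involves k itself or a generator acting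
  as zero, so the joint kernel of the modes of k is a submodule.\<close>

lemma top_op_kernel:
  assumes "top_op k" "\<not> trivial_op k" "\<And>n. op k n x = 0"
  shows "x = 0"
proof -
  let ?U = "{x. \<forall>j\<in>{k}. \<forall>n. op j n x = 0}"
  have "?U = {0} \<or> ?U = UNIV"
  proof (rule irred[OF subspace_op_kernel graded_op_kernel])
    show "op k' m y \<in> ?U" if y: "y \<in> ?U" for k' m y
    proof -
      have "op k n (op k' m y) = 0" for n
      proof -
        obtain s c k'' r where c: "op k n (op k' m y) = scale s (op k' m (op k n y)) + scale c (op k'' r y)"
          "idx k'' = idx k + idx k'" "kind k'' \<ge> kind k"
          using op_commute[of k n k' m y] by blast
        have "op k'' r y = 0"
          using y assms(1) c(2,3) unfolding top_op_def trivial_op_def by (cases "k'' = k") auto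
        then show ?thesis using c(1) y by (simp add: op_zero)
      qed
      then show ?thesis by simp
    qed
  qed
  moreover have "?U \<noteq> UNIV" using assms(2) unfolding trivial_op_def by auto
  ultimately have "?U = {0}" by blast
  moreover have "x \<in> ?U" using assms(3) by simp
  ultimately show ?thesis by blast
qed

text \<open>M + 1 is the least index from which on all modes kill some nonzero vector; it is
  positive by \<open>top_op_kernel\<close>. Hence mode M is injective on the vectors killed by all
  later modes.\<close>

lemma exists_truncation:
  assumes "top_op k" "\<not> trivial_op k"
  obtains x M where "x \<noteq> 0" "\<forall>n>M. op k n x = 0" "\<forall>y. (\<forall>n\<ge>M. op k n y = 0) \<longrightarrow> y = 0"
proof -
  define P where "P N \<longleftrightarrow> (\<exists>x. x \<noteq> 0 \<and> (\<forall>n\<ge>N. op k n x = 0))" for N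
  obtain x0 :: 'v where "x0 \<noteq> 0" using nonzero by blast
  moreover obtain N0 where "\<forall>n\<ge>N0. op k n x0 = 0" using conformal_op_nil[OF conf] by blast
  ultimately have "P N0" unfolding P_def by blast
  then have PN: "P (LEAST N. P N)" by (rule LeastI)
  have "\<not> P 0" using top_op_kernel[OF assms] unfolding P_def by blast
  then obtain M where M: "(LEAST N. P N) = Suc M" using PN by (cases "LEAST N. P N") auto
  have nPM: "\<not> P M" using not_less_Least[of M P] M by simp
  obtain x where "x \<noteq> 0" "\<forall>n\<ge>Suc M. op k n x = 0" using PN[unfolded M] unfolding P_def by blast
  then show thesis using that[of x M] nPM unfolding P_def by (metis Suc_leI)
qed

lemma exists_maximal_nontrivial:
  assumes "Q k" "\<not> trivial_op k"
  obtains k' where "Q k'" "\<not> trivial_op k'" "\<And>j. Q j \<Longrightarrow> idx j > idx k' \<Longrightarrow> trivial_op j"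
proof -
  obtain N where N: "\<And>k. idx k \<ge> N \<Longrightarrow> trivial_op k" using finite_nontrivial by blast
  have "\<forall>j. Q j \<and> \<not> trivial_op j \<longrightarrow> idx j < N" using N not_less by blast
  then obtain k' where k': "Q k' \<and> \<not> trivial_op k'"
    "\<forall>j. Q j \<and> \<not> trivial_op j \<longrightarrow> idx j \<le> idx k'"
    using ex_has_greatest_nat[of "\<lambda>k. Q k \<and> \<not> trivial_op k" k idx N] assms by blast
  have "trivial_op j" if "Q j" "idx j > idx k'" for j
    using k'(2) that not_less by blast
  then show thesis using that k'(1) by blast
qed

text \<open>The nonzero G of largest index is a top generator, since no kind lies above G. Its modes
  anticommute, so mode M preserves the truncation space and squares to zero there, against its
  injectivity.\<close>

lemma G_trivial: "trivial_op (G i)"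
proof (rule ccontr)
  assume nt: "\<not> trivial_op (G i)"
  obtain k where k: "\<exists>i. k = G i" "\<not> trivial_op k"
    "\<And>j. \<exists>i. j = G i \<Longrightarrow> idx j > idx k \<Longrightarrow> trivial_op j"
    using exists_maximal_nontrivial[of "\<lambda>k. \<exists>i. k = G i" "G i"] nt by blast
  then obtain i0 where k_eq: "k = G i0" by blast
  note i0 = k(2)[unfolded k_eq]
  have top: "top_op (G i0)" unfolding top_op_def
  proof (intro allI impI)
    fix j assume j: "kind (G i0) \<le> kind j" "idx (G i0) \<le> idx j" "j \<noteq> G i0"
    show "trivial_op j"
    proof (cases j)
      case (G l)
      then show ?thesis using k(3)[of j] j k_eq by auto
    qed (use j in auto)
  qed
  obtain x M where M': "x \<noteq> 0" "\<forall>n>M. op (G i0) n x = 0"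
    "\<forall>y. (\<forall>n\<ge>M. op (G i0) n y = 0) \<longrightarrow> y = 0"
    using exists_truncation[OF top i0] .
  note M = M'[rule_format]
  define y where "y = op (G i0) M x"
  have twice: "op (G i0) M (op (G i0) M x) = 0"
  proof -
    have "op (G i0) M (op (G i0) M x) = - op (G i0) M (op (G i0) M x)" by (rule GG)
    then have "scale [:2:] (op (G i0) M (op (G i0) M x)) = 0"
      using C.scale_left_distrib[of 1 1 "op (G i0) M (op (G i0) M x)"]
      by (simp add: eq_neg_iff_add_eq_0 flip: one_pCons)
    then show ?thesis using C.scale_eq_0_iff[of 2] by simp
  qed
  have "op (G i0) n y = 0" if "n \<ge> M" for n
  proof (cases "n = M")
    case True
    then show ?thesis using twice by (simp add: y_def)
  next
    case False
    then show ?thesis using that M(2)[of n] GG[of i0 n i0 M x] by (simp add: y_def op_zero)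
  qed
  then have "y = 0" by (rule M(3))
  have "x = 0"
  proof (rule M(3))
    show "op (G i0) n x = 0" if "n \<ge> M" for n
      using that \<open>y = 0\<close> M(2)[of n] by (cases "n = M") (auto simp: y_def)
  qed
  then show False using M(1) by blast
qed

text \<open>
  If the ideal generated by a self-commuting field acts nontrivially, then its top nonvanishing mode
  is injective on a finite-dimensional space, where it is a commutator unless the field is a
  current (weight \<open>1\<close>, i.e. \<open>wt p k = 0\<close>).
\<close>

lemma abelian_ideal_trivial:
  assumes top: "top_op k"
    and comm: "\<And>m n x. op k m (op k n x) = op k n (op k m x)"
    and current: "wt p k = 0 \<Longrightarrow> \<exists>X Y c. C.lin X \<and> C.lin Y \<and> c \<noteq> 0 \<and>
      (\<forall>x. Y (X x) = X (Y x) + scale [:c:] (op k 0 x)) \<and>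
      (\<forall>n x. op k n (X x) = X (op k n x)) \<and> (\<forall>n x. op k n (Y x) = Y (op k n x))"
  shows "trivial_op k"
proof (rule ccontr)
  assume nt: "\<not> trivial_op k"
  obtain x0 M where M': "x0 \<noteq> 0" "\<forall>n>M. op k n x0 = 0" "\<forall>y. (\<forall>n\<ge>M. op k n y = 0) \<longrightarrow> y = 0"
    using exists_truncation[OF top nt] .
  note M = M'[rule_format]
  obtain r where r: "rank_le r" using rank by blast
  define K where "K = {x. \<forall>n\<ge>Suc M. op k n x \<in> {0}}"
  have K: "x \<in> K \<longleftrightarrow> (\<forall>n>M. op k n x = 0)" for x by (auto simp: K_def Suc_le_eq)
  have sK: "C.subspace K"
    unfolding K_def by (rule complex_subspace_truncation[OF conf subspace_single_0])
  have dim: "C.dim_le_mod r K {0}"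
    unfolding K_def
    by (rule truncation_dim_le[OF conf subspace_single_0 _ _ r]) (use M(3) in \<open>auto simp: op_zero\<close>)
  have x0: "x0 \<in> K" using M(2) K by blast
  let ?Z = "op k M"
  have ZK: "op k m x \<in> K" if "x \<in> K" for m x
    unfolding K
  proof (intro allI impI)
    fix n assume "n > M"
    then show "op k n (op k m x) = 0" using that comm[of n m x] by (simp add: K op_zero)
  qed
  have Zinj: "x = 0" if "x \<in> K" "?Z x = 0" for x
  proof (rule M(3))
    show "op k n x = 0" if "n \<ge> M" for n
      using that \<open>x \<in> K\<close> \<open>?Z x = 0\<close> by (cases "n = M") (auto simp: K)
  qed
  \<comment> \<open>The condition m \<ge> 1 keeps the index m + n - 1 above M; L_(0) would lower
    it.\<close>
  have LK: "Lop m x \<in> K" if "x \<in> K" "m \<ge> 1" for m x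
    unfolding K
  proof (intro allI impI)
    fix n assume n: "n > M"
    then have "op k n x = 0" "op k (m + n - 1) x = 0" using that by (auto simp: K)
    then show "op k n (Lop m x) = 0" using Lop_op[of m k n x] by (simp add: Lop_zero)
  qed
  show False
  proof (cases "wt p k = of_nat M")
    case False
    show False
    proof (rule C.no_injective_shift[of "Lop 1" K ?Z "wt p k - of_nat M" r x0])
      show "Lop 1 (?Z x) = ?Z (Lop 1 x) + scale [:wt p k - of_nat M:] (?Z x)" for x
        using Lop_op[of 1 k M x] by simp
    qed (use False sK dim x0 M(1) Lop_lin op_lin ZK Zinj LK in auto)
  next
    case True
    show False
    proof (cases M)
      case 0
      then obtain X Y c where XY: "C.lin X" "C.lin Y" "c \<noteq> 0"
        "\<And>x. Y (X x) = X (Y x) + scale [:c:] (op k 0 x)"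
        "\<And>n x. op k n (X x) = X (op k n x)" "\<And>n x. op k n (Y x) = Y (op k n x)"
        using current True by auto
      show False
      proof (rule C.no_injective_commutator[of X K Y ?Z c r x0])
        show "X x \<in> K" if "x \<in> K" for x
          using that by (simp add: K XY(5) module_hom.zero[OF XY(1)])
        show "Y x \<in> K" if "x \<in> K" for x
          using that by (simp add: K XY(6) module_hom.zero[OF XY(2)])
      qed (use XY sK dim x0 M(1) op_lin ZK Zinj 0 in auto)
    next
      case (Suc m)
      \<comment> \<open>With wt = M and m = M - 1, the bracket of L_(2) with mode M - 1 is M + 1
        times mode M. The bracket of L_(2) with mode M is a multiple of mode M + 1, which is zero on
        K.\<close>
      have w: "2 * wt p k - of_nat m = of_nat (Suc M)" "2 * wt p k - of_nat M = of_nat M"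
        using True Suc by simp_all
      show False
      proof (rule C.no_injective_commutator[of "op k m" K "Lop 2" ?Z "of_nat (Suc M)" r x0])
        show "Lop 2 (op k m x) = op k m (Lop 2 x) + scale [:of_nat (Suc M):] (?Z x)" for x
          using Lop_op[of 2 k m x] w(1) Suc by simp
        show "?Z (Lop 2 x) = Lop 2 (?Z x)" if "x \<in> K" for x
          using Lop_op[of 2 k M x] that by (simp add: K)
      qed (use sK dim x0 M(1) Lop_lin op_lin ZK Zinj LK comm in \<open>auto simp del: of_nat_Suc\<close>)
    qed
  qed
qed

text \<open>For i \<ge> 1 the field W_i has \<open>wt\<close> i / p, which is not 0, so it is no
  current. As all G act as zero, the last nonzero W is a top generator.\<close>

lemma W_trivial:
  assumes "i \<ge> 1"
  shows "trivial_op (W i)"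
proof (rule ccontr)
  assume nt: "\<not> trivial_op (W i)"
  define Q where "Q k \<longleftrightarrow> (\<exists>i\<ge>1. k = W i)" for k
  obtain k where k: "Q k" "\<not> trivial_op k" "\<And>j. Q j \<Longrightarrow> idx j > idx k \<Longrightarrow> trivial_op j"
    using exists_maximal_nontrivial[of Q "W i"] nt assms unfolding Q_def by blast
  obtain i0 where i0: "i0 \<ge> 1" "k = W i0" using k(1) unfolding Q_def by blast
  have "trivial_op k"
  proof (rule abelian_ideal_trivial)
    show "top_op k" unfolding top_op_def
    proof (intro allI impI)
      fix j assume j: "kind k \<le> kind j" "idx k \<le> idx j" "j \<noteq> k"
      show "trivial_op j"
      proof (cases j)
        case (W l)
        then show ?thesis using k(3)[of j] j i0 unfolding Q_def by auto
      qed (use j i0 G_trivial in auto)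
    qed
    show "wt p k = 0 \<Longrightarrow> \<exists>X Y c. C.lin X \<and> C.lin Y \<and> c \<noteq> 0 \<and>
      (\<forall>x. Y (X x) = X (Y x) + scale [:c:] (op k 0 x)) \<and>
      (\<forall>n x. op k n (X x) = X (op k n x)) \<and> (\<forall>n x. op k n (Y x) = Y (op k n x))"
      using i0 p by simp
  qed (use i0 WW in auto)
  then show False using k(2) by blast
qed

text \<open>The last nonzero L_i with i \<ge> 1 commutes with itself, as the index 2 i is beyond it.
  If it is a current with i \<ge> 2, the two modes whose commutator gives its zero mode commute with
  it for the same reason.\<close>

lemma L_trivial:
  assumes "i \<ge> 1" "\<not> (i = 1 \<and> p = - 1)"
  shows "trivial_op (L i)"
proof (rule ccontr)
  assume nt: "\<not> trivial_op (L i)"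
  define Q where "Q k \<longleftrightarrow> (\<exists>i\<ge>1. k = L i \<and> \<not> (i = 1 \<and> p = - 1))" for k
  obtain k where k: "Q k" "\<not> trivial_op k" "\<And>j. Q j \<Longrightarrow> idx j > idx k \<Longrightarrow> trivial_op j"
    using exists_maximal_nontrivial[of Q "L i"] nt assms unfolding Q_def by blast
  obtain i0 where i0: "i0 \<ge> 1" "k = L i0" "\<not> (i0 = 1 \<and> p = - 1)" using k(1) unfolding Q_def by blast
  have above: "op (L l) n x = 0" if "l > i0" for l n x
    using k(3)[of "L l"] that i0 unfolding Q_def trivial_op_def by auto
  have "trivial_op k"
  proof (rule abelian_ideal_trivial)
    show "top_op k" unfolding top_op_def
    proof (intro allI impI)
      fix j assume j: "kind k \<le> kind j" "idx k \<le> idx j" "j \<noteq> k"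
      show "trivial_op j"
      proof (cases j)
        case (L l)
        then show ?thesis using above j i0 unfolding trivial_op_def by auto
      qed (use j i0 G_trivial W_trivial in auto)
    qed
    show "op k m (op k n x) = op k n (op k m x)" for m n x
      using LL[of i0 m i0 n x] above[of "i0 + i0"] i0 by simp
    assume "wt p k = 0"
    then have pi: "p = - of_nat i0" using i0 p by (simp add: field_simps eq_neg_iff_add_eq_0)
    then have i2: "i0 \<ge> 2" using i0 by (cases "i0 = 1") auto
    show "\<exists>X Y c. C.lin X \<and> C.lin Y \<and> c \<noteq> 0 \<and>
      (\<forall>x. Y (X x) = X (Y x) + scale [:c:] (op k 0 x)) \<and>
      (\<forall>n x. op k n (X x) = X (op k n x)) \<and> (\<forall>n x. op k n (Y x) = Y (op k n x))"
    proof (intro exI conjI allI)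
      show "C.lin (op (L (i0 - 1)) 0)" "C.lin (op (L 1) 1)" by (rule op_lin)+
      show "(- 1 :: complex) \<noteq> 0" by simp
      \<comment> \<open>The factor is j + p with j = i0 - 1 and p = - i0.\<close>
      show "op (L 1) 1 (op (L (i0 - 1)) 0 x) = op (L (i0 - 1)) 0 (op (L 1) 1 x) +
          scale [:- 1:] (op k 0 x)" for x
        using LL[of 1 1 "i0 - 1" 0 x] i2 pi i0 by (simp add: of_nat_diff)
      show "op k n (op (L (i0 - 1)) 0 x) = op (L (i0 - 1)) 0 (op k n x)" for n x
        using LL[of i0 n "i0 - 1" 0 x] above[of "i0 + (i0 - 1)"] i2 i0 by simp
      show "op k n (op (L 1) 1 x) = op (L 1) 1 (op k n x)" for n x
        using LL[of i0 n 1 1 x] above[of "i0 + 1"] i0 by simp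
    qed
  qed
  then show False using k(2) by blast
qed

section \<open>Central zero modes and the lowest weight vector\<close>

lemma op_scalar:
  assumes even: "S_parity k = 0"
    and comm: "\<And>j n x. op j n (op k 0 x) = op k 0 (op j n x)"
  shows "\<exists>c. \<forall>x. op k 0 x = scale [:c:] x"
proof (rule Schur)
  show "op k 0 (scale \<partial> x) = scale \<partial> (op k 0 x)" for x
    using op_partial[of k 0 x] by simp
  show "op k 0 x \<in> gr \<beta>" if "x \<in> gr \<beta>" for \<beta> x
    using parity[OF that, of k 0] unfolding even by (simp only: add_0_left)
qed (use op_lin comm in auto)

text \<open>All brackets with this zero mode that do not involve G carry the factor 1 + p.\<close>

lemma L_odd_commute:
  assumes "p = - 1"
  shows "op j n (op (L 1) 0 x) = op (L 1) 0 (op j n x)"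
proof (cases j)
  case (L i)
  then show ?thesis using LL[of i n 1 0 x] assms by simp
next
  case (W i)
  then show ?thesis using LW[of 1 0 i n x] assms by simp
next
  case (G i)
  then show ?thesis using G_trivial[of i] by (simp add: trivial_op_def op_zero)
qed

lemma W0_commute: "op j n (op (W 0) 0 x) = op (W 0) 0 (op j n x)"
proof (cases j)
  case (L i)
  then show ?thesis using LW[of i n 0 0 x] by simp
next
  case (W i)
  then show ?thesis using WW[of i n 0 0 x] by simp
next
  case (G i)
  then show ?thesis using G_trivial[of i] by (simp add: trivial_op_def op_zero)
qed

text \<open>The equations satisfied by a lowest weight vector pass to its homogeneous components,
  one of which is nonzero. Homogeneity makes the span of v graded, as irreducibility
  requires.\<close>

lemma homogeneous_lowest:
  obtains v \<beta> \<Delta> where "v \<noteq> 0" "v \<in> gr \<beta>" "Lop 1 v = scale [:\<Delta>:] v" "\<forall>m\<ge>2. Lop m v = 0"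
    "\<forall>x e. x \<noteq> 0 \<longrightarrow> Lop 1 x = scale [:e:] x \<longrightarrow> Re \<Delta> \<le> Re e"
proof -
  obtain x0 :: 'v where x0: "x0 \<noteq> 0" using nonzero by blast
  then have "{0} \<noteq> (UNIV :: 'v set)" by blast
  then obtain v \<Delta> where v: "lowest {0} v \<Delta>" using exists_lowest[OF Lstable_zero] by blast
  have v0: "v \<noteq> 0" using v multiples_superset[of "{0}" \<alpha>] by (auto simp: lowest_def)
  have minimal: "Re \<Delta> \<le> Re e" if "x \<noteq> 0" "Lop 1 x = scale [:e:] x" for x e
    using v that by (auto simp: lowest_def)
  define T where "T i x = (if i = 1 then Lop 1 x - scale [:\<Delta>:] x else Lop i x)" for i x
  have "v \<in> {x. \<forall>i\<in>{1..}. T i x = 0}"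
    using v by (auto simp: lowest_def T_def)
  moreover have "Lop i x \<in> gr \<beta>" if "x \<in> gr \<beta>" for i x \<beta>
    unfolding Lop_def using parity[OF that, of "L 0" i]
    by (intro subspace_scale[OF gr_subspace]) (simp only: S_parity.simps add_0_left)
  then have "T i x \<in> gr (0 + \<beta>)" if "x \<in> gr \<beta>" for i x \<beta>
    using that by (simp only: add_0_left) (auto simp: T_def
        intro: subspace_diff[OF gr_subspace] subspace_scale[OF gr_subspace])
  moreover have "T i (x + y) = T i x + T i y" for i x y
    by (simp add: T_def Lop_add scale_right_distrib)
  ultimately obtain x y where xy: "x \<in> {x. \<forall>i\<in>{1..}. T i x = 0} \<inter> gr 0"
    "y \<in> {x. \<forall>i\<in>{1..}. T i x = 0} \<inter> gr 1" "v = x + y"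
    using graded_kernel[of "{1..}" T "\<lambda>_. 0" v] by blast
  have "\<exists>u \<beta>. u \<noteq> 0 \<and> u \<in> gr \<beta> \<and> (\<forall>i\<in>{1..}. T i u = 0)"
    using xy v0 by (cases "x = 0") auto
  then obtain u \<beta> where u: "u \<noteq> 0" "u \<in> gr \<beta>" "\<And>i. i \<ge> 1 \<Longrightarrow> T i u = 0" by auto
  show thesis
  proof (rule that[OF u(1,2)])
    show "Lop 1 u = scale [:\<Delta>:] u" using u(3)[of 1] by (simp add: T_def)
    show "\<forall>m\<ge>2. Lop m u = 0"
    proof (intro allI impI)
      fix m :: nat assume "m \<ge> 2"
      then show "Lop m u = 0" using u(3)[of m] by (simp add: T_def)
    qed
  qed (use minimal in blast)
qed

theorem cyclic: "\<exists>v. v \<noteq> 0 \<and> (\<forall>x. \<exists>q. x = scale q v)"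
proof -
  obtain v \<beta> \<Delta> where v: "v \<noteq> 0" "v \<in> gr \<beta>" "Lop 1 v = scale [:\<Delta>:] v"
    "\<forall>m\<ge>2. Lop m v = 0"
    "\<forall>x e. x \<noteq> 0 \<longrightarrow> Lop 1 x = scale [:e:] x \<longrightarrow> Re \<Delta> \<le> Re e"
    using homogeneous_lowest .
  \<comment> \<open>A positive mode of a current lowers the L_(1)-eigenvalue by m, below the
    minimum.\<close>
  have neg: "op k m v = 0" if "wt p k = 0" "m \<ge> 1" for k m
  proof (rule ccontr)
    assume nz: "op k m v \<noteq> 0"
    have "Lop 1 (op k m v) = scale [:\<Delta> - of_nat m:] (op k m v)"
      unfolding Lop_op v(3) op_const using that(1)
      by (simp flip: scale_left_distrib scale_left_diff_distrib)
    then have "Re \<Delta> \<le> Re (\<Delta> - of_nat m)" using v(5) nz by blast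
    then show False using that(2) by simp
  qed
  have current: "\<exists>q. op k n v = scale q v"
    if k: "wt p k = 0" "S_parity k = 0" "\<And>j n x. op j n (op k 0 x) = op k 0 (op j n x)" for k n
  proof (cases "n = 0")
    case True
    then show ?thesis using op_scalar[OF k(2,3)] by blast
  next
    case False
    then show ?thesis using neg[OF k(1), of n] by (intro exI[of _ 0]) auto
  qed
  have opv: "\<exists>q. op k n v = scale q v" for k n
  proof (cases "trivial_op k")
    case True
    then show ?thesis by (intro exI[of _ 0]) (simp add: trivial_op_def)
  next
    case False
    then consider "k = L 0" | "k = L 1" "p = - 1" | "k = W 0"
      using G_trivial W_trivial L_trivial
      by (cases k) (metis One_nat_def less_one not_less)+
    then show ?thesis
    proof cases
      case 1
      consider "n = 0" | "n = 1" | "n \<ge> 2" by linarith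
      then have "\<exists>q. Lop n v = scale q v"
      proof cases
        case 3
        then show ?thesis using v(4) by (intro exI[of _ 0]) simp
      qed (use v(3) Lop_0 in auto)
      then show ?thesis unfolding 1 op_L0 by (metis scale_scale)
    next
      case 2
      then show ?thesis using L_odd_commute by (intro current) auto
    next
      case 3
      then show ?thesis using W0_commute by (intro current) auto
    qed
  qed
  have range_eq: "range (\<lambda>q. scale q v) = span {v}" by (simp add: span_singleton)
  have "span {v} = {0} \<or> span {v} = UNIV"
  proof (rule irred)
    show "\<exists>x\<in>span {v} \<inter> gr 0. \<exists>y\<in>span {v} \<inter> gr 1. u = x + y" if "u \<in> span {v}" for u
    proof -
      have "u \<in> gr \<beta>"
        using that v(2) subspace_scale[OF gr_subspace] unfolding range_eq[symmetric] by blast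
      moreover have "0 \<in> span {v}" "0 \<in> gr \<gamma>" for \<gamma> using span_zero subspace_0[OF gr_subspace] by auto
      moreover have "\<beta> = 0 \<or> \<beta> = 1" by (cases \<beta>) auto
      ultimately show ?thesis using that
        by (metis IntI add.left_neutral add.right_neutral)
    qed
    show "op k n u \<in> span {v}" if u: "u \<in> span {v}" for k n u
    proof -
      have "v \<in> {x. \<forall>n. op k n x \<in> span {v}}"
        using opv[of k] unfolding range_eq[symmetric] by blast
      moreover have "subspace {x. \<forall>n. op k n x \<in> span {v}}"
        by (rule subspace_preimage[OF conf]) simp
      ultimately have "span {v} \<subseteq> {x. \<forall>n. op k n x \<in> span {v}}"
        by (intro span_minimal) simp_all
      then show ?thesis using u by blast
    qed
  qed simp
  moreover have "v \<in> span {v}" by (simp add: span_base)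
  ultimately have "span {v} = UNIV" using v(1) by blast
  then show ?thesis using v(1) unfolding range_eq[symmetric] by blast
qed

end

section \<open>From the modes of the generators back to the algebra\<close>

context conformal_module
begin

lemma nprod_partial_left:
  "nprod (scaleS \<partial> a) n v = scaleV [:- of_nat n:] (nprod a (n - 1) v)"
proof (rule V.eg_inj[where f = "\<lambda>n. nprod (scaleS \<partial> a) n v"])
  let ?g = "\<lambda>n. scaleV [:of_nat n:] (nprod a (n - 1) v)"
  have fin: "V.finsupp ?g" by (intro V.finsupp_shift finsupp_nprod)
  then show "V.finsupp (\<lambda>n. scaleV [:- of_nat n:] (nprod a (n - 1) v))"
    by (rule V.finsupp_zero_case) auto
  show "V.eg (\<lambda>n. nprod (scaleS \<partial> a) n v) l = V.eg (\<lambda>n. scaleV [:- of_nat n:] (nprod a (n - 1) v)) l" for l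
  proof -
    have "V.eg (\<lambda>n. nprod (scaleS \<partial> a) n v) l = scaleV [:- 1:] (scaleV [:l:] (act_at a l v))"
      unfolding act_at_eg[symmetric] using act_partial_left[of a v l] by (simp add: act_at_def)
    also have "\<dots> = scaleV [:- 1:] (V.eg ?g l)"
      unfolding act_at_eg V.eg_shift[OF finsupp_nprod] ..
    also have "\<dots> = V.eg (\<lambda>n. scaleV [:- 1:] (?g n)) l" by (rule V.eg_scale[OF fin])
    finally show ?thesis by simp
  qed
qed (rule finsupp_nprod)

text \<open>Lets conditions on the modes be checked on a basis only: a submodule of S containing all
  \<open>e k\<close> is S.\<close>

lemma subspace_stabilizer:
  assumes U: "V.subspace U"
  shows "S.subspace {a. \<forall>x\<in>D. \<forall>n. nprod a n x \<in> U}"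
proof -
  interpret PS: poly_module scaleS ..
  show ?thesis
  proof (rule PS.subspace_closedI)
    have "nprod 0 n x = 0" for n x using nprod_const_left[of 0 0 n x] by simp
    then show "PS.C.subspace {a. \<forall>x\<in>D. \<forall>n. nprod a n x \<in> U}"
      unfolding PS.C.subspace_def
      using V.subspace_0[OF U] V.subspace_add[OF U] V.subspace_scale[OF U]
      by (simp add: nprod_add_left nprod_const_left)
    show "scaleS \<partial> a \<in> {a. \<forall>x\<in>D. \<forall>n. nprod a n x \<in> U}" if "a \<in> {a. \<forall>x\<in>D. \<forall>n. nprod a n x \<in> U}" for a
      using that V.subspace_scale[OF U] V.subspace_neg[OF U] by (simp add: nprod_partial_left)
  qed
qed

end

lemma (in graded_module) has_rank_1_if_cyclic:
  assumes tf: "\<And>q x. q \<noteq> 0 \<Longrightarrow> scale q x = 0 \<Longrightarrow> x = 0"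
    and v: "v \<noteq> 0" "\<And>x. \<exists>q. x = scale q v"
  shows "free_module \<and> has_rank UNIV 1"
proof -
  have ind: "independent {v}"
  proof -
    have "\<forall>t\<subseteq>{v}. finite t \<longrightarrow> (\<forall>u. (\<Sum>w\<in>t. scale (u w) w) = 0 \<longrightarrow> (\<forall>w\<in>t. u w = 0))"
      using tf v(1) by (auto simp: subset_singleton_iff)
    then show ?thesis unfolding independent_explicit_module by blast
  qed
  moreover have "span {v} = UNIV" unfolding span_singleton using v(2) by auto
  ultimately have "free_module" unfolding free_module_def by blast
  moreover have "finite B \<and> card B \<le> 1" if B: "independent B" for B
  proof -
    have "x = y" if xy: "x \<in> B" "y \<in> B" for x y
    proof (rule ccontr)
      assume ne: "x \<noteq> y"
      obtain a where a: "x = scale a v" using v(2) by blast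
      obtain b where b: "y = scale b v" using v(2) by blast
      \<comment> \<open>The relation b (a v) - a (b v) = 0 between two multiples of v.\<close>
      define u where "u w = (if w = x then b else - a)" for w
      have "(\<Sum>w\<in>{x, y}. scale (u w) w) = 0"
        using ne by (simp add: u_def) (simp add: a b mult.commute)
      then have "u x = 0" by (rule independentD[OF B, of "{x, y}" u x, rotated 2]) (use xy in auto)
      then have "y = 0" using b by (simp add: u_def)
      then show False using B xy(2) dependent_zero by blast
    qed
    then have "B = {} \<or> (\<exists>x. B = {x})" by blast
    then show ?thesis by auto
  qed
  then have "has_rank UNIV 1" unfolding has_rank_def using ind by (auto intro: exI[of _ "{v}"])
  ultimately show ?thesis by blast
qed

theorem lemma4p7:
  fixes p :: complex
    and scaleS :: "complex poly \<Rightarrow> 's::ab_group_add \<Rightarrow> 's" and grS :: "bit \<Rightarrow> 's set"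
    and br :: "'s \<Rightarrow> 's \<Rightarrow> 's poly" and e :: "S_index \<Rightarrow> 's"
    and scaleV :: "complex poly \<Rightarrow> 'v::ab_group_add \<Rightarrow> 'v" and grV :: "bit \<Rightarrow> 'v set"
    and act :: "'s \<Rightarrow> 'v \<Rightarrow> 'v poly"
  assumes "p \<noteq> 0"
    and "S_algebra scaleS grS br p e"
    and "conformal_module scaleS grS br scaleV grV act"
    and "graded_module.finitely_generated scaleV"
    and "conformal_module.non_trivial act"
    and "conformal_module.irreducible scaleV grV act"
  shows "graded_module.free_module scaleV \<and>
    (graded_module.has_rank scaleV UNIV 1 \<or>
     graded_module.has_rank scaleV (grV 0) 1 \<and> graded_module.has_rank scaleV (grV 1) 1)"
proof -
  interpret A: S_algebra scaleS grS br p e by fact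
  interpret M: conformal_module scaleS grS br scaleV grV act by fact
  define op where "op k = M.nprod (e k)" for k
  have sign: "parity_sign 0 \<beta> = 1" "parity_sign \<beta> 0 = 1" "parity_sign 1 1 = - 1" for \<beta>
    by (simp_all add: parity_sign_def)
  have par: "e k \<in> grS (S_parity k)" for k by (rule A.e_parity)
  \<comment> \<open>In \<open>nprod_commutator\<close>, B = i + p and C - B = j + p; for W below, C
    - B = j.\<close>
  have LL: "op (L i) m (op (L j) n x) = op (L j) n (op (L i) m x) +
      scaleV [:of_nat m * (of_nat j + p) - of_nat n * (of_nat i + p):] (op (L (i + j)) (m + n - 1) x)"
    for i j m n x
    using M.nprod_commutator[OF par[of "L i"] par[of "L j"], of "of_nat i + p"
        "of_nat i + of_nat j + 2 * p" 0 "e (L (i + j))" m n x] A.br_L_L[of i _ j]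
    by (simp add: A.br_at_def op_def sign algebra_simps)
  have LW: "op (L i) m (op (W j) n x) = op (W j) n (op (L i) m x) +
      scaleV [:of_nat m * of_nat j - of_nat n * (of_nat i + p):] (op (W (i + j)) (m + n - 1) x)"
    for i j m n x
    using M.nprod_commutator[OF par[of "L i"] par[of "W j"], of "of_nat i + p"
        "of_nat i + of_nat j + p" 0 "e (W (i + j))" m n x] A.br_L_W[of i _ j]
    by (simp add: A.br_at_def op_def sign algebra_simps)
  have LG: "op (L i) m (op (G j) n x) = op (G j) n (op (L i) m x) +
      scaleV [:of_nat m * (of_nat j + p) - of_nat n * (of_nat i + p):] (op (G (i + j)) (m + n - 1) x)"
    for i j m n x
    using M.nprod_commutator[OF par[of "L i"] par[of "G j"], of "of_nat i + p"
        "of_nat i + of_nat j + 2 * p" 0 "e (G (i + j))" m n x] A.br_L_G[of i _ j]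
    by (simp add: A.br_at_def op_def sign algebra_simps)
  have WG: "op (W i) m (op (G j) n x) = op (G j) n (op (W i) m x) + op (G (i + j)) (m + n) x"
    for i j m n x
    using M.nprod_commutator[OF par[of "W i"] par[of "G j"], of 0 0 1 "e (G (i + j))" m n x]
      A.br_W_G[of i _ j]
    by (simp add: A.br_at_def op_def sign algebra_simps flip: one_pCons)
  have WW: "op (W i) m (op (W j) n x) = op (W j) n (op (W i) m x)" for i j m n x
    using M.nprod_commutator[OF par[of "W i"] par[of "W j"], of 0 0 0 0 m n x] A.br_W_W[of i _ j]
    by (simp add: A.br_at_def op_def sign)
  have GG: "op (G i) m (op (G j) n x) = - op (G j) n (op (G i) m x)" for i j m n x
    using M.nprod_commutator[OF par[of "G i"] par[of "G j"], of 0 0 0 0 m n x] A.br_G_G[of i _ j]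
    by (simp add: A.br_at_def op_def sign eq_neg_iff_add_eq_0)
  \<comment> \<open>\<open>submodule\<close> asks for invariance under all of S, whereas
    \<open>irred\<close> speaks of the generators.\<close>
  have generated: "coeff (act a x) n \<in> U"
    if U: "M.V.subspace U" and x: "x \<in> U" and ops: "\<And>k n x. x \<in> U \<Longrightarrow> op k n x \<in> U" for a U x n
  proof -
    have sub: "A.subspace {a. \<forall>x\<in>U. \<forall>n. M.nprod a n x \<in> U}"
      by (rule M.subspace_stabilizer[OF U])
    have "range e \<subseteq> {a. \<forall>x\<in>U. \<forall>n. M.nprod a n x \<in> U}" using ops by (auto simp: op_def)
    then have "a \<in> {a. \<forall>x\<in>U. \<forall>n. M.nprod a n x \<in> U}"
      using A.span_minimal[OF _ sub] A.e_span by blast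
    then have "M.nprod a n x \<in> U" using x by blast
    then have "scaleV [:1 / fact n:] (M.nprod a n x) \<in> U" by (rule M.V.subspace_scale[OF U])
    then show ?thesis by (simp add: M.nprod_def flip: one_pCons)
  qed
  interpret O: S_module_ops scaleV grV op p
  proof
    show "\<exists>B. finite B \<and> M.V.span B = UNIV" using assms(4) by (simp add: M.V.finitely_generated_def)
    show "M.V.conformal_op (op k)" for k unfolding op_def by (rule M.conformal_op_nprod)
    show "op k n x \<in> grV (S_parity k + \<beta>)" if "x \<in> grV \<beta>" for k n x \<beta>
      unfolding op_def M.nprod_def
      by (intro M.V.subspace_scale[OF M.V.subspace_gr] M.act_parity[OF par that])
    show "U = {0} \<or> U = UNIV"
      if "M.V.subspace U" "\<And>v. v \<in> U \<Longrightarrow> \<exists>x\<in>U \<inter> grV 0. \<exists>y\<in>U \<inter> grV 1. v = x + y"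
        "\<And>k n x. x \<in> U \<Longrightarrow> op k n x \<in> U" for U
      using assms(6) that generated[OF that(1) _ that(3)]
      unfolding M.irreducible_def M.submodule_def by blast
    show "\<exists>k n x. op k n x \<noteq> 0"
    proof (rule ccontr)
      assume "\<not> (\<exists>k n x. op k n x \<noteq> 0)"
      then have z: "op k n x = 0" for k n x by blast
      have sub: "A.subspace {a. \<forall>x n. M.nprod a n x = 0}"
        using M.subspace_stabilizer[OF M.V.subspace_single_0, of UNIV] by simp
      have "range e \<subseteq> {a. \<forall>x n. M.nprod a n x = 0}" using z by (auto simp: op_def)
      then have "M.nprod a n x = 0" for a n x
        using A.span_minimal[OF _ sub] A.e_span by blast
      then have "act a x = 0" for a x by (simp add: M.nprod_eq_0_iff poly_eq_iff)
      then show False using assms(5) by (simp add: M.non_trivial_def)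
    qed
  qed (fact assms(1) M.V.subspace_gr M.V.gr_disjoint M.V.gr_sum LL LW LG WG WW GG)+
  obtain v where "v \<noteq> 0" "\<And>x. \<exists>q. x = scaleV q v" using O.cyclic by blast
  then have "M.V.free_module \<and> M.V.has_rank UNIV 1"
    using M.V.has_rank_1_if_cyclic M.V.saturatedD[OF O.torsion_free] by blast
  then show ?thesis by blast
qed

end
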